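(* (Generalization to solids with spin-orbit coupling.) Let $d\ge1$ and let $G$ be a double symmorphic magnetic space group in $\mathbb{R}^d$ with broken time-reversal symmetry. Consider a simple band of spinor Bloch functions with $G$ symmetry whose projection operator is analytic throughout the Brillouin torus $T^d$. Then the simple band is a band representation of $G$ if and only if it is topologically trivial as a complex vector bundle of rank one over $T^d$. (The latter condition is known to be equivalent to the vanishing of the first Chern class of this line bundle.)
   Context: Groups. $BL\subset\mathbb{R}^d$ is a full-rank lattice (Bravais lattice), $RL=\{K: K\cdot R\in2\pi\mathbb{Z}\ \forall R\in BL\}$, and $T^d=\mathbb{R}^d/RL$ is the Brillouin torus, with volume $|T^d|$. The double point group $\mathcal P$ is a finite group with a homomorphism $p\mapsto(\check p,s_p)\in O(d)\times\{\pm1\}$ with $\check p\,BL=BL$, whose kernel is $\{E,\bar E\}$, where $E$ is the identity and $\bar E\ne E$ corresponds to a $2\pi$ rotation ($\bar E^2=E$, $\bar E$ central); $s_p=-1$ means that $p$ involves time reversal. Broken time-reversal symmetry means that no $p\in\mathcal P$ has $\check p$ equal to the identity matrix and $s_p=-1$. The double symmorphic magnetic space group is $G=\{(p|R):p\in\mathcal P,R\in BL\}$ with $(q|R')(p|R)=(qp|\check qR+R')$, acting on space by $(p|R)\circ r=\check pr+R$. $V_0$ is a finite-dimensional complex Hilbert space (spinor space) on which $\mathcal P$ acts by operators $D_p$ with $D_qD_p=D_{qp}$, $D_p$ unitary if $s_p=1$ and antiunitary if $s_p=-1$, and $D_{\bar E}=-1$. For $g=(p|R)$ the operator $\hat g$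 acts on spinor functions $f:\mathbb{R}^d\to V_0$ by $(\hat gf)(r)=D_pf(g^{-1}\circ r)$. Simple bands. A Bloch function with wavevector $k$ is a locally square-integrable $\psi_k:\mathbb{R}^d\to V_0$ with $\psi_k(r+R)=e^{ik\cdot R}\psi_k(r)$ for $R\in BL$. A simple band with $G$ symmetry assigns to each $k\in\mathbb{R}^d$ a one-dimensional space spanned by a Bloch function $\psi_k$ normalized over a unit cell (phase not fixed), such that $P(k)=|\psi_k\rangle\langle\psi_k|$ satisfies $P(k+K)=P(k)$ for $K\in RL$, and for every $g=(p|R)\in G$ and $k$ there is $\rho_g(k)\in U(1)$ with $\hat g\psi_k=\rho_g(k)\psi_{s_p\check pk}$. The projection is analytic if $e^{-ik\cdot r}P(k)e^{ik\cdot r}$, an operator on $L^2(\mathbb{R}^d/BL;V_0)$, is real-analytic in $k\in\mathbb{R}^d$. A choice of $\psi_k$ is continuous (analytic) if $k\mapsto e^{-ik\cdot r}\psi_k\in L^2(\mathbb{R}^d/BL;V_0)$ is continuous (real-analytic), and periodic if $\psi_{k+K}=\psi_k$ for $K\in RL$. The band is topologically trivial if the normalized $\psi_k$ can be chosen continuous and periodic. Band representations. For $\varpi\in\mathbb{R}^d$, $G_\varpi=\{g\in G:g\circ\varpi=\varpi\}$ is the site stabilizer, and $\varpi$ has unit multiplicity if $g\circ\varpi-\varpi\in BL$ for all $g\in G$. If $\psi_k$ is analytic and periodic, the Wannier functions are $w_R(r)=|T^d|^{-1/2}\int_{T^d}e^{-ik\cdot R}\psi_k(r)\,dk$, $R\in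 BL$. The simple band is a band representation of $G$ if there exist an analytic and periodic choice of $\psi_k$ and a point $\varpi$ of unit multiplicity such that for every $R\in BL$ and every $g\in G_{\varpi+R}$, $\hat gw_R$ is a unimodular scalar multiple of $w_R$. *)

theory Defs
  imports "HOL-Analysis.Analysis" "HOL-Algebra.Group" "HOL-Library.Function_Algebras"
begin

section \<open>Lattices\<close>

definition lattice_basis :: "real^'d^'d \<Rightarrow> (real^'d) set \<Rightarrow> bool" where
  "lattice_basis A L \<longleftrightarrow>
     invertible A \<and> L = range (\<lambda>n :: 'd \<Rightarrow> int. A *v (\<chi> i. of_int (n i)))"

definition full_rank_lattice :: "(real^'d) set \<Rightarrow> bool" where
  "full_rank_lattice L \<longleftrightarrow> (\<exists>A. lattice_basis A L)"

definition reciprocal_lattice :: "(real^'d) set \<Rightarrow> (real^'d) set" where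
  "reciprocal_lattice BL = {K. \<forall>R\<in>BL. \<exists>n::int. K \<bullet> R = 2 * pi * of_int n}"

text \<open>
  A half-open fundamental parallelepiped. Quotients by a lattice are represented by
  lattice-periodic functions, integrated over this cell; for periodic integrands the integral
  does not depend on the basis that is picked.
\<close>

definition unit_cell :: "(real^'d) set \<Rightarrow> (real^'d) set" where
  "unit_cell L = (\<lambda>x. (SOME A. lattice_basis A L) *v x) ` {x. \<forall>i. 0 \<le> x $ i \<and> x $ i < 1}"

section \<open>Real-analytic maps\<close>

text \<open>
  Real vector space structure on functions, used for power series whose coefficients are
  functions or operators on functions.
\<close>

instantiation "fun" :: (type, scaleR) scaleR
begin
definition scaleR_fun :: "real \<Rightarrow> ('a \<Rightarrow> 'b) \<Rightarrow> 'a \<Rightarrow> 'b" where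
  "scaleR_fun c f = (\<lambda>x. c *\<^sub>R f x)"
instance ..
end

instance "fun" :: (type, real_vector) real_vector
  by standard (auto simp: scaleR_fun_def fun_eq_iff scaleR_add_left scaleR_add_right)

text \<open>
  Real analyticity with values in a space \<open>V\<close> whose topology is given by a seminorm \<open>N\<close>
  (null vectors of \<open>N\<close> are identified with \<open>0\<close>): near every point, \<open>f\<close> is the sum of an
  unordered power series indexed by multi-indices.
\<close>

definition real_analytic_wrt ::
    "'v::real_vector set \<Rightarrow> ('v \<Rightarrow> real) \<Rightarrow> (real^'d \<Rightarrow> 'v) \<Rightarrow> bool" where
  "real_analytic_wrt V N f \<longleftrightarrow>
     (\<forall>k0. \<exists>c :: ('d \<Rightarrow> nat) \<Rightarrow> 'v. \<exists>\<rho>>0. (\<forall>\<alpha>. c \<alpha> \<in> V) \<and>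
        (\<forall>k\<in>ball k0 \<rho>.
           ((\<lambda>S. N (f k - (\<Sum>\<alpha>\<in>S. (\<Prod>i\<in>UNIV. (k $ i - k0 $ i) ^ \<alpha> i) *\<^sub>R c \<alpha>))) \<longlongrightarrow> 0)
             (finite_subsets_at_top UNIV)))"

section \<open>Spinor functions\<close>

text \<open>The spinor space is \<open>complex^'m\<close> with its standard Hermitian inner product.\<close>

definition herm_inner :: "complex^'m \<Rightarrow> complex^'m \<Rightarrow> complex" where
  "herm_inner u v = (\<Sum>i\<in>UNIV. cnj (u $ i) * v $ i)"

definition unitary_op :: "(complex^'m \<Rightarrow> complex^'m) \<Rightarrow> bool" where
  "unitary_op U \<longleftrightarrow> bij U \<and> (\<forall>u v. U (u + v) = U u + U v) \<and> (\<forall>c u. U (c *s u) = c *s U u) \<and>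
     (\<forall>u v. herm_inner (U u) (U v) = herm_inner u v)"

definition antiunitary_op :: "(complex^'m \<Rightarrow> complex^'m) \<Rightarrow> bool" where
  "antiunitary_op U \<longleftrightarrow> bij U \<and> (\<forall>u v. U (u + v) = U u + U v) \<and> (\<forall>c u. U (c *s u) = cnj c *s U u) \<and>
     (\<forall>u v. herm_inner (U u) (U v) = cnj (herm_inner u v))"

text \<open>
  Elements of \<open>L\<^sup>2\<close> spaces are represented by Borel functions, and all identities between them
  are required almost everywhere.
\<close>

definition locally_square_integrable :: "(real^'d \<Rightarrow> complex^'m) \<Rightarrow> bool" where
  "locally_square_integrable f \<longleftrightarrow> f \<in> borel_measurable borel \<and>
     (\<forall>S. compact S \<longrightarrow> set_integrable lborel S (\<lambda>r. (norm (f r))\<^sup>2))"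

definition cell_inner :: "(real^'d) set \<Rightarrow> (real^'d \<Rightarrow> complex^'m) \<Rightarrow> (real^'d \<Rightarrow> complex^'m) \<Rightarrow> complex" where
  "cell_inner BL f g = (LINT r:unit_cell BL|lborel. herm_inner (f r) (g r))"

definition cell_norm :: "(real^'d) set \<Rightarrow> (real^'d \<Rightarrow> complex^'m) \<Rightarrow> real" where
  "cell_norm BL f = sqrt (LINT r:unit_cell BL|lborel. (norm (f r))\<^sup>2)"

definition bloch_function :: "(real^'d) set \<Rightarrow> real^'d \<Rightarrow> (real^'d \<Rightarrow> complex^'m) \<Rightarrow> bool" where
  "bloch_function BL k f \<longleftrightarrow> locally_square_integrable f \<and>
     (\<forall>R\<in>BL. AE r in lborel. f (r + R) = cis (k \<bullet> R) *s f r)"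

text \<open>
  \<open>L\<^sup>2(\<real>\<^sup>d/BL; V\<^sub>0)\<close>, with seminorm \<open>cell_norm\<close>: lattice-periodic functions are the Bloch functions
  with wavevector \<open>0\<close>.
\<close>

definition torus_L2 :: "(real^'d) set \<Rightarrow> (real^'d \<Rightarrow> complex^'m) set" where
  "torus_L2 BL = {f. bloch_function BL 0 f}"

definition torus_bounded_ops :: "(real^'d) set \<Rightarrow> ((real^'d \<Rightarrow> complex^'m) \<Rightarrow> real^'d \<Rightarrow> complex^'m) set" where
  "torus_bounded_ops BL = {T. (\<forall>f\<in>torus_L2 BL. T f \<in> torus_L2 BL) \<and>
     (\<forall>f\<in>torus_L2 BL. \<forall>g\<in>torus_L2 BL. \<forall>a b. AE r in lborel.
        T (\<lambda>x. a *s f x + b *s g x) r = a *s T f r + b *s T g r) \<and>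
     (\<exists>C. \<forall>f\<in>torus_L2 BL. cell_norm BL (T f) \<le> C * cell_norm BL f)}"

definition torus_op_norm :: "(real^'d) set \<Rightarrow> ((real^'d \<Rightarrow> complex^'m) \<Rightarrow> real^'d \<Rightarrow> complex^'m) \<Rightarrow> real" where
  "torus_op_norm BL T = (SUP f \<in> {f \<in> torus_L2 BL. cell_norm BL f \<le> 1}. cell_norm BL (T f))"

section \<open>Double symmorphic magnetic space groups\<close>

definition double_point_group ::
    "'p monoid \<Rightarrow> ('p \<Rightarrow> real^'d^'d) \<Rightarrow> ('p \<Rightarrow> real) \<Rightarrow> 'p \<Rightarrow> (real^'d) set \<Rightarrow> bool" where
  "double_point_group P ch s Ebar BL \<longleftrightarrow>
     group P \<and> finite (carrier P) \<and>
     (\<forall>p\<in>carrier P. orthogonal_matrix (ch p) \<and> s p \<in> {1, -1} \<and> (\<lambda>R. ch p *v R) ` BL = BL) \<and>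
     (\<forall>q\<in>carrier P. \<forall>p\<in>carrier P.
        ch (q \<otimes>\<^bsub>P\<^esub> p) = ch q ** ch p \<and> s (q \<otimes>\<^bsub>P\<^esub> p) = s q * s p) \<and>
     {p \<in> carrier P. ch p = mat 1 \<and> s p = 1} = {\<one>\<^bsub>P\<^esub>, Ebar} \<and> Ebar \<noteq> \<one>\<^bsub>P\<^esub> \<and>
     Ebar \<otimes>\<^bsub>P\<^esub> Ebar = \<one>\<^bsub>P\<^esub> \<and> (\<forall>p\<in>carrier P. Ebar \<otimes>\<^bsub>P\<^esub> p = p \<otimes>\<^bsub>P\<^esub> Ebar)"

definition broken_time_reversal :: "'p monoid \<Rightarrow> ('p \<Rightarrow> real^'d^'d) \<Rightarrow> ('p \<Rightarrow> real) \<Rightarrow> bool" where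
  "broken_time_reversal P ch s \<longleftrightarrow> \<not> (\<exists>p\<in>carrier P. ch p = mat 1 \<and> s p = -1)"

definition spinor_representation ::
    "'p monoid \<Rightarrow> ('p \<Rightarrow> real) \<Rightarrow> 'p \<Rightarrow> ('p \<Rightarrow> complex^'m \<Rightarrow> complex^'m) \<Rightarrow> bool" where
  "spinor_representation P s Ebar D \<longleftrightarrow>
     (\<forall>q\<in>carrier P. \<forall>p\<in>carrier P. D q \<circ> D p = D (q \<otimes>\<^bsub>P\<^esub> p)) \<and>
     (\<forall>p\<in>carrier P. (s p = 1 \<longrightarrow> unitary_op (D p)) \<and> (s p = -1 \<longrightarrow> antiunitary_op (D p))) \<and>
     (\<forall>v. D Ebar v = - v)"

definition space_group ::
    "'p monoid \<Rightarrow> ('p \<Rightarrow> real^'d^'d) \<Rightarrow> (real^'d) set \<Rightarrow> ('p \<times> (real^'d)) monoid" where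
  "space_group P ch BL =
     \<lparr>carrier = carrier P \<times> BL,
      monoid.mult = (\<lambda>(q, R') (p, R). (q \<otimes>\<^bsub>P\<^esub> p, ch q *v R + R')),
      one = (\<one>\<^bsub>P\<^esub>, 0)\<rparr>"

definition space_act :: "('p \<Rightarrow> real^'d^'d) \<Rightarrow> 'p \<times> (real^'d) \<Rightarrow> real^'d \<Rightarrow> real^'d" where
  "space_act ch g r = ch (fst g) *v r + snd g"

definition spinor_act ::
    "'p monoid \<Rightarrow> ('p \<Rightarrow> real^'d^'d) \<Rightarrow> (real^'d) set \<Rightarrow> ('p \<Rightarrow> complex^'m \<Rightarrow> complex^'m) \<Rightarrow>
     'p \<times> (real^'d) \<Rightarrow> (real^'d \<Rightarrow> complex^'m) \<Rightarrow> real^'d \<Rightarrow> complex^'m" where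
  "spinor_act P ch BL D g f =
     (\<lambda>r. D (fst g) (f (space_act ch (inv\<^bsub>space_group P ch BL\<^esub> g) r)))"

definition site_stabilizer ::
    "'p monoid \<Rightarrow> ('p \<Rightarrow> real^'d^'d) \<Rightarrow> (real^'d) set \<Rightarrow> real^'d \<Rightarrow> ('p \<times> (real^'d)) set" where
  "site_stabilizer P ch BL w = {g \<in> carrier (space_group P ch BL). space_act ch g w = w}"

definition unit_multiplicity ::
    "'p monoid \<Rightarrow> ('p \<Rightarrow> real^'d^'d) \<Rightarrow> (real^'d) set \<Rightarrow> real^'d \<Rightarrow> bool" where
  "unit_multiplicity P ch BL w \<longleftrightarrow>
     (\<forall>g\<in>carrier (space_group P ch BL). space_act ch g w - w \<in> BL)"

section \<open>Simple bands\<close>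

definition ae_span :: "(real^'d \<Rightarrow> complex^'m) \<Rightarrow> (real^'d \<Rightarrow> complex^'m) set" where
  "ae_span \<phi> = {f \<in> borel_measurable borel. \<exists>c. AE r in lborel. f r = c *s \<phi> r}"

text \<open>A band is a family \<open>B\<close> of spaces of Bloch functions; a choice picks unit vectors in them.\<close>

definition band_choice ::
    "(real^'d) set \<Rightarrow> (real^'d \<Rightarrow> (real^'d \<Rightarrow> complex^'m) set) \<Rightarrow> (real^'d \<Rightarrow> real^'d \<Rightarrow> complex^'m) \<Rightarrow> bool" where
  "band_choice BL B \<psi> \<longleftrightarrow> (\<forall>k. \<psi> k \<in> B k \<and> cell_norm BL (\<psi> k) = 1)"

text \<open>
  The projection \<open>|\<psi>\<rangle>\<langle>\<psi>|\<close> onto the line \<open>V\<close>; up to null sets it does not depend on the unit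
  vector \<open>\<psi>\<close> of \<open>V\<close> that is picked.
\<close>

definition line_projection ::
    "(real^'d) set \<Rightarrow> (real^'d \<Rightarrow> complex^'m) set \<Rightarrow> (real^'d \<Rightarrow> complex^'m) \<Rightarrow> real^'d \<Rightarrow> complex^'m" where
  "line_projection BL V f =
     (let \<psi> = (SOME \<psi>. \<psi> \<in> V \<and> cell_norm BL \<psi> = 1) in (\<lambda>r. cell_inner BL \<psi> f *s \<psi> r))"

definition simple_band ::
    "'p monoid \<Rightarrow> ('p \<Rightarrow> real^'d^'d) \<Rightarrow> ('p \<Rightarrow> real) \<Rightarrow> (real^'d) set \<Rightarrow>
     ('p \<Rightarrow> complex^'m \<Rightarrow> complex^'m) \<Rightarrow> (real^'d \<Rightarrow> (real^'d \<Rightarrow> complex^'m) set) \<Rightarrow> bool" where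
  "simple_band P ch s BL D B \<longleftrightarrow>
     (\<forall>k. \<exists>\<phi>. bloch_function BL k \<phi> \<and> cell_norm BL \<phi> = 1 \<and> B k = ae_span \<phi>) \<and>
     (\<forall>k. \<forall>K\<in>reciprocal_lattice BL. \<forall>f. bloch_function BL k f \<longrightarrow>
        (AE r in lborel. line_projection BL (B (k + K)) f r = line_projection BL (B k) f r)) \<and>
     (\<forall>\<psi>. band_choice BL B \<psi> \<longrightarrow>
        (\<forall>g\<in>carrier (space_group P ch BL). \<forall>k. \<exists>\<rho>. norm \<rho> = 1 \<and>
           (AE r in lborel. spinor_act P ch BL D g (\<psi> k) r =
              \<rho> *s \<psi> (s (fst g) *\<^sub>R (ch (fst g) *v k)) r)))"

definition analytic_projection ::
    "(real^'d) set \<Rightarrow> (real^'d \<Rightarrow> (real^'d \<Rightarrow> complex^'m) set) \<Rightarrow> bool" where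
  "analytic_projection BL B \<longleftrightarrow>
     real_analytic_wrt (torus_bounded_ops BL) (torus_op_norm BL)
       (\<lambda>k f r. cis (- (k \<bullet> r)) *s line_projection BL (B k) (\<lambda>x. cis (k \<bullet> x) *s f x) r)"

definition periodic_part :: "(real^'d \<Rightarrow> real^'d \<Rightarrow> complex^'m) \<Rightarrow> real^'d \<Rightarrow> real^'d \<Rightarrow> complex^'m" where
  "periodic_part \<psi> k = (\<lambda>r. cis (- (k \<bullet> r)) *s \<psi> k r)"

definition continuous_choice ::
    "(real^'d) set \<Rightarrow> (real^'d \<Rightarrow> real^'d \<Rightarrow> complex^'m) \<Rightarrow> bool" where
  "continuous_choice BL \<psi> \<longleftrightarrow>
     (\<forall>k0. ((\<lambda>k. cell_norm BL (periodic_part \<psi> k - periodic_part \<psi> k0)) \<longlongrightarrow> 0) (at k0))"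

definition analytic_choice ::
    "(real^'d) set \<Rightarrow> (real^'d \<Rightarrow> real^'d \<Rightarrow> complex^'m) \<Rightarrow> bool" where
  "analytic_choice BL \<psi> \<longleftrightarrow> real_analytic_wrt (torus_L2 BL) (cell_norm BL) (periodic_part \<psi>)"

definition periodic_choice ::
    "(real^'d) set \<Rightarrow> (real^'d \<Rightarrow> real^'d \<Rightarrow> complex^'m) \<Rightarrow> bool" where
  "periodic_choice BL \<psi> \<longleftrightarrow>
     (\<forall>k. \<forall>K\<in>reciprocal_lattice BL. AE r in lborel. \<psi> (k + K) r = \<psi> k r)"

definition topologically_trivial ::
    "(real^'d) set \<Rightarrow> (real^'d \<Rightarrow> (real^'d \<Rightarrow> complex^'m) set) \<Rightarrow> bool" where
  "topologically_trivial BL B \<longleftrightarrow>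
     (\<exists>\<psi>. band_choice BL B \<psi> \<and> continuous_choice BL \<psi> \<and> periodic_choice BL \<psi>)"

section \<open>Band representations\<close>

definition wannier ::
    "(real^'d) set \<Rightarrow> (real^'d \<Rightarrow> real^'d \<Rightarrow> complex^'m) \<Rightarrow> real^'d \<Rightarrow> real^'d \<Rightarrow> complex^'m" where
  "wannier BL \<psi> R r =
     (1 / sqrt (measure lborel (unit_cell (reciprocal_lattice BL)))) *\<^sub>R
       (LINT k:unit_cell (reciprocal_lattice BL)|lborel. cis (- (k \<bullet> R)) *s \<psi> k r)"

text \<open>
  The pointwise Wannier integral only makes sense if the representatives \<open>\<psi> k\<close>, each determined
  up to a null set depending on \<open>k\<close>, depend measurably on \<open>(k, r)\<close>. Every analytic choice
  has jointly measurable representatives, and by Fubini any two such families give the same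
  Wannier functions almost everywhere.
\<close>

definition band_representation ::
    "'p monoid \<Rightarrow> ('p \<Rightarrow> real^'d^'d) \<Rightarrow> (real^'d) set \<Rightarrow>
     ('p \<Rightarrow> complex^'m \<Rightarrow> complex^'m) \<Rightarrow> (real^'d \<Rightarrow> (real^'d \<Rightarrow> complex^'m) set) \<Rightarrow> bool" where
  "band_representation P ch BL D B \<longleftrightarrow>
     (\<exists>\<psi> w. band_choice BL B \<psi> \<and> analytic_choice BL \<psi> \<and> periodic_choice BL \<psi> \<and>
        (\<lambda>(k, r). \<psi> k r) \<in> borel_measurable (borel \<Otimes>\<^sub>M borel) \<and>
        unit_multiplicity P ch BL w \<and>
        (\<forall>R\<in>BL. \<forall>g\<in>site_stabilizer P ch BL (w + R). \<exists>c. norm c = 1 \<and>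
           (AE r in lborel. spinor_act P ch BL D g (wannier BL \<psi> R) r = c *s wannier BL \<psi> R r)))"

end

theory Submission
  imports Defs "HOL-Complex_Analysis.Cauchy_Integral_Formula"
begin

text \<open>
  A band representation comes with an analytic, hence continuous, periodic choice. Conversely,
  let \<open>\<psi>\<close> be a continuous periodic choice. Projecting finitely many trial functions with
  trigonometric-polynomial coefficients onto the band and normalizing yields an analytic periodic
  choice. Then \<open>p \<psi> k = \<rho>\<^sub>p(k) \<psi>(s p k)\<close> with \<open>\<rho>\<^sub>p\<close> analytic and periodic, so
  \<open>\<rho>\<^sub>p(k) = exp i (k R\<^sub>p + a\<^sub>p + \<phi>\<^sub>p(k))\<close> with \<open>R\<^sub>p \<in> BL\<close> and \<open>\<phi>\<^sub>p\<close> analytic, periodic and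
  zero at \<open>k = 0\<close>. The \<open>\<phi>\<^sub>p\<close> are a real-valued cocycle of a finite group, so averaging removes them
  by a change of phase of \<open>\<psi>\<close>. What remains are linear phases: they say that \<open>p\<close> moves the Wannier
  function at \<open>0\<close> to the one at \<open>T\<^sub>p = - s p R\<^sub>p\<close>, and the affine action \<open>x \<mapsto> p x - T\<^sub>p\<close> of the
  finite point group fixes an average \<open>w\<close> of the \<open>- T\<^sub>p\<close>, which is the Wannier center.

  Analyticity is only ever checked on scalar functions of \<open>k\<close>: a choice is analytic as soon as
  \<open>\<langle>\<psi> k0, \<psi> k\<rangle>\<close> is analytic near each \<open>k0\<close>, because \<open>\<psi> k\<close> is \<open>P(k) \<psi> k0\<close> divided by the
  conjugate of this number.
\<close>

section \<open>Convergent power series in several real variables\<close>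

text \<open>Triviality provides a gauge that is merely continuous, and only the projection is known
  to be analytic. Smoothing the gauge directly would leave the line or produce zeros, hence the
  detour over projected trial functions. A second obstacle is that the periodic part of a periodic
  choice is not periodic in \<open>k\<close>: it acquires the factor \<open>exp (- i K r)\<close>,
  and trial functions have to share this twist. The symmetry phases may wind around the Brillouin
  torus. Their windings form a cocycle with values in a lattice, where averaging is impossible; the
  periodic remainders are real-valued, and there division by the group order is harmless. Performing
  the same division on the windings leads out of the lattice into real space, which is why the
  Wannier center is a point of space and not a lattice vector. Antiunitary elements conjugate
  scalars and reverse wavevectors; \<open>cj\<close> and \<open>rot\<close> carry these signs, so
  that both kinds of elements are treated at once. Functions matter only up to null sets and
  \<open>cell_norm\<close> is a seminorm, so vector-valued and operator-valued series are reduced to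
  scalar ones by testing them against square-integrable functions.\<close>

definition mpow :: "real^'d \<Rightarrow> ('d \<Rightarrow> nat) \<Rightarrow> real" where
  "mpow x \<alpha> = (\<Prod>i\<in>UNIV. x $ i ^ \<alpha> i)"

definition mdeg :: "('d::finite \<Rightarrow> nat) \<Rightarrow> nat" where
  "mdeg \<alpha> = (\<Sum>i\<in>UNIV. \<alpha> i)"

text \<open>A closed sup-norm cube is used because on it every monomial satisfies \<open>\<bar>mpow
  (k - k0) \<alpha>\<bar> \<le> \<rho> ^ mdeg \<alpha>\<close>; a weighted norm of the coefficients
  therefore majorizes the series on the whole cube.\<close>

definition near :: "real \<Rightarrow> real^'d \<Rightarrow> real^'d \<Rightarrow> bool" where
  "near \<rho> k0 k \<longleftrightarrow> (\<forall>i. \<bar>k $ i - k0 $ i\<bar> \<le> \<rho>)"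

text \<open>
  \<open>f\<close> is on the cube of radius \<open>\<rho>\<close> around \<open>k0\<close> the sum of a power series whose weighted
  \<open>\<ell>\<^sup>1\<close>-norm \<open>\<Sum> \<bar>a \<alpha>\<bar> \<rho>\<^bsup>\<bar>\<alpha>\<bar>\<^esup>\<close> is at most \<open>b\<close>. This norm is submultiplicative.
\<close>

definition power_series_le :: "real \<Rightarrow> real^'d \<Rightarrow> (real^'d \<Rightarrow> complex) \<Rightarrow> real \<Rightarrow> bool" where
  "power_series_le \<rho> k0 f b \<longleftrightarrow>
     (\<exists>a. \<exists>b'\<le>b. ((\<lambda>\<alpha>. norm (a \<alpha>) * \<rho> ^ mdeg \<alpha>) has_sum b') UNIV \<and>
        (\<forall>k. near \<rho> k0 k \<longrightarrow> ((\<lambda>\<alpha>. of_real (mpow (k - k0) \<alpha>) * a \<alpha>) has_sum f k) UNIV))"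

lemma mpow_add: "mpow x (\<alpha> + \<beta>) = mpow x \<alpha> * mpow x \<beta>"
  by (simp add: mpow_def power_add prod.distrib)

lemma mdeg_add: "mdeg (\<alpha> + \<beta>) = mdeg \<alpha> + mdeg \<beta>"
  by (simp add: mdeg_def sum.distrib)

lemma mpow_zero [simp]: "mpow x (\<lambda>_. 0) = 1" "mpow x 0 = 1"
  by (simp_all add: mpow_def)

lemma mdeg_zero [simp]: "mdeg (\<lambda>_. 0) = 0" "mdeg 0 = 0"
  by (simp_all add: mdeg_def)

lemma mdeg_eq_0: "mdeg \<alpha> = 0 \<longleftrightarrow> \<alpha> = 0"
  by (auto simp: mdeg_def fun_eq_iff)

lemma abs_mpow_le:
  assumes "\<And>i. \<bar>x $ i\<bar> \<le> \<rho>"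
  shows "\<bar>mpow x \<alpha>\<bar> \<le> \<rho> ^ mdeg \<alpha>"
proof -
  have "\<bar>mpow x \<alpha>\<bar> = (\<Prod>i\<in>UNIV. \<bar>x $ i\<bar> ^ \<alpha> i)"
    by (simp add: mpow_def abs_prod power_abs)
  also have "\<dots> \<le> (\<Prod>i\<in>UNIV. \<rho> ^ \<alpha> i)"
    by (intro prod_mono) (auto intro!: power_mono assms)
  also have "\<dots> = \<rho> ^ mdeg \<alpha>"
    by (simp add: mdeg_def power_sum)
  finally show ?thesis .
qed

lemma abs_mpow_near: "near \<rho> k0 k \<Longrightarrow> \<bar>mpow (k - k0) \<alpha>\<bar> \<le> \<rho> ^ mdeg \<alpha>"
  by (rule abs_mpow_le) (simp add: near_def)

lemma near_mono: "near \<rho>' k0 k \<Longrightarrow> \<rho>' \<le> \<rho> \<Longrightarrow> near \<rho> k0 k"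
  unfolding near_def using order_trans by blast

lemma norm_mpow_term_le:
  assumes "near \<rho> k0 k"
  shows "norm (complex_of_real (mpow (k - k0) \<alpha>) * c) \<le> norm c * \<rho> ^ mdeg \<alpha>"
  using mult_left_mono[OF abs_mpow_near[OF assms, of \<alpha>] norm_ge_zero[of c]]
  by (simp add: norm_mult mult.commute)

lemma near_refl: "0 \<le> \<rho> \<Longrightarrow> near \<rho> k k"
  by (simp add: near_def)

lemma eventually_near:
  assumes "\<rho> > 0"
  shows "eventually (near \<rho> k0) (nhds k0)"
  unfolding eventually_nhds_metric
proof (intro exI conjI allI impI)
  fix k assume "dist k k0 < \<rho>"
  then show "near \<rho> k0 k"
    unfolding near_def by (metis component_le_norm_cart dist_norm le_less_trans less_imp_le vector_minus_component)
qed (use assms in auto)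

lemma near_imp_ball:
  fixes k0 :: "real^'d"
  assumes "\<rho> > 0"
  obtains \<rho>' where "\<rho>' > 0" "\<And>k. near \<rho>' k0 k \<Longrightarrow> k \<in> ball k0 \<rho>"
proof
  let ?n = "real CARD('d)"
  have n: "?n > 0" by simp
  show "\<rho> / (2 * ?n) > 0" using assms n by simp
  fix k assume *: "near (\<rho> / (2 * ?n)) k0 k"
  have "norm (k - k0) \<le> (\<Sum>i\<in>UNIV. \<bar>(k - k0) $ i\<bar>)"
    by (rule norm_le_l1_cart)
  also have "\<dots> \<le> (\<Sum>i\<in>(UNIV::'d set). \<rho> / (2 * ?n))"
    using * by (intro sum_mono) (simp add: near_def)
  also have "\<dots> < \<rho>" using assms n by (simp add: field_simps)
  finally show "k \<in> ball k0 \<rho>" by (simp add: dist_norm norm_minus_commute)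
qed

text \<open>Several indices may carry the same multidegree. Adding up their coefficients fibre by
  fibre can only decrease the weighted norm, by the triangle inequality, and absolute summability
  allows the rearrangement. Sums, products and substitutions of series all reach their normal form
  through this lemma.\<close>

lemma power_series_le_grouped:
  fixes m :: "'i \<Rightarrow> complex" and dg :: "'i \<Rightarrow> 'd::finite \<Rightarrow> nat"
  assumes \<rho>: "\<rho> > 0"
    and S: "((\<lambda>i. norm (m i) * \<rho> ^ mdeg (dg i)) has_sum b') I" and b: "b' \<le> b"
    and f: "\<And>k. near \<rho> k0 k \<Longrightarrow> ((\<lambda>i. of_real (mpow (k - k0) (dg i)) * m i) has_sum f k) I"
  shows "power_series_le \<rho> k0 f b"
proof -
  define F where "F \<gamma> = {i\<in>I. dg i = \<gamma>}" for \<gamma>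
  have bij: "bij_betw snd (Sigma UNIV F) I"
    by (rule bij_betwI[where g = "\<lambda>i. (dg i, i)"]) (auto simp: F_def)
  have sub: "(\<lambda>i. norm (m i)) summable_on F \<gamma>" for \<gamma>
  proof -
    have "(\<lambda>i. norm (m i) * \<rho> ^ mdeg (dg i)) summable_on F \<gamma>"
      by (rule summable_on_subset[OF has_sum_imp_summable[OF S]]) (auto simp: F_def)
    then have "(\<lambda>i. norm (m i) * \<rho> ^ mdeg \<gamma>) summable_on F \<gamma>"
      by (rule summable_on_cong[THEN iffD1, rotated]) (auto simp: F_def)
    then show ?thesis
      using \<rho> by (subst (asm) summable_on_cmult_left') auto
  qed
  then have msum: "(m has_sum infsum m (F \<gamma>)) (F \<gamma>)" for \<gamma>
    using abs_summable_summable by (intro has_sum_infsum) blast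
  have nsum: "((\<lambda>i. norm (m i)) has_sum infsum (\<lambda>i. norm (m i)) (F \<gamma>)) (F \<gamma>)" for \<gamma>
    using sub by (intro has_sum_infsum)
  define a where "a \<gamma> = infsum m (F \<gamma>)" for \<gamma>
  have na: "norm (a \<gamma>) \<le> infsum (\<lambda>i. norm (m i)) (F \<gamma>)" for \<gamma>
    unfolding a_def using sub by (intro norm_infsum_bound)
  have S': "((\<lambda>p. norm (m (snd p)) * \<rho> ^ mdeg (dg (snd p))) has_sum b') (Sigma UNIV F)"
    using S by (subst has_sum_reindex_bij_betw[OF bij])
  have B: "((\<lambda>\<gamma>. infsum (\<lambda>i. norm (m i)) (F \<gamma>) * \<rho> ^ mdeg \<gamma>) has_sum b') UNIV"
  proof (rule has_sum_SigmaD[OF S'])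
    fix \<gamma>
    have "((\<lambda>i. norm (m i) * \<rho> ^ mdeg \<gamma>) has_sum infsum (\<lambda>i. norm (m i)) (F \<gamma>) * \<rho> ^ mdeg \<gamma>) (F \<gamma>)"
      by (intro has_sum_cmult_left nsum)
    then show "((\<lambda>y. norm (m (snd (\<gamma>, y))) * \<rho> ^ mdeg (dg (snd (\<gamma>, y)))) has_sum
        infsum (\<lambda>i. norm (m i)) (F \<gamma>) * \<rho> ^ mdeg \<gamma>) (F \<gamma>)"
      by (rule has_sum_cong[THEN iffD1, rotated]) (auto simp: F_def)
  qed
  have sm: "(\<lambda>\<gamma>. norm (a \<gamma>) * \<rho> ^ mdeg \<gamma>) summable_on UNIV"
    by (rule summable_on_comparison_test[OF has_sum_imp_summable[OF B]])
      (use \<rho> na in \<open>auto intro!: mult_right_mono\<close>)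
  have le: "infsum (\<lambda>\<gamma>. norm (a \<gamma>) * \<rho> ^ mdeg \<gamma>) UNIV \<le> b'"
    by (rule has_sum_mono[OF has_sum_infsum[OF sm] B])
      (use \<rho> na in \<open>auto intro!: mult_right_mono\<close>)
  show ?thesis
    unfolding power_series_le_def
  proof (intro exI conjI allI impI)
    show "infsum (\<lambda>\<gamma>. norm (a \<gamma>) * \<rho> ^ mdeg \<gamma>) UNIV \<le> b" using le b by simp
    show "((\<lambda>\<alpha>. norm (a \<alpha>) * \<rho> ^ mdeg \<alpha>) has_sum infsum (\<lambda>\<gamma>. norm (a \<gamma>) * \<rho> ^ mdeg \<gamma>) UNIV) UNIV"
      using sm by (rule has_sum_infsum)
    fix k assume k: "near \<rho> k0 k"
    have "((\<lambda>p. of_real (mpow (k - k0) (dg (snd p))) * m (snd p)) has_sum f k) (Sigma UNIV F)"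
      using f[OF k] by (subst has_sum_reindex_bij_betw[OF bij])
    then show "((\<lambda>\<alpha>. of_real (mpow (k - k0) \<alpha>) * a \<alpha>) has_sum f k) UNIV"
    proof (rule has_sum_SigmaD)
      fix \<gamma>
      have "((\<lambda>i. of_real (mpow (k - k0) \<gamma>) * m i) has_sum of_real (mpow (k - k0) \<gamma>) * a \<gamma>) (F \<gamma>)"
        unfolding a_def by (intro has_sum_cmult_right msum)
      then show "((\<lambda>y. of_real (mpow (k - k0) (dg (snd (\<gamma>, y)))) * m (snd (\<gamma>, y))) has_sum
          of_real (mpow (k - k0) \<gamma>) * a \<gamma>) (F \<gamma>)"
        by (rule has_sum_cong[THEN iffD1, rotated]) (auto simp: F_def)
    qed
  qed
qed

lemma power_series_le_mono: "power_series_le \<rho> k0 f b \<Longrightarrow> b \<le> b' \<Longrightarrow> power_series_le \<rho> k0 f b'"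
  unfolding power_series_le_def by (meson order_trans)

lemma power_series_le_cong:
  assumes "power_series_le \<rho> k0 f b" "\<And>k. near \<rho> k0 k \<Longrightarrow> f k = g k"
  shows "power_series_le \<rho> k0 g b"
  using assms unfolding power_series_le_def by metis

lemma power_series_le_norm:
  assumes "power_series_le \<rho> k0 f b" "near \<rho> k0 k"
  shows "norm (f k) \<le> b"
proof -
  obtain a b' where a: "b' \<le> b" "((\<lambda>\<alpha>. norm (a \<alpha>) * \<rho> ^ mdeg \<alpha>) has_sum b') UNIV"
    "((\<lambda>\<alpha>. of_real (mpow (k - k0) \<alpha>) * a \<alpha>) has_sum f k) UNIV"
    using assms unfolding power_series_le_def by blast
  have le: "norm (of_real (mpow (k - k0) \<alpha>) * a \<alpha>) \<le> norm (a \<alpha>) * \<rho> ^ mdeg \<alpha>" for \<alpha>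
    by (rule norm_mpow_term_le[OF assms(2)])
  have s: "(\<lambda>\<alpha>. norm (of_real (mpow (k - k0) \<alpha>) * a \<alpha>)) summable_on UNIV"
    by (rule summable_on_comparison_test[OF has_sum_imp_summable[OF a(2)]]) (use le in auto)
  have "norm (f k) \<le> infsum (\<lambda>\<alpha>. norm (of_real (mpow (k - k0) \<alpha>) * a \<alpha>)) UNIV"
    by (rule norm_has_sum_bound[OF has_sum_infsum[OF s] a(3)])
  also have "\<dots> \<le> b'"
    by (rule has_sum_mono[OF has_sum_infsum[OF s] a(2)]) (use le in auto)
  finally show ?thesis using a(1) by simp
qed

text \<open>Summable bounds make the double family of all monomials, indexed by pairs of a function
  and a multidegree, absolutely summable, so it may be regrouped by degree. Finite sums, composition
  with a Taylor series and linear substitution are instances.\<close>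

lemma power_series_le_infsum:
  fixes f :: "'i \<Rightarrow> real^'d \<Rightarrow> complex"
  assumes \<rho>: "\<rho> > 0" and f: "\<And>i. i \<in> I \<Longrightarrow> power_series_le \<rho> k0 (f i) (b i)"
    and b: "(b has_sum B) I"
    and g: "\<And>k. near \<rho> k0 k \<Longrightarrow> ((\<lambda>i. f i k) has_sum g k) I"
  shows "power_series_le \<rho> k0 g B"
proof -
  have "\<forall>i\<in>I. \<exists>a b'. b' \<le> b i \<and> ((\<lambda>\<alpha>. norm (a \<alpha>) * \<rho> ^ mdeg \<alpha>) has_sum b') UNIV \<and>
        (\<forall>k. near \<rho> k0 k \<longrightarrow> ((\<lambda>\<alpha>. of_real (mpow (k - k0) \<alpha>) * a \<alpha>) has_sum f i k) UNIV)"
    using f unfolding power_series_le_def by blast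
  from bchoice[OF this] obtain a where "\<forall>i\<in>I. \<exists>b'. b' \<le> b i \<and>
        ((\<lambda>\<alpha>. norm (a i \<alpha>) * \<rho> ^ mdeg \<alpha>) has_sum b') UNIV \<and>
        (\<forall>k. near \<rho> k0 k \<longrightarrow> ((\<lambda>\<alpha>. of_real (mpow (k - k0) \<alpha>) * a i \<alpha>) has_sum f i k) UNIV)" ..
  from bchoice[OF this] obtain b' where a: "\<And>i. i \<in> I \<Longrightarrow> b' i \<le> b i"
    "\<And>i. i \<in> I \<Longrightarrow> ((\<lambda>\<alpha>. norm (a i \<alpha>) * \<rho> ^ mdeg \<alpha>) has_sum b' i) UNIV"
    "\<And>i k. i \<in> I \<Longrightarrow> near \<rho> k0 k \<Longrightarrow> ((\<lambda>\<alpha>. of_real (mpow (k - k0) \<alpha>) * a i \<alpha>) has_sum f i k) UNIV"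
    by blast
  have b0: "0 \<le> b' i" if "i \<in> I" for i
    by (rule has_sum_nonneg[OF a(2)[OF that]]) (use \<rho> in auto)
  have sb: "b' summable_on I"
    by (rule summable_on_comparison_test[OF has_sum_imp_summable[OF b]]) (use a(1) b0 in auto)
  have le: "infsum b' I \<le> B"
    by (rule has_sum_mono[OF has_sum_infsum[OF sb] b]) (use a(1) in auto)
  have sS: "(\<lambda>p. norm (a (fst p) (snd p)) * \<rho> ^ mdeg (snd p)) summable_on Sigma I (\<lambda>_. UNIV)"
    by (rule summable_on_SigmaI[OF _ sb]) (use a(2) \<rho> in auto)
  have hS: "((\<lambda>p. norm (a (fst p) (snd p)) * \<rho> ^ mdeg (snd p)) has_sum infsum b' I) (Sigma I (\<lambda>_. UNIV))"
    by (rule has_sum_SigmaI[OF _ has_sum_infsum[OF sb] sS]) (use a(2) in auto)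
  show ?thesis
  proof (rule power_series_le_grouped[OF \<rho> hS le])
    fix k assume k: "near \<rho> k0 k"
    have "(\<lambda>p. norm (of_real (mpow (k - k0) (snd p)) * a (fst p) (snd p))) summable_on Sigma I (\<lambda>_. UNIV)"
      by (rule summable_on_comparison_test[OF sS])
        (use norm_mpow_term_le[OF k] in auto)
    then have s: "(\<lambda>p. of_real (mpow (k - k0) (snd p)) * a (fst p) (snd p)) summable_on Sigma I (\<lambda>_. UNIV)"
      by (rule abs_summable_summable)
    show "((\<lambda>p. of_real (mpow (k - k0) (snd p)) * a (fst p) (snd p)) has_sum g k) (Sigma I (\<lambda>_. UNIV))"
      by (rule has_sum_SigmaI[OF _ g[OF k] s]) (use a(3) k in auto)
  qed
qed

lemma power_series_le_add:
  assumes \<rho>: "\<rho> > 0" and f: "power_series_le \<rho> k0 f b" and g: "power_series_le \<rho> k0 g c"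
  shows "power_series_le \<rho> k0 (\<lambda>k. f k + g k) (b + c)"
  by (rule power_series_le_infsum[where I = "UNIV :: bool set" and f = "\<lambda>i. if i then f else g"
        and b = "\<lambda>i. if i then b else c", OF \<rho>])
    (use f g in \<open>auto intro!: has_sum_finiteI simp: UNIV_bool\<close>)

text \<open>This is the Cauchy product, kept as a family over pairs of multi-indices. Since
  \<open>mdeg\<close> and \<open>mpow\<close> turn sums of multi-indices into sums and products, the
  norms and the values both factor over the pairs.\<close>

lemma power_series_le_mult:
  assumes \<rho>: "\<rho> > 0" and f: "power_series_le \<rho> k0 f b" and g: "power_series_le \<rho> k0 g c"
  shows "power_series_le \<rho> k0 (\<lambda>k. f k * g k) (b * c)"
proof -
  obtain a b' where a: "b' \<le> b" "((\<lambda>\<alpha>. norm (a \<alpha>) * \<rho> ^ mdeg \<alpha>) has_sum b') UNIV"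
    "\<And>k. near \<rho> k0 k \<Longrightarrow> ((\<lambda>\<alpha>. of_real (mpow (k - k0) \<alpha>) * a \<alpha>) has_sum f k) UNIV"
    using f unfolding power_series_le_def by blast
  obtain a' c' where a': "c' \<le> c" "((\<lambda>\<alpha>. norm (a' \<alpha>) * \<rho> ^ mdeg \<alpha>) has_sum c') UNIV"
    "\<And>k. near \<rho> k0 k \<Longrightarrow> ((\<lambda>\<alpha>. of_real (mpow (k - k0) \<alpha>) * a' \<alpha>) has_sum g k) UNIV"
    using g unfolding power_series_le_def by blast
  have b0: "0 \<le> b'" "0 \<le> c'"
    by (rule has_sum_nonneg[OF a(2)] has_sum_nonneg[OF a'(2)], use \<rho> in simp)+
  let ?n = "\<lambda>p. norm (a (fst p) * a' (snd p)) * \<rho> ^ mdeg (fst p + snd p)"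
  have row: "((\<lambda>y. ?n (x, y)) has_sum (norm (a x) * \<rho> ^ mdeg x) * c') UNIV" for x
    using has_sum_cmult_right[OF a'(2), of "norm (a x) * \<rho> ^ mdeg x"]
    by (simp add: norm_mult mdeg_add power_add mult_ac)
  have tot: "((\<lambda>x. (norm (a x) * \<rho> ^ mdeg x) * c') has_sum b' * c') UNIV"
    by (rule has_sum_cmult_left[OF a(2)])
  have sS: "?n summable_on Sigma UNIV (\<lambda>_. UNIV)"
    by (rule summable_on_SigmaI[OF row has_sum_imp_summable[OF tot]]) (use \<rho> in auto)
  have hS: "(?n has_sum b' * c') (Sigma UNIV (\<lambda>_. UNIV))"
    by (rule has_sum_SigmaI[OF row tot sS])
  show ?thesis
  proof (rule power_series_le_grouped[OF \<rho> hS])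
    show "b' * c' \<le> b * c" using a(1) a'(1) b0 by (intro mult_mono) auto
    fix k assume k: "near \<rho> k0 k"
    let ?m = "\<lambda>p. complex_of_real (mpow (k - k0) (fst p + snd p)) * (a (fst p) * a' (snd p))"
    have "(\<lambda>p. norm (?m p)) summable_on Sigma UNIV (\<lambda>_. UNIV)"
      by (rule summable_on_comparison_test[OF sS])
        (use norm_mpow_term_le[OF k] in auto)
    then have s: "?m summable_on Sigma UNIV (\<lambda>_. UNIV)"
      by (rule abs_summable_summable)
    show "(?m has_sum f k * g k) (Sigma UNIV (\<lambda>_. UNIV))"
    proof (rule has_sum_SigmaI[OF _ _ s])
      show "((\<lambda>x. (of_real (mpow (k - k0) x) * a x) * g k) has_sum f k * g k) UNIV"
        by (rule has_sum_cmult_left[OF a(3)[OF k]])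
      show "((\<lambda>y. ?m (x, y)) has_sum (of_real (mpow (k - k0) x) * a x) * g k) UNIV" for x
        using has_sum_cmult_right[OF a'(3)[OF k], of "of_real (mpow (k - k0) x) * a x"]
        by (simp add: mpow_add mult_ac)
    qed
  qed
qed

lemma power_series_le_const:
  assumes "\<rho> > 0"
  shows "power_series_le \<rho> k0 (\<lambda>_. c) (norm c)"
  by (rule power_series_le_grouped[where I = "{()}" and m = "\<lambda>_. c" and dg = "\<lambda>_ _. 0", OF assms])
    (auto intro!: has_sum_finiteI)

lemma power_series_le_coordinate:
  fixes k0 :: "real^'d"
  assumes "\<rho> > 0"
  shows "power_series_le \<rho> k0 (\<lambda>k. of_real (k $ i - k0 $ i)) \<rho>"
proof (rule power_series_le_grouped[where I = "{()}" and m = "\<lambda>_. 1"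
      and dg = "\<lambda>_ j. if j = i then 1 else 0" and b' = \<rho>, OF assms])
  have d: "mdeg (\<lambda>j::'d. if j = i then 1 else 0) = 1" by (simp add: mdeg_def)
  show "((\<lambda>_. norm (1::complex) * \<rho> ^ mdeg (\<lambda>j::'d. if j = i then 1 else 0)) has_sum \<rho>) {()}"
    by (rule has_sum_finiteI) (simp_all add: d)
  fix k :: "real^'d"
  have "(\<Prod>j\<in>UNIV. (k $ j - k0 $ j) ^ (if j = i then 1 else 0)) =
      (\<Prod>j\<in>UNIV. if j = i then k $ j - k0 $ j else 1)"
    by (intro prod.cong) auto
  then have "mpow (k - k0) (\<lambda>j. if j = i then 1 else 0) = k $ i - k0 $ i"
    by (simp add: mpow_def)
  then show "((\<lambda>_. complex_of_real (mpow (k - k0) (\<lambda>j. if j = i then 1 else 0)) * 1) has_sum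
      complex_of_real (k $ i - k0 $ i)) {()}"
    by (intro has_sum_finiteI) simp_all
qed auto

lemma power_series_le_power:
  assumes "\<rho> > 0" "power_series_le \<rho> k0 f b"
  shows "power_series_le \<rho> k0 (\<lambda>k. f k ^ n) (b ^ n)"
proof (induction n)
  case 0
  then show ?case using power_series_le_const[OF assms(1), of k0 1] by simp
next
  case (Suc n)
  then show ?case using power_series_le_mult[OF assms(1,2) Suc] by simp
qed

lemma power_series_le_prod:
  assumes "\<rho> > 0" "finite J" "\<And>j. j \<in> J \<Longrightarrow> power_series_le \<rho> k0 (f j) (b j)"
  shows "power_series_le \<rho> k0 (\<lambda>k. \<Prod>j\<in>J. f j k) (\<Prod>j\<in>J. b j)"
  using assms(2,3)
proof (induction J rule: finite_induct)
  case empty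
  then show ?case using power_series_le_const[OF assms(1), of k0 1] by simp
next
  case (insert j J)
  then show ?case by (simp add: power_series_le_mult[OF assms(1)])
qed

lemma power_series_le_sum:
  assumes "\<rho> > 0" "finite J" "\<And>j. j \<in> J \<Longrightarrow> power_series_le \<rho> k0 (f j) (b j)"
  shows "power_series_le \<rho> k0 (\<lambda>k. \<Sum>j\<in>J. f j k) (\<Sum>j\<in>J. b j)"
  by (rule power_series_le_infsum[OF assms(1,3)]) (use assms(2) in \<open>auto intro!: has_sum_finiteI\<close>)

lemma power_series_le_shrink:
  assumes "power_series_le \<rho> k0 f b" "0 < \<rho>'" "\<rho>' \<le> \<rho>"
  shows "power_series_le \<rho>' k0 f b"
proof -
  obtain a b' where a: "b' \<le> b" "((\<lambda>\<alpha>. norm (a \<alpha>) * \<rho> ^ mdeg \<alpha>) has_sum b') UNIV"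
    "\<And>k. near \<rho> k0 k \<Longrightarrow> ((\<lambda>\<alpha>. of_real (mpow (k - k0) \<alpha>) * a \<alpha>) has_sum f k) UNIV"
    using assms(1) unfolding power_series_le_def by blast
  have le: "norm (a \<alpha>) * \<rho>' ^ mdeg \<alpha> \<le> norm (a \<alpha>) * \<rho> ^ mdeg \<alpha>" for \<alpha>
    using assms by (intro mult_left_mono power_mono) auto
  have s: "(\<lambda>\<alpha>. norm (a \<alpha>) * \<rho>' ^ mdeg \<alpha>) summable_on UNIV"
    by (rule summable_on_comparison_test[OF has_sum_imp_summable[OF a(2)]]) (use le assms in auto)
  have "infsum (\<lambda>\<alpha>. norm (a \<alpha>) * \<rho>' ^ mdeg \<alpha>) UNIV \<le> b'"
    by (rule has_sum_mono[OF has_sum_infsum[OF s] a(2)]) (use le in auto)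
  then show ?thesis
    unfolding power_series_le_def
    using a has_sum_infsum[OF s] near_mono[OF _ assms(3)] by (meson order_trans)
qed

text \<open>Without the constant term every monomial has degree at least one, so shrinking the
  radius by a factor \<open>t \<le> 1\<close> gains at least one factor \<open>t\<close> in each
  term. The smallness obtained here is what allows substitution into a Taylor series.\<close>

lemma power_series_le_centered:
  fixes k0 :: "real^'d"
  assumes f: "power_series_le \<rho> k0 f b" and \<rho>: "\<rho> > 0" and \<epsilon>: "\<epsilon> > 0"
  obtains \<rho>' where "0 < \<rho>'" "\<rho>' \<le> \<rho>" "power_series_le \<rho>' k0 (\<lambda>k. f k - f k0) \<epsilon>"
proof -
  obtain a b' where a: "b' \<le> b" "((\<lambda>\<alpha>. norm (a \<alpha>) * \<rho> ^ mdeg \<alpha>) has_sum b') UNIV"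
    "\<And>k. near \<rho> k0 k \<Longrightarrow> ((\<lambda>\<alpha>. of_real (mpow (k - k0) \<alpha>) * a \<alpha>) has_sum f k) UNIV"
    using f unfolding power_series_le_def by blast
  have b0: "0 \<le> b'"
    by (rule has_sum_nonneg[OF a(2)]) (use \<rho> in simp)
  have z: "mpow (0 :: real^'d) \<alpha> = (if \<alpha> = 0 then 1 else 0)" for \<alpha>
    by (auto simp: mpow_def fun_eq_iff)
  have "((\<lambda>\<alpha>. of_real (mpow (k0 - k0) \<alpha>) * a \<alpha>) has_sum a 0) {0}"
    by (rule has_sum_finiteI) (simp_all add: z)
  then have "((\<lambda>\<alpha>. of_real (mpow (k0 - k0) \<alpha>) * a \<alpha>) has_sum a 0) UNIV"
    by (rule has_sum_cong_neutral[THEN iffD1, rotated -1]) (auto simp: z)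
  then have a0: "a 0 = f k0"
    using has_sum_unique[OF _ a(3)[OF near_refl]] \<rho> by simp
  \<comment> \<open>The \<open>1\<close> added to \<open>b'\<close> keeps the denominator positive
    when all coefficients vanish.\<close>
  define t where "t = min 1 (\<epsilon> / (b' + 1))"
  have t: "0 < t" "t \<le> 1" "t * b' \<le> \<epsilon>"
  proof -
    show "0 < t" "t \<le> 1" using b0 \<epsilon> by (auto simp: t_def)
    have "t * b' \<le> \<epsilon> / (b' + 1) * b'" using b0 by (intro mult_right_mono) (auto simp: t_def)
    also have "\<dots> \<le> \<epsilon>" using b0 \<epsilon> by (simp add: field_simps)
    finally show "t * b' \<le> \<epsilon>" .
  qed
  let ?\<rho> = "t * \<rho>"
  have \<rho>': "0 < ?\<rho>" "?\<rho> \<le> \<rho>" using t \<rho> by (auto simp: mult_le_cancel_right1)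
  have le: "norm (a \<alpha>) * ?\<rho> ^ mdeg \<alpha> \<le> t * (norm (a \<alpha>) * \<rho> ^ mdeg \<alpha>)" if nz: "\<alpha> \<noteq> 0" for \<alpha>
  proof -
    obtain n where n: "mdeg \<alpha> = Suc n" using nz mdeg_eq_0[of \<alpha>] by (cases "mdeg \<alpha>") auto
    have "t ^ mdeg \<alpha> \<le> t" using t by (simp add: n mult_left_le power_le_one)
    then have "t ^ mdeg \<alpha> * (norm (a \<alpha>) * \<rho> ^ mdeg \<alpha>) \<le> t * (norm (a \<alpha>) * \<rho> ^ mdeg \<alpha>)"
      using \<rho> by (intro mult_right_mono) auto
    then show ?thesis
      unfolding power_mult_distrib by (simp only: mult_ac)
  qed
  let ?B = "\<lambda>\<alpha>. t * (norm (a \<alpha>) * \<rho> ^ mdeg \<alpha>)"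
  have sB: "?B summable_on UNIV" 
    by (intro summable_on_cmult_right has_sum_imp_summable[OF a(2)])
  have s: "(\<lambda>\<alpha>. norm (a \<alpha>) * ?\<rho> ^ mdeg \<alpha>) summable_on (UNIV - {0})"
    by (rule summable_on_comparison_test[OF summable_on_subset[OF sB]]) (use le \<rho>' in auto)
  have "infsum (\<lambda>\<alpha>. norm (a \<alpha>) * ?\<rho> ^ mdeg \<alpha>) (UNIV - {0}) \<le> t * b'"
    by (rule has_sum_mono_neutral[OF has_sum_infsum[OF s] has_sum_cmult_right[OF a(2)]])
      (use le t \<rho> in auto)
  then have "power_series_le ?\<rho> k0 (\<lambda>k. f k - f k0) \<epsilon>"
  proof (intro power_series_le_grouped[where I = "UNIV - {0}" and m = a and dg = "\<lambda>\<alpha>. \<alpha>", OF \<rho>'(1) has_sum_infsum[OF s]])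
    fix k assume "near ?\<rho> k0 k"
    then have "((\<lambda>\<alpha>. of_real (mpow (k - k0) \<alpha>) * a \<alpha>) has_sum f k) UNIV"
      using a(3) near_mono \<rho>'(2) by blast
    moreover have "((\<lambda>\<alpha>. of_real (mpow (k - k0) \<alpha>) * a \<alpha>) has_sum f k0) {0}"
      by (rule has_sum_finiteI) (simp_all add: a0)
    ultimately show "((\<lambda>\<alpha>. of_real (mpow (k - k0) \<alpha>) * a \<alpha>) has_sum f k - f k0) (UNIV - {0})"
      by (rule has_sum_Diff) auto
  qed (use t in auto)
  then show ?thesis using that \<rho>' by blast
qed

section \<open>Germs of complex-valued real-analytic functions\<close>

definition analytic_near :: "real^'d \<Rightarrow> (real^'d \<Rightarrow> complex) \<Rightarrow> bool" where
  "analytic_near k0 f \<longleftrightarrow> (\<exists>\<rho>>0. \<exists>b. power_series_le \<rho> k0 f b)"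

lemma analytic_nearI: "\<rho> > 0 \<Longrightarrow> power_series_le \<rho> k0 f b \<Longrightarrow> analytic_near k0 f"
  unfolding analytic_near_def by blast

lemma analytic_near2E:
  assumes "analytic_near k0 f" "analytic_near k0 g"
  obtains \<rho> b c where "\<rho> > 0" "power_series_le \<rho> k0 f b" "power_series_le \<rho> k0 g c"
proof -
  obtain \<rho> b \<rho>' c where *: "\<rho> > 0" "power_series_le \<rho> k0 f b" "\<rho>' > 0" "power_series_le \<rho>' k0 g c"
    using assms unfolding analytic_near_def by blast
  then show ?thesis
    using that[of "min \<rho> \<rho>'" b c] power_series_le_shrink[OF *(2), of "min \<rho> \<rho>'"]
      power_series_le_shrink[OF *(4), of "min \<rho> \<rho>'"] by simp
qed

lemma analytic_near_const: "analytic_near k0 (\<lambda>_. c)"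
  by (rule analytic_nearI[OF zero_less_one power_series_le_const]) simp

lemma analytic_near_add:
  "analytic_near k0 f \<Longrightarrow> analytic_near k0 g \<Longrightarrow> analytic_near k0 (\<lambda>k. f k + g k)"
  by (metis analytic_near2E analytic_nearI power_series_le_add)

lemma analytic_near_mult:
  "analytic_near k0 f \<Longrightarrow> analytic_near k0 g \<Longrightarrow> analytic_near k0 (\<lambda>k. f k * g k)"
  by (metis analytic_near2E analytic_nearI power_series_le_mult)

lemma analytic_near_sum:
  assumes "finite J" "\<And>j. j \<in> J \<Longrightarrow> analytic_near k0 (f j)"
  shows "analytic_near k0 (\<lambda>k. \<Sum>j\<in>J. f j k)"
  using assms by (induction J rule: finite_induct) (auto intro: analytic_near_const analytic_near_add)

lemma analytic_near_coordinate: "analytic_near k0 (\<lambda>k. of_real (k $ i))"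
  using analytic_near_add[OF analytic_nearI[OF zero_less_one power_series_le_coordinate[OF zero_less_one]]
      analytic_near_const[of k0 "of_real (k0 $ i)"], of i]
  by simp

text \<open>The variables are real, so conjugating the coefficients conjugates the sum. This is why
  real analyticity, unlike holomorphy, survives complex conjugation.\<close>

lemma analytic_near_cnj:
  assumes "analytic_near k0 f"
  shows "analytic_near k0 (\<lambda>k. cnj (f k))"
proof -
  obtain \<rho> b a b' where a: "\<rho> > 0" "b' \<le> b" "((\<lambda>\<alpha>. norm (a \<alpha>) * \<rho> ^ mdeg \<alpha>) has_sum b') UNIV"
    "\<And>k. near \<rho> k0 k \<Longrightarrow> ((\<lambda>\<alpha>. of_real (mpow (k - k0) \<alpha>) * a \<alpha>) has_sum f k) UNIV"
    using assms unfolding analytic_near_def power_series_le_def by blast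
  have "((\<lambda>\<alpha>. of_real (mpow (k - k0) \<alpha>) * cnj (a \<alpha>)) has_sum cnj (f k)) UNIV" if "near \<rho> k0 k" for k
    using a(4)[OF that, THEN has_sum_cnj_iff[THEN iffD2]] by simp
  moreover have "((\<lambda>\<alpha>. norm (cnj (a \<alpha>)) * \<rho> ^ mdeg \<alpha>) has_sum b') UNIV" using a(3) by simp
  ultimately have "power_series_le \<rho> k0 (\<lambda>k. cnj (f k)) b"
    unfolding power_series_le_def using a(2)
    by (intro exI[of _ "\<lambda>\<alpha>. cnj (a \<alpha>)"] exI[of _ b'] conjI allI impI)
  then show ?thesis using a(1) analytic_nearI by blast
qed

lemma analytic_near_cong:
  assumes "analytic_near k0 f" and eq: "eventually (\<lambda>k. f k = g k) (nhds k0)"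
  shows "analytic_near k0 g"
proof -
  obtain \<rho> b where \<rho>: "\<rho> > 0" "power_series_le \<rho> k0 f b"
    using assms unfolding analytic_near_def by blast
  obtain e where e: "e > 0" "\<And>k. k \<in> ball k0 e \<Longrightarrow> f k = g k"
    using eq unfolding eventually_nhds_metric by (auto simp: dist_commute)
  obtain \<rho>' where \<rho>': "\<rho>' > 0" "\<And>k. near \<rho>' k0 k \<Longrightarrow> k \<in> ball k0 e"
    using near_imp_ball[OF e(1)] by blast
  have "power_series_le (min \<rho> \<rho>') k0 f b"
    using power_series_le_shrink[OF \<rho>(2)] \<rho> \<rho>' by simp
  then have "power_series_le (min \<rho> \<rho>') k0 g b"
    by (rule power_series_le_cong) (meson \<rho>'(2) e(2) min.cobounded2 near_mono)
  then show ?thesis using \<rho> \<rho>' by (intro analytic_nearI[of "min \<rho> \<rho>'"]) auto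
qed

lemma analytic_near_isCont:
  assumes "analytic_near k0 f"
  shows "isCont f k0"
  unfolding isCont_def tendsto_iff
proof (intro allI impI)
  fix \<epsilon> :: real assume \<epsilon>: "\<epsilon> > 0"
  obtain \<rho> b where \<rho>: "\<rho> > 0" "power_series_le \<rho> k0 f b"
    using assms unfolding analytic_near_def by blast
  obtain \<rho>' where \<rho>': "0 < \<rho>'" "power_series_le \<rho>' k0 (\<lambda>k. f k - f k0) (\<epsilon>/2)"
    using power_series_le_centered[OF \<rho>(2,1), of "\<epsilon>/2"] \<epsilon> by auto
  have "dist (f k) (f k0) < \<epsilon>" if "near \<rho>' k0 k" for k
    using power_series_le_norm[OF \<rho>'(2) that] \<epsilon> by (simp add: dist_norm)
  then have "eventually (\<lambda>k. dist (f k) (f k0) < \<epsilon>) (nhds k0)"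
    using eventually_near[OF \<rho>'(1), of k0] by (auto elim: eventually_mono)
  then show "eventually (\<lambda>k. dist (f k) (f k0) < \<epsilon>) (at k0)"
    unfolding eventually_at_filter by (rule eventually_mono) simp
qed

text \<open>Insert \<open>f\<close> into the Taylor series of \<open>g\<close> at
  \<open>f k0\<close>. Once \<open>f - f k0\<close> has weighted norm at most \<open>r/4\<close>,
  submultiplicativity bounds the term of order \<open>n\<close> by
  \<open>norm (c n) * (r/4) ^ n\<close>.\<close>

lemma analytic_near_compose:
  assumes f: "analytic_near k0 f" and g: "g analytic_on {f k0}"
  shows "analytic_near k0 (\<lambda>k. g (f k))"
proof -
  obtain r where r: "r > 0" "g holomorphic_on ball (f k0) r"
    using g by (auto simp: analytic_on_def)
  define c where "c n = (deriv ^^ n) g (f k0) / fact n" for n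
  have gs: "(\<lambda>n. c n * (w - f k0) ^ n) sums g w" if "w \<in> ball (f k0) r" for w
    unfolding c_def by (rule holomorphic_power_series[OF r(2) that])
  \<comment> \<open>Convergence at distance \<open>r/2\<close> from the center gives absolute
    convergence at the smaller distance \<open>r/4\<close>.\<close>
  have "summable (\<lambda>n. c n * of_real (r/2) ^ n)"
    using gs[of "f k0 + of_real (r/2)"] r by (auto simp: dist_norm summable_def)
  then have sc: "summable (\<lambda>n. norm (c n * of_real (r/4) ^ n))"
    by (rule powser_insidea) (use r in auto)
  then have sc': "summable (\<lambda>n. norm (c n) * (r/4) ^ n)"
    using r by (simp add: norm_mult norm_power)
  obtain \<rho> b where \<rho>: "\<rho> > 0" "power_series_le \<rho> k0 f b"
    using f unfolding analytic_near_def by blast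
  obtain \<rho>' where \<rho>': "0 < \<rho>'" "power_series_le \<rho>' k0 (\<lambda>k. f k - f k0) (r/4)"
    using power_series_le_centered[OF \<rho>(2,1), of "r/4"] r by auto
  have bs: "((\<lambda>n. norm (c n) * (r/4) ^ n) has_sum (\<Sum>n. norm (c n) * (r/4) ^ n)) UNIV"
    by (rule norm_summable_imp_has_sum) (use sc' r in \<open>auto simp: norm_mult norm_power summable_sums\<close>)
  have "power_series_le \<rho>' k0 (\<lambda>k. g (f k)) (\<Sum>n. norm (c n) * (r/4) ^ n)"
  proof (rule power_series_le_infsum[OF \<rho>'(1) _ bs])
    show "power_series_le \<rho>' k0 (\<lambda>k. c n * (f k - f k0) ^ n) (norm (c n) * (r/4) ^ n)" for n
      by (intro power_series_le_mult power_series_le_const power_series_le_power \<rho>')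
    fix k assume k: "near \<rho>' k0 k"
    have n: "norm (f k - f k0) \<le> r/4" by (rule power_series_le_norm[OF \<rho>'(2) k])
    have "summable (\<lambda>n. norm (c n * (f k - f k0) ^ n))"
      by (rule summable_comparison_test'[OF sc', of 0])
        (use n in \<open>auto simp: norm_mult norm_power intro!: mult_left_mono power_mono\<close>)
    then show "((\<lambda>n. c n * (f k - f k0) ^ n) has_sum g (f k)) UNIV"
      by (rule norm_summable_imp_has_sum)
        (rule gs, use n r in \<open>auto simp: dist_norm norm_minus_commute\<close>)
  qed
  then show ?thesis using \<rho>'(1) analytic_nearI by blast
qed

text \<open>Each coordinate of \<open>M *v (k - k0)\<close> is a linear form, of weighted norm at
  most \<open>\<rho>\<close> on a cube that is smaller by a bound for the absolute row sums. Hence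
  the substituted monomials obey the same bounds as the original ones.\<close>

lemma analytic_near_matrix:
  fixes M :: "real^'d^'d"
  assumes "analytic_near (M *v k0) f"
  shows "analytic_near k0 (\<lambda>k. f (M *v k))"
proof -
  obtain \<rho> b a b' where a: "\<rho> > 0" "b' \<le> b" "((\<lambda>\<alpha>. norm (a \<alpha>) * \<rho> ^ mdeg \<alpha>) has_sum b') UNIV"
    "\<And>k. near \<rho> (M *v k0) k \<Longrightarrow> ((\<lambda>\<alpha>. of_real (mpow (k - M *v k0) \<alpha>) * a \<alpha>) has_sum f k) UNIV"
    using assms unfolding analytic_near_def power_series_le_def by blast
  \<comment> \<open>The sum of all entries dominates every row sum, and the \<open>1\<close> keeps
    \<open>c\<close> positive even for \<open>M = 0\<close>.\<close>
  define c where "c = (\<Sum>i\<in>UNIV. \<Sum>j\<in>UNIV. \<bar>M $ i $ j\<bar>) + 1"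
  have c0: "c \<ge> 1" by (simp add: c_def sum_nonneg)
  have c: "(\<Sum>j\<in>UNIV. \<bar>M $ i $ j\<bar>) \<le> c" for i
  proof -
    have "(\<Sum>j\<in>UNIV. \<bar>M $ i $ j\<bar>) \<le> (\<Sum>i\<in>UNIV. \<Sum>j\<in>UNIV. \<bar>M $ i $ j\<bar>)"
      by (rule member_le_sum) (auto simp: sum_nonneg)
    then show ?thesis by (simp add: c_def)
  qed
  define \<rho>' where "\<rho>' = \<rho> / c"
  have \<rho>': "\<rho>' > 0" "\<rho>' * c = \<rho>" using a(1) c0 by (auto simp: \<rho>'_def)
  have Mk: "(M *v k - M *v k0) $ i = (\<Sum>j\<in>UNIV. M $ i $ j * (k $ j - k0 $ j))" for i k
    by (simp add: matrix_vector_mult_def sum_subtractf right_diff_distrib)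
  have coord: "power_series_le \<rho>' k0 (\<lambda>k. of_real ((M *v k - M *v k0) $ i)) \<rho>" for i
  proof -
    have "power_series_le \<rho>' k0 (\<lambda>k. \<Sum>j\<in>UNIV. of_real (M $ i $ j) * of_real (k $ j - k0 $ j))
        (\<Sum>j\<in>UNIV. norm (of_real (M $ i $ j) :: complex) * \<rho>')"
      by (intro power_series_le_sum power_series_le_mult power_series_le_const power_series_le_coordinate \<rho>') auto
    moreover have "(\<Sum>j\<in>UNIV. norm (of_real (M $ i $ j) :: complex) * \<rho>') \<le> \<rho>"
      unfolding norm_of_real sum_distrib_right[symmetric]
      using mult_right_mono[OF c[of i], of \<rho>'] \<rho>' by (simp only: mult.commute[of c])
    ultimately show ?thesis
      unfolding Mk of_real_sum of_real_mult by (rule power_series_le_mono)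
  qed
  have nr: "near \<rho> (M *v k0) (M *v k)" if "near \<rho>' k0 k" for k
    unfolding near_def using power_series_le_norm[OF coord that]
    by (simp only: norm_of_real vector_minus_component) auto
  have "power_series_le \<rho>' k0 (\<lambda>k. f (M *v k)) b'"
  proof (rule power_series_le_infsum[OF \<rho>'(1) _ a(3)])
    fix \<alpha> :: "'d \<Rightarrow> nat"
    have "power_series_le \<rho>' k0 (\<lambda>k. (\<Prod>i\<in>UNIV. of_real ((M *v k - M *v k0) $ i) ^ \<alpha> i) * a \<alpha>)
        ((\<Prod>i\<in>UNIV. \<rho> ^ \<alpha> i) * norm (a \<alpha>))"
      by (intro power_series_le_mult power_series_le_prod power_series_le_power coord
          power_series_le_const \<rho>') auto
    then show "power_series_le \<rho>' k0 (\<lambda>k. of_real (mpow (M *v k - M *v k0) \<alpha>) * a \<alpha>)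
        (norm (a \<alpha>) * \<rho> ^ mdeg \<alpha>)"
      by (simp add: mpow_def mdeg_def power_sum mult.commute)
  next
    fix k assume "near \<rho>' k0 k"
    then show "((\<lambda>\<alpha>. of_real (mpow (M *v k - M *v k0) \<alpha>) * a \<alpha>) has_sum f (M *v k)) UNIV"
      by (intro a(4) nr)
  qed
  then show ?thesis using \<rho>'(1) analytic_nearI by blast
qed

section \<open>Integration over a fundamental cell\<close>

declare transpose_matrix_vector [simp del]

lemma orthogonal_matrix_mult_self:
  fixes M :: "real^'n^'n"
  assumes "orthogonal_matrix M"
  shows "M *v (transpose M *v r) = r" "transpose M *v (M *v r) = r"
  using assms by (simp_all add: matrix_vector_mul_assoc orthogonal_matrix_def del: transpose_matrix_vector)

lemma orthogonal_matrix_inner: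
  fixes M :: "real^'n^'n"
  assumes "orthogonal_matrix M"
  shows "(M *v x) \<bullet> (M *v y) = x \<bullet> y"
proof -
  have "(M *v x) \<bullet> (M *v y) = (transpose M *v (M *v x)) \<bullet> y"
    by (simp add: dot_lmul_matrix transpose_matrix_vector)
  then show ?thesis by (simp only: orthogonal_matrix_mult_self(2)[OF assms])
qed

lemma orthogonal_matrix_norm_eq:
  fixes M :: "real^'n^'n"
  shows "orthogonal_matrix M \<Longrightarrow> norm (M *v x) = norm x"
  by (simp add: norm_eq orthogonal_matrix_inner)

lemma measurable_matrix_mult [measurable]: "(*v) (M :: real^'n^'m) \<in> borel_measurable borel"
  by (intro borel_measurable_continuous_onI matrix_vector_mult_linear_continuous_on)

lemma measurable_vec_nth [measurable (raw)]:
  fixes f :: "'x \<Rightarrow> 'a::euclidean_space^'n"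
  assumes "f \<in> borel_measurable M"
  shows "(\<lambda>x. f x $ i) \<in> borel_measurable M"
  by (rule measurable_compose[OF assms]) (intro borel_measurable_continuous_onI continuous_intros)

text \<open>
  A translation-invariant measure that agrees with the Lebesgue measure on the unit ball is the
  Lebesgue measure: compare \<open>\<integral>\<integral> f(x) g(y)\<close> for the two product measures, where \<open>g\<close> is the
  indicator of the ball.
\<close>

lemma nn_integral_orthogonal:
  fixes M :: "real^'d^'d" and f :: "real^'d \<Rightarrow> ennreal"
  assumes M: "orthogonal_matrix M" and f[measurable]: "f \<in> borel_measurable borel"
  shows "(\<integral>\<^sup>+x. f (M *v x) \<partial>lborel) = (\<integral>\<^sup>+x. f x \<partial>lborel)"
proof -
  have tr: "(\<integral>\<^sup>+x. h (x + a) \<partial>lborel) = (\<integral>\<^sup>+x. h x \<partial>lborel)"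
    if [measurable]: "h \<in> borel_measurable borel" for h :: "real^'d \<Rightarrow> ennreal" and a
    by (subst (2) lborel_distr_plus[of a, symmetric]) (simp add: nn_integral_distr add.commute)
  have neg: "(\<integral>\<^sup>+x. h (- x) \<partial>lborel) = (\<integral>\<^sup>+x. h x \<partial>lborel)"
    if [measurable]: "h \<in> borel_measurable borel" for h :: "real^'d \<Rightarrow> ennreal"
    by (subst (2) lborel_affine[of "-1" 0]) (simp_all add: nn_integral_distr nn_integral_density)
  define g :: "real^'d \<Rightarrow> ennreal" where "g = indicator (ball 0 1)"
  have [measurable]: "g \<in> borel_measurable borel" unfolding g_def by (intro borel_measurable_indicator) simp
  have gM: "g (M *v x) = g x" for x
    by (simp add: g_def indicator_def orthogonal_matrix_norm_eq[OF M])
  let ?I = "\<lambda>h. \<integral>\<^sup>+x. h x \<partial>(lborel :: (real^'d) measure)"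
  have MM: "M *v (transpose M *v x) = x" for x by (rule orthogonal_matrix_mult_self[OF M])
  have trM: "(\<integral>\<^sup>+x. f (M *v x) \<partial>lborel) = (\<integral>\<^sup>+x. f (M *v x + y) \<partial>lborel)" for y
    using tr[of "\<lambda>x. f (M *v x)" "transpose M *v y"] by (simp add: matrix_vector_right_distrib MM)
  have "?I (\<lambda>x. f (M *v x)) * ?I g = (\<integral>\<^sup>+y. ?I (\<lambda>x. f (M *v x)) * g y \<partial>lborel)"
    by (simp add: nn_integral_cmult)
  also have "\<dots> = (\<integral>\<^sup>+y. (\<integral>\<^sup>+x. f (M *v x + y) * g y \<partial>lborel) \<partial>lborel)"
    by (intro nn_integral_cong) (simp add: nn_integral_multc trM[symmetric])
  also have "\<dots> = (\<integral>\<^sup>+x. (\<integral>\<^sup>+y. f (M *v x + y) * g y \<partial>lborel) \<partial>lborel)"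
    by (rule lborel_pair.Fubini'[symmetric]) measurable
  also have "\<dots> = (\<integral>\<^sup>+x. (\<integral>\<^sup>+y. f y * g (y - M *v x) \<partial>lborel) \<partial>lborel)"
  proof (rule nn_integral_cong)
    fix x
    show "(\<integral>\<^sup>+y. f (M *v x + y) * g y \<partial>lborel) = (\<integral>\<^sup>+y. f y * g (y - M *v x) \<partial>lborel)"
      using tr[of "\<lambda>y. f y * g (y - M *v x)" "M *v x"] by (simp add: add.commute)
  qed
  also have "\<dots> = (\<integral>\<^sup>+y. (\<integral>\<^sup>+x. f y * g (y - M *v x) \<partial>lborel) \<partial>lborel)"
    by (rule lborel_pair.Fubini') measurable
  also have "\<dots> = (\<integral>\<^sup>+y. f y * ?I g \<partial>lborel)"
  proof (rule nn_integral_cong)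
    fix y
    have "y - M *v x = M *v (transpose M *v y - x)" for x
      by (simp add: matrix_vector_mult_diff_distrib MM)
    then have "(\<integral>\<^sup>+x. g (y - M *v x) \<partial>lborel) = (\<integral>\<^sup>+x. g (- (x + (- (transpose M *v y)))) \<partial>lborel)"
      by (simp add: gM)
    also have "\<dots> = ?I g"
      by (subst tr[of "\<lambda>x. g (- x)"]) (simp_all add: neg)
    finally show "(\<integral>\<^sup>+x. f y * g (y - M *v x) \<partial>lborel) = f y * ?I g"
      by (simp add: nn_integral_cmult)
  qed
  also have "\<dots> = ?I f * ?I g" by (simp add: nn_integral_multc)
  finally have eq: "?I (\<lambda>x. f (M *v x)) * ?I g = ?I f * ?I g" .
  have "?I g = emeasure lborel (ball (0::real^'d) 1)" by (simp add: g_def)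
  then have "?I g \<noteq> 0" "?I g \<noteq> \<infinity>"
    using emeasure_lborel_ball_finite[of "0::real^'d" 1] content_ball_pos[of 1 "0::real^'d"]
    by (auto simp: measure_def)
  with eq show ?thesis
    by (simp add: mult.commute[of _ "?I g"] ennreal_mult_cancel_left)
qed

lemma distr_lborel_orthogonal:
  fixes M :: "real^'d^'d"
  assumes "orthogonal_matrix M"
  shows "distr lborel borel ((*v) M) = lborel"
proof (rule measure_eqI)
  fix A assume "A \<in> sets (distr lborel borel ((*v) M))"
  then have [measurable]: "A \<in> sets borel" by simp
  have "emeasure (distr lborel borel ((*v) M)) A = (\<integral>\<^sup>+x. indicator A x \<partial>distr lborel borel ((*v) M))"
    by simp
  also have "\<dots> = (\<integral>\<^sup>+x. indicator A (M *v x) \<partial>lborel)"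
    by (rule nn_integral_distr) simp_all
  also have "\<dots> = emeasure lborel A"
    by (subst nn_integral_orthogonal[OF assms]) simp_all
  finally show "emeasure (distr lborel borel ((*v) M)) A = emeasure lborel A" .
qed simp

lemma AE_lborel_orthogonal:
  fixes M :: "real^'d^'d"
  assumes "orthogonal_matrix M" "AE r in lborel. Q r"
  shows "AE r in lborel. Q (M *v r)"
proof -
  obtain N where N: "{r. \<not> Q r} \<subseteq> N" "N \<in> null_sets lborel"
    using assms(2) by (auto simp: eventually_ae_filter)
  then have "AE r in distr lborel borel ((*v) M). r \<notin> N"
    unfolding distr_lborel_orthogonal[OF assms(1)] by (intro AE_not_in)
  then have "AE r in lborel. M *v r \<notin> N"
    by (subst (asm) AE_distr_iff) (use N in \<open>auto simp: null_sets_def\<close>)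
  then show ?thesis by (rule AE_mp) (use N in auto)
qed

lemma AE_lborel_translate:
  fixes a :: "'a::euclidean_space"
  assumes "AE r in lborel. Q r"
  shows "AE r in lborel. Q (r + a)"
proof -
  obtain N where N: "{r. \<not> Q r} \<subseteq> N" "N \<in> null_sets lborel"
    using assms by (auto simp: eventually_ae_filter)
  then have "AE r in distr lborel borel ((+) a). r \<notin> N"
    unfolding lborel_distr_plus by (intro AE_not_in)
  then have "AE r in lborel. a + r \<notin> N"
    by (subst (asm) AE_distr_iff) (use N in \<open>auto simp: null_sets_def\<close>)
  then show ?thesis by (rule AE_mp) (use N in \<open>auto simp: add.commute\<close>)
qed

section \<open>Lattice coordinates, the fundamental cell and periodic functions\<close>

locale full_lattice =
  fixes L :: "(real^'d) set"
  assumes full_rank: "full_rank_lattice L"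
begin

text \<open>The choice term coincides with the one inside \<open>unit_cell\<close>, so that lying in
  the cell becomes a condition on \<open>coords\<close>.\<close>

definition basis :: "real^'d^'d" where "basis = (SOME A. lattice_basis A L)"

definition coords :: "real^'d \<Rightarrow> real^'d" where "coords r = matrix_inv basis *v r"

definition cell_rep :: "real^'d \<Rightarrow> real^'d" where
  "cell_rep r = basis *v (\<chi> i. frac (coords r $ i))"

lemma basis: "lattice_basis basis L"
  using full_rank unfolding full_rank_lattice_def basis_def by (rule someI_ex)

lemma basis_coords [simp]: "basis *v coords r = r" "coords (basis *v x) = x"
proof -
  have "basis ** matrix_inv basis = mat 1 \<and> matrix_inv basis ** basis = mat 1"
    unfolding matrix_inv_def by (rule someI_ex) (use basis in \<open>simp add: lattice_basis_def invertible_def\<close>)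
  then show "basis *v coords r = r" "coords (basis *v x) = x"
    by (simp_all add: coords_def matrix_vector_mul_assoc)
qed

lemma mem_lattice_iff: "R \<in> L \<longleftrightarrow> (\<forall>i. coords R $ i \<in> \<int>)"
proof
  assume "R \<in> L"
  then obtain n where "R = basis *v (\<chi> i. of_int (n i))"
    using basis by (auto simp: lattice_basis_def)
  then show "\<forall>i. coords R $ i \<in> \<int>" by simp
next
  assume "\<forall>i. coords R $ i \<in> \<int>"
  then have "\<forall>i. \<exists>n::int. coords R $ i = of_int n" by (auto elim: Ints_cases)
  then obtain n where "\<And>i. coords R $ i = of_int (n i)" by metis
  then have "coords R = (\<chi> i. of_int (n i))" by (simp add: vec_eq_iff)
  then have "R = basis *v (\<chi> i. of_int (n i))" using basis_coords(1)[of R] by simp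
  then show "R \<in> L" using basis by (auto simp: lattice_basis_def)
qed

lemma coords_add: "coords (x + y) = coords x + coords y"
  and coords_diff: "coords (x - y) = coords x - coords y"
  and coords_zero: "coords 0 = 0"
  by (simp_all add: coords_def matrix_vector_right_distrib matrix_vector_mult_diff_distrib)

lemma lattice_zero: "0 \<in> L" and lattice_add: "x \<in> L \<Longrightarrow> y \<in> L \<Longrightarrow> x + y \<in> L"
  and lattice_diff: "x \<in> L \<Longrightarrow> y \<in> L \<Longrightarrow> x - y \<in> L"
  and lattice_minus: "x \<in> L \<Longrightarrow> - x \<in> L"
  using coords_diff[of 0 x]
  by (auto simp: mem_lattice_iff coords_add coords_diff coords_zero)

lemma countable_lattice: "countable L"
proof -
  have "countable (UNIV :: ('d \<Rightarrow> int) set)"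
    using countable_PiE[of UNIV "\<lambda>_::'d. UNIV :: int set"] by (simp add: PiE_UNIV_domain)
  moreover have "L = range (\<lambda>n :: 'd \<Rightarrow> int. basis *v (\<chi> i. of_int (n i)))"
    using basis unfolding lattice_basis_def by blast
  ultimately show ?thesis by (metis countable_image)
qed

lemma mem_cell_iff: "r \<in> unit_cell L \<longleftrightarrow> (\<forall>i. 0 \<le> coords r $ i \<and> coords r $ i < 1)"
  unfolding unit_cell_def basis_def[symmetric]
proof
  assume "r \<in> (*v) basis ` {x. \<forall>i. 0 \<le> x $ i \<and> x $ i < 1}"
  then show "\<forall>i. 0 \<le> coords r $ i \<and> coords r $ i < 1" by auto
next
  assume "\<forall>i. 0 \<le> coords r $ i \<and> coords r $ i < 1"
  then show "r \<in> (*v) basis ` {x. \<forall>i. 0 \<le> x $ i \<and> x $ i < 1}"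
    by (intro image_eqI[of _ _ "coords r"]) auto
qed

lemma cell_rep_in: "cell_rep r \<in> unit_cell L"
  by (simp add: mem_cell_iff cell_rep_def frac_lt_1)

lemma diff_cell_rep: "r - cell_rep r \<in> L"
  by (simp add: mem_lattice_iff cell_rep_def coords_diff frac_def)

lemma cell_rep_add: "R \<in> L \<Longrightarrow> cell_rep (r + R) = cell_rep r"
  by (simp add: cell_rep_def coords_add mem_lattice_iff frac_add_int_right)

lemma cell_rep_cell: "r \<in> unit_cell L \<Longrightarrow> cell_rep r = r"
  using frac_eq by (simp add: cell_rep_def mem_cell_iff)

lemma cell_rep_unique: "r - R \<in> unit_cell L \<Longrightarrow> R \<in> L \<Longrightarrow> cell_rep r = r - R"
  using cell_rep_cell[of "r - R"] cell_rep_add[of R "r - R"] by simp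

lemma measurable_coords [measurable]: "coords \<in> borel_measurable borel"
  unfolding coords_def[abs_def] by measurable

lemma measurable_cell_rep [measurable]: "cell_rep \<in> borel_measurable borel"
proof -
  have fr: "(frac :: real \<Rightarrow> real) \<in> borel_measurable borel"
    unfolding frac_def[abs_def] by measurable
  have "(\<lambda>r. \<chi> i. frac (coords r $ i)) \<in> borel_measurable borel"
    by (subst borel_measurable_euclidean_space)
      (auto simp: Basis_vec_def inner_axis intro!: measurable_compose[OF _ fr])
  then show ?thesis
    unfolding cell_rep_def[abs_def] by measurable
qed

lemma cell_borel [measurable]: "unit_cell L \<in> sets borel"
proof -
  have "unit_cell L = {r \<in> space borel. \<forall>i\<in>UNIV. 0 \<le> coords r $ i \<and> coords r $ i < 1}"
    by (auto simp: mem_cell_iff)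
  also have "\<dots> \<in> sets borel" by measurable
  finally show ?thesis .
qed

lemma cell_bounded: "\<exists>b>0. \<forall>r\<in>unit_cell L. norm r \<le> b"
proof -
  have "bounded (cbox (0::real^'d) 1)" by (rule bounded_cbox)
  then have "bounded ((*v) basis ` cbox 0 1)"
    by (intro bounded_linear_image matrix_vector_mul_bounded_linear)
  moreover have "unit_cell L \<subseteq> (*v) basis ` cbox 0 1"
  proof
    fix r assume "r \<in> unit_cell L"
    then have "coords r \<in> cbox 0 1"
      by (auto simp: mem_cell_iff mem_box_cart less_imp_le)
    then show "r \<in> (*v) basis ` cbox 0 1" by (intro image_eqI[of _ _ "coords r"]) auto
  qed
  ultimately have "bounded (unit_cell L)" by (rule bounded_subset)
  then show ?thesis by (auto simp: bounded_pos)
qed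

lemma cell_rep_bounded: "\<exists>b>0. \<forall>r. norm (cell_rep r) \<le> b"
  using cell_bounded cell_rep_in by blast

text \<open>\<open>r\<close> and \<open>cell_rep r\<close> differ by a lattice vector that depends
  on \<open>r\<close>. As the lattice is countable, one null set serves for all translations
  simultaneously.\<close>

lemma AE_cell_rep_eq:
  assumes "\<And>R. R \<in> L \<Longrightarrow> AE r in lborel. F (r + R) = F r"
  shows "AE r in lborel. F (cell_rep r) = F r"
proof -
  have "AE r in lborel. \<forall>R\<in>L. F (r + R) = F r"
    by (rule AE_ball_countable'[OF assms countable_lattice])
  then show ?thesis
  proof (rule AE_mp, intro AE_I2 impI)
    fix r assume "\<forall>R\<in>L. F (r + R) = F r"
    from this[rule_format, OF lattice_minus[OF diff_cell_rep[of r]]] show "F (cell_rep r) = F r" by simp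
  qed
qed

lemma AE_cell_rep:
  assumes "AE r in lborel. r \<in> unit_cell L \<longrightarrow> Q r"
  shows "AE r in lborel. Q (cell_rep r)"
proof -
  have "AE r in lborel. \<forall>R\<in>L. r + R \<in> unit_cell L \<longrightarrow> Q (r + R)"
    by (rule AE_ball_countable'[OF AE_lborel_translate[OF assms] countable_lattice])
  then show ?thesis
  proof (rule AE_mp, intro AE_I2 impI)
    fix r assume "\<forall>R\<in>L. r + R \<in> unit_cell L \<longrightarrow> Q (r + R)"
    from this[rule_format, OF lattice_minus[OF diff_cell_rep[of r]]] show "Q (cell_rep r)"
      using cell_rep_in by simp
  qed
qed

text \<open>Cut the fundamental domain \<open>D\<close> into the countably many pieces on which
  \<open>cell_rep\<close> is translation by one fixed lattice vector. The translated pieces tile the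
  cell, and each keeps its measure.\<close>

lemma distr_cell_rep:
  assumes D[measurable]: "D \<in> sets borel" and uniq: "\<And>r. \<exists>!R. R \<in> L \<and> r + R \<in> D"
  shows "distr (density lborel (indicator D)) borel cell_rep = density lborel (indicator (unit_cell L))"
proof (rule measure_eqI)
  fix S assume "S \<in> sets (distr (density lborel (indicator D)) borel cell_rep)"
  then have S[measurable]: "S \<in> sets borel" by simp
  let ?C = "unit_cell L"
  have [measurable]: "{r. r - R \<in> ?C \<inter> S} \<in> sets borel" for R
    using measurable_sets[of "\<lambda>r. r - R" borel borel "?C \<inter> S"] by (simp add: vimage_def)
  have [measurable]: "{r. r + R \<in> D} \<in> sets borel" for R
    using measurable_sets[of "\<lambda>r. r + R" borel borel D] by (simp add: vimage_def)
  have 1: "cell_rep -` S \<inter> D = (\<Union>R\<in>L. {r. r - R \<in> ?C \<inter> S} \<inter> D)"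
  proof safe
    fix r assume "cell_rep r \<in> S" "r \<in> D"
    then show "r \<in> (\<Union>R\<in>L. {r. r - R \<in> ?C \<inter> S} \<inter> D)"
      using cell_rep_in[of r] diff_cell_rep[of r] by (intro UN_I[of "r - cell_rep r"]) auto
  qed (auto dest: cell_rep_unique)
  have 2: "?C \<inter> S = (\<Union>R\<in>L. {r. r + R \<in> D} \<inter> (?C \<inter> S))"
    using ex1_implies_ex[OF uniq] by auto
  have m: "emeasure lborel ({r. r - R \<in> ?C \<inter> S} \<inter> D) = emeasure lborel ({r. r + R \<in> D} \<inter> (?C \<inter> S))" for R
  proof -
    have "emeasure lborel ({r. r - R \<in> ?C \<inter> S} \<inter> D) =
        emeasure (distr lborel borel ((+) R)) ({r. r - R \<in> ?C \<inter> S} \<inter> D)"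
      by (simp only: lborel_distr_plus)
    also have "\<dots> = emeasure lborel ((+) R -` ({r. r - R \<in> ?C \<inter> S} \<inter> D))"
      by (subst emeasure_distr) auto
    also have "(+) R -` ({r. r - R \<in> ?C \<inter> S} \<inter> D) = {r. r + R \<in> D} \<inter> (?C \<inter> S)"
      by (auto simp: add.commute)
    finally show ?thesis .
  qed
  have "emeasure (distr (density lborel (indicator D)) borel cell_rep) S
      = emeasure (density lborel (indicator D)) (cell_rep -` S)"
    by (subst emeasure_distr) (auto simp: measurable_cong_sets[OF sets_density refl])
  also have "\<dots> = (\<integral>\<^sup>+ r. indicator D r * indicator (cell_rep -` S) r \<partial>lborel)"
    using measurable_sets[OF measurable_cell_rep S] by (subst emeasure_density) auto
  also have "\<dots> = (\<integral>\<^sup>+ r. indicator (cell_rep -` S \<inter> D) r \<partial>lborel)"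
    by (intro nn_integral_cong) (auto simp: indicator_def)
  also have "\<dots> = emeasure lborel (cell_rep -` S \<inter> D)"
    using measurable_sets[OF measurable_cell_rep S] by (subst nn_integral_indicator) auto
  also have "\<dots> = (\<integral>\<^sup>+ R. emeasure lborel ({r. r - R \<in> ?C \<inter> S} \<inter> D) \<partial>count_space L)"
    unfolding 1
  proof (rule emeasure_UN_countable[OF _ countable_lattice])
    show "disjoint_family_on (\<lambda>R. {r. r - R \<in> ?C \<inter> S} \<inter> D) L"
      unfolding disjoint_family_on_def
    proof (intro ballI impI, rule equals0I)
      fix R R' r assume R: "R \<in> L" "R' \<in> L" "R \<noteq> R'"
        "r \<in> {r. r - R \<in> ?C \<inter> S} \<inter> D \<inter> ({r. r - R' \<in> ?C \<inter> S} \<inter> D)"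
      then have "cell_rep r = r - R" "cell_rep r = r - R'" by (auto intro: cell_rep_unique)
      with R(3) show False by simp
    qed
  qed simp
  also have "\<dots> = (\<integral>\<^sup>+ R. emeasure lborel ({r. r + R \<in> D} \<inter> (?C \<inter> S)) \<partial>count_space L)"
    by (simp only: m)
  also have "\<dots> = emeasure lborel (\<Union>R\<in>L. {r. r + R \<in> D} \<inter> (?C \<inter> S))"
    by (rule emeasure_UN_countable[OF _ countable_lattice, symmetric])
      (use uniq in \<open>auto simp: disjoint_family_on_def\<close>)
  also have "\<dots> = emeasure lborel (?C \<inter> S)"
    by (rule arg_cong[where f = "emeasure lborel", OF 2[symmetric]])
  also have "\<dots> = (\<integral>\<^sup>+ r. indicator (?C \<inter> S) r \<partial>lborel)"
    by (subst nn_integral_indicator) auto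
  also have "\<dots> = (\<integral>\<^sup>+ r. indicator ?C r * indicator S r \<partial>lborel)"
    by (intro nn_integral_cong) (auto simp: indicator_def)
  also have "\<dots> = emeasure (density lborel (indicator ?C)) S"
    by (subst emeasure_density) auto
  finally show "emeasure (distr (density lborel (indicator D)) borel cell_rep) S =
      emeasure (density lborel (indicator ?C)) S" .
qed simp

lemma integral_fundamental_domain:
  fixes G :: "real^'d \<Rightarrow> 'b::{banach,second_countable_topology}"
  assumes D[measurable]: "D \<in> sets borel" and uniq: "\<And>r. \<exists>!R. R \<in> L \<and> r + R \<in> D"
    and G[measurable]: "G \<in> borel_measurable borel"
  shows "(LINT r:D|lborel. G (cell_rep r)) = (LINT r:unit_cell L|lborel. G r)"
proof -
  have dens: "(LINT r:A|lborel. h r) = integral\<^sup>L (density lborel (indicator A)) h"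
    if [measurable]: "A \<in> sets borel" "h \<in> borel_measurable borel" for A and h :: "real^'d \<Rightarrow> 'b"
  proof -
    have "(indicator A :: real^'d \<Rightarrow> ennreal) = (\<lambda>x. ennreal (indicator A x))"
      by (auto simp: indicator_def)
    then show ?thesis
      unfolding set_lebesgue_integral_def by (simp add: integral_density)
  qed
  have "(LINT r:D|lborel. G (cell_rep r)) = integral\<^sup>L (density lborel (indicator D)) (\<lambda>r. G (cell_rep r))"
    by (rule dens) measurable
  also have "\<dots> = integral\<^sup>L (distr (density lborel (indicator D)) borel cell_rep) G"
    by (subst integral_distr) auto
  also have "\<dots> = (LINT r:unit_cell L|lborel. G r)"
    by (simp add: distr_cell_rep[OF D uniq] dens)
  finally show ?thesis .
qed

text \<open>The substitution replaces the cell by its image under \<open>M\<close>. Since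
  \<open>M\<close> permutes the lattice, the image is again a fundamental domain, and a periodic
  function has the same integral over both.\<close>

lemma cell_integral_orthogonal:
  fixes F :: "real^'d \<Rightarrow> 'b::{banach,second_countable_topology}"
  assumes F[measurable]: "F \<in> borel_measurable borel"
    and per: "\<And>R. R \<in> L \<Longrightarrow> AE r in lborel. F (r + R) = F r"
    and M: "orthogonal_matrix M" and inv: "(*v) M ` L = L"
  shows "(LINT r:unit_cell L|lborel. F (M *v r)) = (LINT r:unit_cell L|lborel. F r)"
proof -
  let ?C = "unit_cell L" and ?Mt = "transpose M"
  let ?D = "(*v) ?Mt -` ?C"
  have D[measurable]: "?D \<in> sets borel"
    using measurable_sets[OF measurable_matrix_mult[of ?Mt] cell_borel] by simp
  have MtL: "?Mt *v R \<in> L" if "R \<in> L" for R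
    using that inv orthogonal_matrix_mult_self(2)[OF M] by (metis imageE)
  have uniq: "\<exists>!R. R \<in> L \<and> r + R \<in> ?D" for r
  proof (rule ex1I)
    let ?y = "?Mt *v r"
    \<comment> \<open>The translated point lies in \<open>?D\<close> exactly if \<open>?y\<close>
      plus the back-rotated lattice vector lies in the cell, hence equals
      \<open>cell_rep ?y\<close>; this equation is solved for the lattice vector.\<close>
    show "M *v (cell_rep ?y - ?y) \<in> L \<and> r + M *v (cell_rep ?y - ?y) \<in> ?D"
    proof
      have "cell_rep ?y - ?y \<in> L" using lattice_minus[OF diff_cell_rep[of ?y]] by simp
      then show "M *v (cell_rep ?y - ?y) \<in> L" using inv by blast
      have "?Mt *v (r + M *v (cell_rep ?y - ?y)) = cell_rep ?y"
        by (simp add: matrix_vector_right_distrib orthogonal_matrix_mult_self[OF M])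
      then show "r + M *v (cell_rep ?y - ?y) \<in> ?D" using cell_rep_in by simp
    qed
    fix R assume R: "R \<in> L \<and> r + R \<in> ?D"
    then have "?y - (- (?Mt *v R)) \<in> ?C" "- (?Mt *v R) \<in> L"
      using MtL lattice_minus by (auto simp: matrix_vector_right_distrib)
    then have "cell_rep ?y = ?y + ?Mt *v R" using cell_rep_unique by fastforce
    then show "R = M *v (cell_rep ?y - ?y)"
      by (simp add: orthogonal_matrix_mult_self[OF M])
  qed
  have ae: "AE r in lborel. F (cell_rep r) = F r" by (rule AE_cell_rep_eq[OF per])
  have "(LINT r:?C|lborel. F (M *v r)) = (LINT r:?C|lborel. F (cell_rep (M *v r)))"
    unfolding set_lebesgue_integral_def
    by (rule integral_cong_AE) (measurable, use AE_lborel_orthogonal[OF M ae] in auto)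
  also have "\<dots> = (LINT r:?D|lborel. F (cell_rep r))"
    unfolding set_lebesgue_integral_def
    apply (subst (2) distr_lborel_orthogonal[OF M, symmetric])
    apply (subst integral_distr)
      apply (auto simp: indicator_def orthogonal_matrix_mult_self[OF M])
    done
  also have "\<dots> = (LINT r:?C|lborel. F r)"
    by (rule integral_fundamental_domain[OF D uniq F])
  finally show ?thesis .
qed

end

section \<open>Square-integrable spinor functions on the cell\<close>

lemma summable_on_prod_multiindex:
  fixes g :: "'d::finite \<Rightarrow> nat \<Rightarrow> real"
  assumes nonneg: "\<And>i n. 0 \<le> g i n" and sum: "\<And>i. (g i) summable_on UNIV"
  shows "(\<lambda>\<alpha>. \<Prod>i\<in>UNIV. g i (\<alpha> i)) summable_on UNIV"
proof (rule nonneg_bdd_above_summable_on)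
  show "bdd_above (sum (\<lambda>\<alpha>. \<Prod>i\<in>UNIV. g i (\<alpha> i)) ` {F. F \<subseteq> UNIV \<and> finite F})"
  proof (rule bdd_aboveI2)
    fix F :: "('d \<Rightarrow> nat) set" assume "F \<in> {F. F \<subseteq> UNIV \<and> finite F}"
    then have F: "finite F" by simp
    define n where "n = Max (insert 0 ((\<lambda>(\<alpha>, i). \<alpha> i) ` (F \<times> UNIV)))"
    have n: "\<alpha> i \<le> n" if "\<alpha> \<in> F" for \<alpha> i
      unfolding n_def using that F by (intro Max_ge) auto
    have sub: "F \<subseteq> PiE UNIV (\<lambda>_. {..n})" using n by (auto simp: PiE_iff)
    have "(\<Sum>\<alpha>\<in>F. \<Prod>i\<in>UNIV. g i (\<alpha> i)) \<le> (\<Sum>\<alpha>\<in>PiE UNIV (\<lambda>_. {..n}). \<Prod>i\<in>UNIV. g i (\<alpha> i))"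
      by (intro sum_mono2 sub finite_PiE) (auto intro: prod_nonneg nonneg)
    also have "\<dots> = (\<Prod>i\<in>UNIV. \<Sum>j\<le>n. g i j)"
      by (subst prod_sum_PiE) auto
    also have "\<dots> \<le> (\<Prod>i\<in>UNIV. infsum (g i) UNIV)"
      by (intro prod_mono conjI sum_nonneg nonneg finite_sum_le_infsum sum) (auto simp: nonneg)
    finally show "(\<Sum>\<alpha>\<in>F. \<Prod>i\<in>UNIV. g i (\<alpha> i)) \<le> (\<Prod>i\<in>UNIV. infsum (g i) UNIV)" .
  qed
qed (auto intro: prod_nonneg nonneg)

lemma summable_on_power_mdeg:
  fixes q :: real
  assumes "0 \<le> q" "q < 1"
  shows "(\<lambda>\<alpha>. q ^ mdeg (\<alpha> :: 'd::finite \<Rightarrow> nat)) summable_on UNIV"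
proof -
  have "(\<lambda>n. q ^ n) summable_on UNIV"
    using assms by (intro norm_summable_imp_summable_on) (simp add: norm_power)
  from summable_on_prod_multiindex[of "\<lambda>_ n. q ^ n", OF _ this]
  show ?thesis using assms by (simp add: mdeg_def power_sum)
qed

text \<open>Abel's lemma: convergence at one corner of a cube bounds all terms there, and at half
  the radius a geometric series in \<open>mdeg\<close> takes over. \<open>V\<close> and
  \<open>N\<close> stay abstract because the lemma serves functions with the cell norm as well as
  operators with the operator norm.\<close>

lemma real_analytic_wrt_abs_convergent:
  fixes N :: "'v::real_vector \<Rightarrow> real" and f :: "real^'d \<Rightarrow> 'v"
  assumes an: "real_analytic_wrt V N f"
    and add: "\<And>x y. x \<in> V \<Longrightarrow> y \<in> V \<Longrightarrow> x + y \<in> V"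
    and scale: "\<And>a x. x \<in> V \<Longrightarrow> a *\<^sub>R x \<in> V"
    and triangle: "\<And>x y. x \<in> V \<Longrightarrow> y \<in> V \<Longrightarrow> N (x + y) \<le> N x + N y"
    and homog: "\<And>a x. x \<in> V \<Longrightarrow> N (a *\<^sub>R x) = \<bar>a\<bar> * N x"
    and f: "\<And>k. f k \<in> V"
  obtains c \<rho> where "\<rho> > 0" "\<And>\<alpha>. c \<alpha> \<in> V" "(\<lambda>\<alpha>. N (c \<alpha>) * \<rho> ^ mdeg \<alpha>) summable_on UNIV"
    "\<And>k. near \<rho> k0 k \<Longrightarrow>
      ((\<lambda>S. N (f k - (\<Sum>\<alpha>\<in>S. mpow (k - k0) \<alpha> *\<^sub>R c \<alpha>))) \<longlongrightarrow> 0) (finite_subsets_at_top UNIV)"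
proof -
  obtain c r where r: "r > 0" "\<And>\<alpha>. c \<alpha> \<in> V" and
    lim: "\<And>k. k \<in> ball k0 r \<Longrightarrow>
      ((\<lambda>S. N (f k - (\<Sum>\<alpha>\<in>S. mpow (k - k0) \<alpha> *\<^sub>R c \<alpha>))) \<longlongrightarrow> 0) (finite_subsets_at_top UNIV)"
    using an unfolding real_analytic_wrt_def mpow_def vector_minus_component by meson
  obtain t where t: "t > 0" "\<And>k. near t k0 k \<Longrightarrow> k \<in> ball k0 r"
    using near_imp_ball[OF r(1)] by blast
  have V0: "0 \<in> V" using scale[OF f[of 0], of 0] by simp
  have N0: "N 0 = 0" using homog[OF V0, of 0] by simp
  have minus: "- x \<in> V" "N (- x) = N x" if "x \<in> V" for x
    using scale[OF that, of "-1"] homog[OF that, of "-1"] by simp_all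
  have nonneg: "0 \<le> N x" if "x \<in> V" for x
    using triangle[OF that minus(1)[OF that]] minus(2)[OF that] N0 by simp
  have sumV: "(\<Sum>\<alpha>\<in>S. a \<alpha> *\<^sub>R c \<alpha>) \<in> V" for a and S :: "('d \<Rightarrow> nat) set"
    by (induction S rule: infinite_finite_induct) (auto intro: add scale V0 r(2))
  \<comment> \<open>At this corner of the cube every monomial takes its largest absolute value
    \<open>t ^ mdeg \<alpha>\<close>.\<close>
  define k1 where "k1 = k0 + (\<chi> i. t)"
  have mp: "mpow (k1 - k0) \<alpha> = t ^ mdeg \<alpha>" for \<alpha>
    by (simp add: k1_def mpow_def mdeg_def power_sum)
  have "near t k0 k1" using t(1) by (simp add: near_def k1_def)
  from lim[OF t(2)[OF this]]
  have "eventually (\<lambda>S. N (f k1 - (\<Sum>\<alpha>\<in>S. t ^ mdeg \<alpha> *\<^sub>R c \<alpha>)) < 1) (finite_subsets_at_top UNIV)"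
    unfolding mp by (rule order_tendstoD) simp
  then obtain S0 where S0: "finite S0"
    "\<And>S. finite S \<Longrightarrow> S0 \<subseteq> S \<Longrightarrow> N (f k1 - (\<Sum>\<alpha>\<in>S. t ^ mdeg \<alpha> *\<^sub>R c \<alpha>)) < 1"
    unfolding eventually_finite_subsets_at_top by auto
  \<comment> \<open>A term outside \<open>S0\<close> is the difference of two remainders of seminorm
    below \<open>1\<close>, hence bounded by \<open>2\<close>. The finitely many terms in
    \<open>S0\<close> are bounded by their sum.\<close>
  define M where "M = 2 + (\<Sum>\<alpha>\<in>S0. t ^ mdeg \<alpha> * N (c \<alpha>))"
  have M: "t ^ mdeg \<alpha> * N (c \<alpha>) \<le> M" for \<alpha>
  proof (cases "\<alpha> \<in> S0")
    case True
    then have "t ^ mdeg \<alpha> * N (c \<alpha>) \<le> (\<Sum>\<alpha>\<in>S0. t ^ mdeg \<alpha> * N (c \<alpha>))"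
      using S0(1) t(1) nonneg r(2) by (intro member_le_sum) auto
    then show ?thesis by (simp add: M_def)
  next
    case False
    let ?s = "\<lambda>S. \<Sum>\<alpha>\<in>S. t ^ mdeg \<alpha> *\<^sub>R c \<alpha>"
    have fs: "f k1 - ?s S \<in> V" for S
      using add[OF f minus(1)[OF sumV]] by simp
    have "t ^ mdeg \<alpha> *\<^sub>R c \<alpha> = (f k1 - ?s S0) + - (f k1 - ?s (insert \<alpha> S0))"
      using False S0(1) by simp
    then have "N (t ^ mdeg \<alpha> *\<^sub>R c \<alpha>) \<le> N (f k1 - ?s S0) + N (f k1 - ?s (insert \<alpha> S0))"
      using triangle[OF fs[of S0] minus(1)[OF fs[of "insert \<alpha> S0"]]] minus(2)[OF fs[of "insert \<alpha> S0"]] by simp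
    also have "\<dots> < 1 + 1" using S0 by (intro add_strict_mono S0(2)) auto
    finally have "t ^ mdeg \<alpha> * N (c \<alpha>) \<le> 2" using homog[OF r(2)] t(1) by simp
    moreover have "0 \<le> (\<Sum>\<alpha>\<in>S0. t ^ mdeg \<alpha> * N (c \<alpha>))"
      using t(1) nonneg r(2) by (intro sum_nonneg) auto
    ultimately show ?thesis by (simp add: M_def)
  qed
  show ?thesis
  proof
    show "t / 2 > 0" using t by simp
    show "c \<alpha> \<in> V" for \<alpha> by (rule r)
    have "(\<lambda>\<alpha> :: 'd \<Rightarrow> nat. M * (1/2) ^ mdeg \<alpha>) summable_on UNIV"
      by (intro summable_on_cmult_right summable_on_power_mdeg) auto
    then show "(\<lambda>\<alpha>. N (c \<alpha>) * (t / 2) ^ mdeg \<alpha>) summable_on UNIV"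
    proof (rule summable_on_comparison_test)
      fix \<alpha>
      show "N (c \<alpha>) * (t / 2) ^ mdeg \<alpha> \<le> M * (1/2) ^ mdeg \<alpha>"
        using mult_right_mono[OF M[of \<alpha>], of "(1/2) ^ mdeg \<alpha>"] by (simp add: power_divide mult.commute)
      show "0 \<le> N (c \<alpha>) * (t / 2) ^ mdeg \<alpha>" using nonneg r(2) t(1) by simp
    qed
    fix k assume "near (t / 2) k0 k"
    then have "near t k0 k" using t(1) by (elim near_mono) simp
    then show "((\<lambda>S. N (f k - (\<Sum>\<alpha>\<in>S. mpow (k - k0) \<alpha> *\<^sub>R c \<alpha>))) \<longlongrightarrow> 0) (finite_subsets_at_top UNIV)"
      using lim t(2) by blast
  qed
qed

section \<open>Spinor values and the pointwise Hermitian product\<close>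

lemma sum_fun_eval: "(\<Sum>i\<in>S. f i) x = (\<Sum>i\<in>S. f i x)"
  for f :: "'i \<Rightarrow> 'x \<Rightarrow> 'y::comm_monoid_add"
  by (induction S rule: infinite_finite_induct) auto

lemma norm_vec_smult [simp]: "norm (c *s v) = norm c * norm v"
  for v :: "complex^'m"
  by (simp add: norm_vec_def L2_set_def norm_mult power_mult_distrib sum_distrib_left[symmetric] real_sqrt_mult)

lemma bounded_bilinear_vec_smult: "bounded_bilinear ((*s) :: complex \<Rightarrow> complex^'m \<Rightarrow> complex^'m)"
  by (rule bounded_bilinear.intro)
    (auto simp: vec_eq_iff algebra_simps intro!: exI[of _ 1])

lemma measurable_vec_smult [measurable (raw)]:
  fixes f :: "'x \<Rightarrow> complex^'m"
  assumes "c \<in> borel_measurable M" "f \<in> borel_measurable M"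
  shows "(\<lambda>x. c x *s f x) \<in> borel_measurable M"
  by (rule borel_measurable_continuous_Pair[OF assms])
    (intro bounded_bilinear.continuous_on[OF bounded_bilinear_vec_smult] continuous_intros)

lemma measurable_cis [measurable]: "cis \<in> borel_measurable borel"
  by (intro borel_measurable_continuous_onI continuous_intros)

lemma measurable_herm_inner [measurable (raw)]:
  assumes [measurable]: "f \<in> borel_measurable M" "g \<in> borel_measurable M"
  shows "(\<lambda>x. herm_inner (f x) (g x)) \<in> borel_measurable M"
  unfolding herm_inner_def
  by (intro borel_measurable_sum borel_measurable_times measurable_vec_nth assms
      measurable_compose[OF measurable_vec_nth[OF assms(1)], of cnj]
      borel_measurable_continuous_onI continuous_intros)

lemma herm_inner_add_right: "herm_inner u (v + w) = herm_inner u v + herm_inner u w"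
  by (simp add: herm_inner_def algebra_simps sum.distrib)

lemma herm_inner_smult_right: "herm_inner u (c *s v) = c * herm_inner u v"
  by (simp add: herm_inner_def algebra_simps sum_distrib_left)

lemma herm_inner_cnj: "herm_inner v u = cnj (herm_inner u v)"
  by (simp add: herm_inner_def mult.commute)

lemma herm_inner_self: "herm_inner v v = of_real ((norm v)\<^sup>2)"
  by (simp add: herm_inner_def norm_vec_def L2_set_def sum_nonneg complex_norm_square mult.commute
      del: of_real_power)

lemma norm_herm_inner_le: "norm (herm_inner u v) \<le> norm u * norm v"
proof -
  have "norm (herm_inner u v) \<le> (\<Sum>i\<in>UNIV. \<bar>norm (u $ i)\<bar> * \<bar>norm (v $ i)\<bar>)"
    unfolding herm_inner_def by (rule order_trans[OF norm_sum]) (simp add: norm_mult)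
  also have "\<dots> \<le> norm u * norm v"
    unfolding norm_vec_def by (rule L2_set_mult_ineq)
  finally show ?thesis .
qed

text \<open>The set is a parameter because membership in \<open>torus_L2\<close> concerns all
  compact sets, while inner product and seminorm see only the cell.\<close>

definition square_integrable_on :: "(real^'d) set \<Rightarrow> (real^'d \<Rightarrow> complex^'m) \<Rightarrow> bool" where
  "square_integrable_on S f \<longleftrightarrow>
     f \<in> borel_measurable borel \<and> set_integrable lborel S (\<lambda>r. (norm (f r))\<^sup>2)"

lemma square_integrable_onD:
  assumes "square_integrable_on S f"
  shows "f \<in> borel_measurable borel" "set_integrable lborel S (\<lambda>r. (norm (f r))\<^sup>2)"
  using assms by (auto simp: square_integrable_on_def)

lemma square_integrable_on_bound:
  fixes f :: "real^'d \<Rightarrow> complex^'m" and g :: "real^'d \<Rightarrow> complex^'n"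
  assumes "square_integrable_on S f" "g \<in> borel_measurable borel" "S \<in> sets borel"
    and "\<And>r. r \<in> S \<Longrightarrow> norm (g r) \<le> b * norm (f r)"
  shows "square_integrable_on S g"
proof -
  note [measurable] = square_integrable_onD(1)[OF assms(1)] assms(2,3)
  have "set_integrable lborel S (\<lambda>r. b\<^sup>2 * (norm (f r))\<^sup>2)"
    using square_integrable_onD(2)[OF assms(1)] by (rule set_integrable_mult_right)
  then have "set_integrable lborel S (\<lambda>r. (norm (g r))\<^sup>2)"
  proof (rule set_integrable_bound)
    show "set_borel_measurable lborel S (\<lambda>r. (norm (g r))\<^sup>2)"
      unfolding set_borel_measurable_def by measurable
    have "(norm (g r))\<^sup>2 \<le> b\<^sup>2 * (norm (f r))\<^sup>2" if "r \<in> S" for r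
      using power_mono[OF assms(4)[OF that], of 2] by (simp add: power_mult_distrib)
    then show "AE x in lborel. x \<in> S \<longrightarrow> norm ((norm (g x))\<^sup>2) \<le> norm (b\<^sup>2 * (norm (f x))\<^sup>2)"
      by (auto simp: abs_mult)
  qed
  then show ?thesis using assms(2) by (simp add: square_integrable_on_def)
qed

lemma square_integrable_on_add:
  fixes f :: "real^'d \<Rightarrow> complex^'m"
  assumes "square_integrable_on S f" "square_integrable_on S g" and S: "S \<in> sets borel"
  shows "square_integrable_on S (\<lambda>r. f r + g r)"
proof -
  note [measurable] = square_integrable_onD(1)[OF assms(1)] square_integrable_onD(1)[OF assms(2)] S
  have "set_integrable lborel S (\<lambda>r. 2 * (norm (f r))\<^sup>2 + 2 * (norm (g r))\<^sup>2)"
    using square_integrable_onD(2)[OF assms(1)] square_integrable_onD(2)[OF assms(2)]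
    by (intro set_integral_add set_integrable_mult_right)
  then have "set_integrable lborel S (\<lambda>r. (norm (f r + g r))\<^sup>2)"
  proof (rule set_integrable_bound)
    show "set_borel_measurable lborel S (\<lambda>r. (norm (f r + g r))\<^sup>2)"
      unfolding set_borel_measurable_def by measurable
    have "(norm (f r + g r))\<^sup>2 \<le> 2 * (norm (f r))\<^sup>2 + 2 * (norm (g r))\<^sup>2" for r
    proof -
      have "(norm (f r + g r))\<^sup>2 \<le> (norm (f r) + norm (g r))\<^sup>2"
        by (intro power_mono norm_triangle_ineq) simp
      also have "\<dots> \<le> 2 * (norm (f r))\<^sup>2 + 2 * (norm (g r))\<^sup>2"
        using sum_squares_bound[of "norm (f r)" "norm (g r)"] by (simp add: power2_sum)
      finally show ?thesis .
    qed
    then show "AE x in lborel. x \<in> S \<longrightarrow>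
        norm ((norm (f x + g x))\<^sup>2) \<le> norm (2 * (norm (f x))\<^sup>2 + 2 * (norm (g x))\<^sup>2)"
      by (auto intro: order_trans[OF _ abs_ge_self])
  qed
  then show ?thesis by (simp add: square_integrable_on_def)
qed

section \<open>The seminormed space of square-integrable functions on the cell\<close>

context full_lattice
begin

abbreviation "L2 \<equiv> square_integrable_on (unit_cell L)"
abbreviation "N \<equiv> cell_norm L"
abbreviation "H \<equiv> cell_inner L"

lemma L2_measurable: "L2 f \<Longrightarrow> f \<in> borel_measurable borel"
  by (rule square_integrable_onD)

lemma L2_add: "L2 f \<Longrightarrow> L2 g \<Longrightarrow> L2 (\<lambda>r. f r + g r)"
  by (rule square_integrable_on_add) auto

lemma L2_mult:
  assumes "L2 f" "c \<in> borel_measurable borel" "\<And>r. r \<in> unit_cell L \<Longrightarrow> norm (c r) \<le> b"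
  shows "L2 (\<lambda>r. c r *s f r)"
  using measurable_vec_smult[OF assms(2) L2_measurable[OF assms(1)]]
  by (rule square_integrable_on_bound[OF assms(1), where b = b]) (auto intro: mult_right_mono assms(3))

lemma L2_smult: "L2 f \<Longrightarrow> L2 (\<lambda>r. c *s f r)"
  by (rule L2_mult[where b = "norm c"]) auto

lemma L2_diff: "L2 f \<Longrightarrow> L2 g \<Longrightarrow> L2 (\<lambda>r. f r - g r)"
  using L2_add[of f "\<lambda>r. (-1) *s g r"] L2_smult[of g "-1"] by simp

lemma L2_zero: "L2 (\<lambda>_. 0)"
  by (simp add: square_integrable_on_def set_integrable_def)

lemma L2_sum: "(\<And>i. i \<in> S \<Longrightarrow> L2 (f i)) \<Longrightarrow> L2 (\<lambda>r. \<Sum>i\<in>S. f i r)"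
  by (induction S rule: infinite_finite_induct) (auto intro: L2_zero L2_add)

lemma set_integrable_herm_inner:
  assumes "L2 f" "L2 g"
  shows "set_integrable lborel (unit_cell L) (\<lambda>r. herm_inner (f r) (g r))"
proof -
  note [measurable] = L2_measurable[OF assms(1)] L2_measurable[OF assms(2)]
  have "set_integrable lborel (unit_cell L) (\<lambda>r. (norm (f r))\<^sup>2 + (norm (g r))\<^sup>2)"
    using assms by (intro set_integral_add) (auto simp: square_integrable_on_def)
  then show ?thesis
  proof (rule set_integrable_bound)
    show "set_borel_measurable lborel (unit_cell L) (\<lambda>r. herm_inner (f r) (g r))"
      unfolding set_borel_measurable_def by measurable
    have "norm (herm_inner (f r) (g r)) \<le> (norm (f r))\<^sup>2 + (norm (g r))\<^sup>2" for r
    proof -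
      have "2 * (norm (f r) * norm (g r)) \<le> (norm (f r))\<^sup>2 + (norm (g r))\<^sup>2"
        using sum_squares_bound[of "norm (f r)" "norm (g r)"] by simp
      moreover have "0 \<le> norm (f r) * norm (g r)" by simp
      ultimately show ?thesis using norm_herm_inner_le[of "f r" "g r"] by linarith
    qed
    then show "AE x in lborel. x \<in> unit_cell L \<longrightarrow>
        norm (herm_inner (f x) (g x)) \<le> norm ((norm (f x))\<^sup>2 + (norm (g x))\<^sup>2)" by auto
  qed
qed

lemma cell_inner_add_right: "L2 f \<Longrightarrow> L2 g \<Longrightarrow> L2 h \<Longrightarrow> H f (\<lambda>r. g r + h r) = H f g + H f h"
  unfolding cell_inner_def herm_inner_add_right by (intro set_integral_add set_integrable_herm_inner)

text \<open>Integrability need not be assumed: for a nonzero scalar both integrals are defined or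
  both take the default value \<open>0\<close>.\<close>

lemma cell_inner_smult_right: "H f (\<lambda>r. c *s g r) = c * H f g"
  unfolding cell_inner_def herm_inner_smult_right by simp

lemma cell_inner_cnj: "H g f = cnj (H f g)"
proof -
  have "indicator (unit_cell L) r *\<^sub>R herm_inner (g r) (f r) =
      cnj (indicator (unit_cell L) r *\<^sub>R herm_inner (f r) (g r))" for r
    by (subst herm_inner_cnj) simp
  moreover have "(LINT r|lborel. cnj (h r)) = cnj (LINT r|lborel. h r)" for h :: "real^'d \<Rightarrow> complex"
    by (rule integral_bounded_linear'[OF bounded_linear_cnj bounded_linear_cnj]) simp
  ultimately show ?thesis
    unfolding cell_inner_def set_lebesgue_integral_def by (simp only:)
qed

lemma cell_inner_add_left: "L2 f \<Longrightarrow> L2 g \<Longrightarrow> L2 h \<Longrightarrow> H (\<lambda>r. g r + h r) f = H g f + H h f"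
  by (subst (1 2 3) cell_inner_cnj) (simp add: cell_inner_add_right)

lemma cell_inner_smult_left: "H (\<lambda>r. c *s g r) f = cnj c * H g f"
  by (subst (1 2) cell_inner_cnj) (simp add: cell_inner_smult_right)

lemma cell_inner_minus_right: "H f (\<lambda>r. - g r) = - H f g"
  using cell_inner_smult_right[of f "-1" g] by simp

lemma cell_inner_diff_right: "L2 f \<Longrightarrow> L2 g \<Longrightarrow> L2 h \<Longrightarrow> H f (\<lambda>r. g r - h r) = H f g - H f h"
  using cell_inner_add_right[of f g "\<lambda>r. (-1) *s h r"] L2_smult[of h "-1"]
  by (simp add: cell_inner_minus_right)

lemma cell_inner_diff_left: "L2 f \<Longrightarrow> L2 g \<Longrightarrow> L2 h \<Longrightarrow> H (\<lambda>r. g r - h r) f = H g f - H h f"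
  by (subst (1 2 3) cell_inner_cnj) (simp add: cell_inner_diff_right)

lemma cell_inner_zero_right: "H f (\<lambda>_. 0) = 0"
  by (simp add: cell_inner_def herm_inner_def)

lemma cell_inner_sum_right:
  "L2 f \<Longrightarrow> (\<And>i. i \<in> S \<Longrightarrow> L2 (g i)) \<Longrightarrow> H f (\<lambda>r. \<Sum>i\<in>S. g i r) = (\<Sum>i\<in>S. H f (g i))"
  by (induction S rule: infinite_finite_induct)
    (auto simp: cell_inner_zero_right cell_inner_add_right L2_sum)

lemma cell_inner_cong_AE:
  assumes "f \<in> borel_measurable borel" "f' \<in> borel_measurable borel"
    "g \<in> borel_measurable borel" "g' \<in> borel_measurable borel"
    "AE r in lborel. f r = f' r" "AE r in lborel. g r = g' r"
  shows "H f g = H f' g'"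
proof -
  note [measurable] = assms(1-4)
  show ?thesis
    unfolding cell_inner_def
  proof (rule set_lebesgue_integral_cong_AE)
    show "AE r\<in>unit_cell L in lborel. herm_inner (f r) (g r) = herm_inner (f' r) (g' r)"
      using assms(5,6) by eventually_elim auto
  qed measurable
qed

lemma cell_norm_cong_AE:
  assumes "f \<in> borel_measurable borel" "g \<in> borel_measurable borel" "AE r in lborel. f r = g r"
  shows "N f = N g"
proof -
  note [measurable] = assms(1,2)
  have "(LINT r:unit_cell L|lborel. (norm (f r))\<^sup>2) = (LINT r:unit_cell L|lborel. (norm (g r))\<^sup>2)"
    by (rule set_lebesgue_integral_cong_AE) (measurable, use assms(3) in auto)
  then show ?thesis by (simp add: cell_norm_def)
qed

lemma N_nonneg: "0 \<le> N f"
  unfolding cell_norm_def set_lebesgue_integral_def by (simp add: integral_nonneg_AE)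

lemma N_square: "(N f)\<^sup>2 = (LINT r:unit_cell L|lborel. (norm (f r))\<^sup>2)"
  unfolding cell_norm_def set_lebesgue_integral_def by (simp add: integral_nonneg_AE)

lemma cell_inner_self: "H f f = of_real ((N f)\<^sup>2)"
  unfolding N_square cell_inner_def herm_inner_self by (rule set_integral_complex_of_real)

lemma N_smult: "N (\<lambda>r. c *s f r) = norm c * N f"
proof -
  have "(N (\<lambda>r. c *s f r))\<^sup>2 = (norm c * N f)\<^sup>2"
    unfolding N_square power_mult_distrib norm_vec_smult by simp
  then show ?thesis by (simp add: power2_eq_iff_nonneg N_nonneg)
qed

lemma N_mult_le:
  assumes f: "L2 f" and c: "c \<in> borel_measurable borel" and b: "\<And>r. r \<in> unit_cell L \<Longrightarrow> norm (c r) \<le> b" "0 \<le> b"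
  shows "N (\<lambda>r. c r *s f r) \<le> b * N f"
proof -
  have "(N (\<lambda>r. c r *s f r))\<^sup>2 \<le> (LINT r:unit_cell L|lborel. b\<^sup>2 * (norm (f r))\<^sup>2)"
    unfolding N_square
  proof (rule set_integral_mono)
    show "set_integrable lborel (unit_cell L) (\<lambda>r. (norm (c r *s f r))\<^sup>2)"
      using L2_mult[OF f c b(1)] by (rule square_integrable_onD)
    show "set_integrable lborel (unit_cell L) (\<lambda>r. b\<^sup>2 * (norm (f r))\<^sup>2)"
      using square_integrable_onD(2)[OF f] by (rule set_integrable_mult_right)
    show "(norm (c r *s f r))\<^sup>2 \<le> b\<^sup>2 * (norm (f r))\<^sup>2" if "r \<in> unit_cell L" for r
      using b(1)[OF that] by (simp add: power_mult_distrib mult_right_mono power_mono)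
  qed
  also have "\<dots> = (b * N f)\<^sup>2" by (simp add: power_mult_distrib N_square)
  finally show ?thesis by (rule power2_le_imp_le) (simp add: b N_nonneg)
qed

lemma N_unimodular: "(\<And>r. r \<in> unit_cell L \<Longrightarrow> norm (c r) = 1) \<Longrightarrow> N (\<lambda>r. c r *s f r) = N f"
  unfolding cell_norm_def norm_vec_smult
  by (intro arg_cong[where f = sqrt] set_lebesgue_integral_cong) auto

lemma N_square_add:
  assumes "L2 f" "L2 g"
  shows "(N (\<lambda>r. f r + g r))\<^sup>2 = (N f)\<^sup>2 + 2 * Re (H f g) + (N g)\<^sup>2"
proof -
  have "complex_of_real ((N (\<lambda>r. f r + g r))\<^sup>2) = H f f + H f g + (cnj (H f g) + H g g)"
    unfolding cell_inner_self[symmetric]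
    using assms by (simp add: cell_inner_add_right cell_inner_add_left L2_add cell_inner_cnj[of g f])
  then have "Re (complex_of_real ((N (\<lambda>r. f r + g r))\<^sup>2)) = Re (H f f + H f g + (cnj (H f g) + H g g))"
    by simp
  then show ?thesis by (simp add: cell_inner_self)
qed

text \<open>Expand the square of \<open>N (f + t g)\<close> for \<open>t = - s * cnj (H f g)\<close>
  with real \<open>s\<close>, which makes the mixed term a negative multiple of \<open>s\<close>.
  The case \<open>N g = 0\<close> needs its own choice of \<open>s\<close>, because a function of
  vanishing seminorm need not be the zero function.\<close>

lemma Cauchy_Schwarz:
  assumes "L2 f" "L2 g"
  shows "norm (H f g) \<le> N f * N g"
proof -
  let ?c = "H f g"
  have key: "0 \<le> (N f)\<^sup>2 - 2 * s * (norm ?c)\<^sup>2 + s\<^sup>2 * (norm ?c)\<^sup>2 * (N g)\<^sup>2" for s :: real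
  proof -
    have expand: "0 \<le> (N f)\<^sup>2 + 2 * Re (t * ?c) + (norm t * N g)\<^sup>2" for t
      using N_square_add[OF assms(1) L2_smult[OF assms(2), of t]]
        zero_le_power2[of "N (\<lambda>r. f r + t *s g r)"]
      by (simp add: cell_inner_smult_right N_smult)
    have "(- of_real s * cnj ?c) * ?c = of_real (- s * (norm ?c)\<^sup>2)"
      unfolding of_real_mult complex_norm_square by simp
    then have "Re ((- of_real s * cnj ?c) * ?c) = - s * (norm ?c)\<^sup>2"
      by (simp only: Re_complex_of_real)
    moreover have "(norm (- of_real s * cnj ?c) * N g)\<^sup>2 = s\<^sup>2 * (norm ?c)\<^sup>2 * (N g)\<^sup>2"
      by (simp add: norm_mult power_mult_distrib)
    ultimately show ?thesis
      using expand[of "- of_real s * cnj ?c"] by linarith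
  qed
  have "(norm ?c)\<^sup>2 \<le> (N f * N g)\<^sup>2"
  proof (cases "N g = 0")
    case True
    have "norm ?c = 0"
    proof (rule ccontr)
      assume "norm ?c \<noteq> 0"
      \<comment> \<open>For \<open>N g = 0\<close> this \<open>s\<close> turns the right-hand side
        of \<open>key\<close> into \<open>-1\<close>.\<close>
      then have "2 * (((N f)\<^sup>2 + 1) / (2 * (norm ?c)\<^sup>2)) * (norm ?c)\<^sup>2 = (N f)\<^sup>2 + 1" by simp
      with key[of "((N f)\<^sup>2 + 1) / (2 * (norm ?c)\<^sup>2)"] True show False by simp
    qed
    then show ?thesis by simp
  next
    case False
    \<comment> \<open>The value \<open>1 / (N g)\<^sup>2\<close> minimizes the quadratic polynomial
      in \<open>s\<close>.\<close>
    then have "2 * (1 / (N g)\<^sup>2) * (norm ?c)\<^sup>2 - (1 / (N g)\<^sup>2)\<^sup>2 * (norm ?c)\<^sup>2 * (N g)\<^sup>2 = (norm ?c)\<^sup>2 / (N g)\<^sup>2"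
      by (simp add: power2_eq_square)
    with key[of "1 / (N g)\<^sup>2"] have "(norm ?c)\<^sup>2 / (N g)\<^sup>2 \<le> (N f)\<^sup>2" by linarith
    then show ?thesis using False by (simp add: divide_le_eq power_mult_distrib)
  qed
  then show ?thesis by (rule power2_le_imp_le) (simp add: N_nonneg)
qed

lemma N_triangle:
  assumes "L2 f" "L2 g"
  shows "N (\<lambda>r. f r + g r) \<le> N f + N g"
proof (rule power2_le_imp_le)
  have "Re (H f g) \<le> N f * N g"
    using Cauchy_Schwarz[OF assms] complex_Re_le_cmod[of "H f g"] by linarith
  then show "(N (\<lambda>r. f r + g r))\<^sup>2 \<le> (N f + N g)\<^sup>2"
    unfolding N_square_add[OF assms] by (simp add: power2_sum)
qed (simp add: N_nonneg)

lemma N_minus: "N (\<lambda>r. - f r) = N f"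
  using N_smult[of "-1" f] by simp

lemma N_diff_triangle:
  assumes "L2 f" "L2 g" "L2 h"
  shows "N (\<lambda>r. f r - h r) \<le> N (\<lambda>r. f r - g r) + N (\<lambda>r. g r - h r)"
  using N_triangle[OF L2_diff[OF assms(1,2)] L2_diff[OF assms(2,3)]] by simp

lemma N_zero: "N (\<lambda>_. 0) = 0"
  by (simp add: cell_norm_def)

text \<open>Test against the remainder itself: the tail of the norms bounds its norm.\<close>

lemma weak_sum_tendsto:
  fixes c :: "'i \<Rightarrow> real^'d \<Rightarrow> complex^'m"
  assumes c: "\<And>i. L2 (c i)" and v: "L2 v" and sum: "(\<lambda>i. N (c i)) summable_on UNIV"
    and weak: "\<And>f. L2 f \<Longrightarrow> ((\<lambda>i. H f (c i)) has_sum H f v) UNIV"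
  shows "((\<lambda>S. N (\<lambda>r. v r - (\<Sum>i\<in>S. c i r))) \<longlongrightarrow> 0) (finite_subsets_at_top UNIV)"
proof -
  let ?B = "infsum (\<lambda>i. N (c i)) UNIV"
  have le: "N (\<lambda>r. v r - (\<Sum>i\<in>S. c i r)) \<le> ?B - (\<Sum>i\<in>S. N (c i))" if S: "finite S" for S
  proof -
    let ?w = "\<lambda>r. v r - (\<Sum>i\<in>S. c i r)"
    have w: "L2 ?w" by (intro L2_diff v L2_sum c)
    have s1: "((\<lambda>i. N (c i)) has_sum ?B - (\<Sum>i\<in>S. N (c i))) (UNIV - S)"
      by (intro has_sum_Diff has_sum_infsum sum has_sum_finiteI S) auto
    have s2: "((\<lambda>i. H ?w (c i)) has_sum H ?w v - (\<Sum>i\<in>S. H ?w (c i))) (UNIV - S)"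
      by (intro has_sum_Diff weak[OF w] has_sum_finiteI S) auto
    have b: "norm (H ?w (c i)) \<le> N ?w * N (c i)" for i by (rule Cauchy_Schwarz[OF w c])
    have s3: "((\<lambda>i. N ?w * N (c i)) has_sum N ?w * (?B - (\<Sum>i\<in>S. N (c i)))) (UNIV - S)"
      by (rule has_sum_cmult_right[OF s1])
    have s4: "(\<lambda>i. norm (H ?w (c i))) summable_on (UNIV - S)"
      by (rule summable_on_comparison_test[OF has_sum_imp_summable[OF s3]]) (use b in auto)
    have "(N ?w)\<^sup>2 = norm (H ?w ?w)" by (simp only: cell_inner_self norm_of_real abs_power2)
    also have "H ?w ?w = H ?w v - (\<Sum>i\<in>S. H ?w (c i))"
      by (subst cell_inner_diff_right) (auto intro: w v L2_sum c simp: cell_inner_sum_right w c)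
    also have "norm \<dots> \<le> infsum (\<lambda>i. norm (H ?w (c i))) (UNIV - S)"
      by (rule norm_has_sum_bound[OF has_sum_infsum[OF s4] s2])
    also have "\<dots> \<le> N ?w * (?B - (\<Sum>i\<in>S. N (c i)))"
      by (rule has_sum_mono[OF has_sum_infsum[OF s4] s3]) (use b in auto)
    finally have "N ?w * N ?w \<le> N ?w * (?B - (\<Sum>i\<in>S. N (c i)))" by (simp add: power2_eq_square)
    moreover have "0 \<le> ?B - (\<Sum>i\<in>S. N (c i))" by (rule has_sum_nonneg[OF s1]) (rule N_nonneg)
    ultimately show ?thesis
      using N_nonneg[of ?w] by (cases "N ?w = 0") (auto simp: mult_le_cancel_left)
  qed
  have "((\<lambda>S. ?B - (\<Sum>i\<in>S. N (c i))) \<longlongrightarrow> ?B - ?B) (finite_subsets_at_top UNIV)"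
    using has_sum_infsum[OF sum] unfolding has_sum_def by (intro tendsto_diff tendsto_const)
  then have lim: "((\<lambda>S. ?B - (\<Sum>i\<in>S. N (c i))) \<longlongrightarrow> 0) (finite_subsets_at_top UNIV)" by simp
  show ?thesis
  proof (rule tendsto_sandwich[OF _ _ tendsto_const lim])
    show "\<forall>\<^sub>F S in finite_subsets_at_top UNIV. 0 \<le> N (\<lambda>r. v r - (\<Sum>i\<in>S. c i r))"
      by (simp add: N_nonneg)
    show "\<forall>\<^sub>F S in finite_subsets_at_top UNIV. N (\<lambda>r. v r - (\<Sum>i\<in>S. c i r)) \<le> ?B - (\<Sum>i\<in>S. N (c i))"
      by (rule eventually_finite_subsets_at_top_weakI) (rule le)
  qed
qed

text \<open>By Cauchy-Schwarz the remainder tested against \<open>f\<close> is at most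
  \<open>N f\<close> times its seminorm. Together with \<open>weak_sum_tendsto\<close> this allows
  free passage between weak and strong sums when the norms of the terms are summable.\<close>

lemma tendsto_weak_sum:
  fixes c :: "'i \<Rightarrow> real^'d \<Rightarrow> complex^'m"
  assumes c: "\<And>i. L2 (c i)" and v: "L2 v" and f: "L2 f"
    and lim: "((\<lambda>S. N (\<lambda>r. v r - (\<Sum>i\<in>S. c i r))) \<longlongrightarrow> 0) (finite_subsets_at_top UNIV)"
  shows "((\<lambda>i. H f (c i)) has_sum H f v) UNIV"
proof -
  have "((\<lambda>S. H f v - (\<Sum>i\<in>S. H f (c i))) \<longlongrightarrow> 0) (finite_subsets_at_top UNIV)"
  proof (rule tendsto_norm_zero_cancel, rule tendsto_sandwich[OF _ _ tendsto_const])
    show "((\<lambda>S. N f * N (\<lambda>r. v r - (\<Sum>i\<in>S. c i r))) \<longlongrightarrow> 0) (finite_subsets_at_top UNIV)"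
      using tendsto_mult_right_zero[OF lim] .
    have "norm (H f v - (\<Sum>i\<in>S. H f (c i))) \<le> N f * N (\<lambda>r. v r - (\<Sum>i\<in>S. c i r))" for S
    proof -
      have "H f v - (\<Sum>i\<in>S. H f (c i)) = H f (\<lambda>r. v r - (\<Sum>i\<in>S. c i r))"
        by (subst cell_inner_diff_right) (auto intro: f v L2_sum c simp: cell_inner_sum_right f c)
      then show ?thesis using Cauchy_Schwarz[OF f L2_diff[OF v L2_sum], of S c] c by simp
    qed
    then show "\<forall>\<^sub>F S in finite_subsets_at_top UNIV.
        norm (H f v - (\<Sum>i\<in>S. H f (c i))) \<le> N f * N (\<lambda>r. v r - (\<Sum>i\<in>S. c i r))" by simp
  qed simp
  from tendsto_diff[OF tendsto_const[of "H f v"] this] show ?thesis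
    unfolding has_sum_def by simp
qed

section \<open>Lattice-periodic, locally square-integrable functions\<close>

lemma torus_L2_iff:
  "f \<in> torus_L2 L \<longleftrightarrow> f \<in> borel_measurable borel \<and> (\<forall>S. compact S \<longrightarrow> square_integrable_on S f) \<and>
     (\<forall>R\<in>L. AE r in lborel. f (r + R) = f r)"
  by (auto simp: torus_L2_def bloch_function_def locally_square_integrable_def square_integrable_on_def)

lemma torus_L2_L2:
  assumes "f \<in> torus_L2 L"
  shows "L2 f"
proof -
  obtain b where b: "\<And>r. r \<in> unit_cell L \<Longrightarrow> norm r \<le> b" using cell_bounded by blast
  have "square_integrable_on (cball 0 b) f" using assms by (auto simp: torus_L2_iff)
  then have "set_integrable lborel (unit_cell L) (\<lambda>r. (norm (f r))\<^sup>2)"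
    unfolding square_integrable_on_def
    by (elim conjE set_integrable_subset) (use b in auto)
  then show ?thesis using assms by (simp add: torus_L2_iff square_integrable_on_def)
qed

lemma torus_L2_measurable: "f \<in> torus_L2 L \<Longrightarrow> f \<in> borel_measurable borel"
  by (simp add: torus_L2_iff)

lemma torus_L2_periodic: "f \<in> torus_L2 L \<Longrightarrow> R \<in> L \<Longrightarrow> AE r in lborel. f (r + R) = f r"
  by (simp add: torus_L2_iff)

lemma torus_L2_add: 
  assumes "f \<in> torus_L2 L" "g \<in> torus_L2 L"
  shows "(\<lambda>r. f r + g r) \<in> torus_L2 L"
  unfolding torus_L2_iff
proof (intro conjI allI impI ballI)
  show "(\<lambda>r. f r + g r) \<in> borel_measurable borel"
    using assms by (intro borel_measurable_add) (auto simp: torus_L2_iff)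
  show "square_integrable_on S (\<lambda>r. f r + g r)" if "compact S" for S
    using assms that by (intro square_integrable_on_add) (auto simp: torus_L2_iff borel_compact)
  fix R assume "R \<in> L"
  from torus_L2_periodic[OF assms(1) this] torus_L2_periodic[OF assms(2) this]
  show "AE r in lborel. f (r + R) + g (r + R) = f r + g r" by eventually_elim simp
qed

lemma torus_L2_mult:
  assumes f: "f \<in> torus_L2 L" and c: "c \<in> borel_measurable borel" and b: "\<And>r. norm (c r) \<le> b"
    and per: "\<And>r R. R \<in> L \<Longrightarrow> c (r + R) = c r"
  shows "(\<lambda>r. c r *s f r) \<in> torus_L2 L"
  unfolding torus_L2_iff
proof (intro conjI allI impI ballI)
  show m: "(\<lambda>r. c r *s f r) \<in> borel_measurable borel"
    using torus_L2_measurable[OF f] c by (intro measurable_vec_smult)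
  show "square_integrable_on S (\<lambda>r. c r *s f r)" if "compact S" for S
    by (rule square_integrable_on_bound[of S f _ b])
      (use f that b m in \<open>auto simp: torus_L2_iff borel_compact intro!: mult_right_mono\<close>)
  fix R assume R: "R \<in> L"
  from torus_L2_periodic[OF f this] show "AE r in lborel. c (r + R) *s f (r + R) = c r *s f r"
    by eventually_elim (simp add: per R)
qed

lemma torus_L2_smult: "f \<in> torus_L2 L \<Longrightarrow> (\<lambda>r. c *s f r) \<in> torus_L2 L"
  by (rule torus_L2_mult[where b = "norm c"]) auto

lemma torus_L2_zero: "(\<lambda>_. 0) \<in> torus_L2 L"
  by (simp add: torus_L2_iff square_integrable_on_def set_integrable_def)

lemma torus_L2_sum: "(\<And>i. i \<in> S \<Longrightarrow> f i \<in> torus_L2 L) \<Longrightarrow> (\<lambda>r. \<Sum>i\<in>S. f i r) \<in> torus_L2 L"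
  by (induction S rule: infinite_finite_induct) (auto intro: torus_L2_zero torus_L2_add)

lemma torus_L2_cong_AE:
  fixes f g :: "real^'d \<Rightarrow> complex^'m"
  assumes f: "f \<in> torus_L2 L" and g: "g \<in> borel_measurable borel" and ae: "AE r in lborel. g r = f r"
  shows "g \<in> torus_L2 L"
  unfolding torus_L2_iff
proof (intro conjI allI impI ballI)
  show "square_integrable_on S g" if "compact S" for S
  proof -
    note [measurable] = torus_L2_measurable[OF f] g
    have "set_integrable lborel S (\<lambda>r. (norm (g r))\<^sup>2) = set_integrable lborel S (\<lambda>r. (norm (f r))\<^sup>2)"
      by (rule set_integrable_cong_AE) (use ae that in \<open>auto simp: borel_compact\<close>)
    then show ?thesis using f g that by (simp add: torus_L2_iff square_integrable_on_def)
  qed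
  fix R assume "R \<in> L"
  from torus_L2_periodic[OF f this] ae AE_lborel_translate[OF ae, of R]
  show "AE r in lborel. g (r + R) = g r" by eventually_elim simp
qed (rule g)

end

section \<open>Analytic families of functions and operators\<close>

lemma scaleR_vec_smult: "a *\<^sub>R v = complex_of_real a *s v" for v :: "complex^'m"
proof -
  have "(a *\<^sub>R v) $ i = (complex_of_real a *s v) $ i" for i
    by (simp only: vector_scaleR_component vector_smult_component) (rule scaleR_conv_of_real)
  then show ?thesis by (simp only: vec_eq_iff simp_thms)
qed

lemma has_sum_mult_pairs:
  fixes f :: "'i \<Rightarrow> complex" and g :: "'j \<Rightarrow> complex"
  assumes f: "(f has_sum a) A" "(\<lambda>x. norm (f x)) summable_on A"
    and g: "(g has_sum b) B" "(\<lambda>y. norm (g y)) summable_on B"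
  shows "((\<lambda>(x, y). f x * g y) has_sum a * b) (A \<times> B)"
    and "(\<lambda>(x, y). norm (f x) * norm (g y)) summable_on (A \<times> B)"
proof -
  have s: "(\<lambda>p. norm (f (fst p)) * norm (g (snd p))) summable_on (Sigma A (\<lambda>_. B))"
  proof (rule summable_on_SigmaI)
    show "((\<lambda>y. norm (f (fst (x, y))) * norm (g (snd (x, y)))) has_sum
        norm (f x) * infsum (\<lambda>y. norm (g y)) B) B" for x
      using has_sum_cmult_right[OF has_sum_infsum[OF g(2)], of "norm (f x)"] by simp
    show "(\<lambda>x. norm (f x) * infsum (\<lambda>y. norm (g y)) B) summable_on A"
      by (rule summable_on_cmult_left[OF f(2)])
  qed auto
  then show "(\<lambda>(x, y). norm (f x) * norm (g y)) summable_on (A \<times> B)"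
    by (simp add: case_prod_unfold)
  have "(\<lambda>p. norm (f (fst p) * g (snd p))) summable_on (Sigma A (\<lambda>_. B))"
    using s by (simp add: norm_mult)
  then have s': "(\<lambda>p. f (fst p) * g (snd p)) summable_on (Sigma A (\<lambda>_. B))"
    by (rule abs_summable_summable)
  have "((\<lambda>p. f (fst p) * g (snd p)) has_sum a * b) (Sigma A (\<lambda>_. B))"
  proof (rule has_sum_SigmaI[OF _ has_sum_cmult_left[OF f(1)] s'])
    show "((\<lambda>y. f (fst (x, y)) * g (snd (x, y))) has_sum f x * b) B" for x
      using has_sum_cmult_right[OF g(1), of "f x"] by simp
  qed
  then show "((\<lambda>(x, y). f x * g y) has_sum a * b) (A \<times> B)"
    by (simp add: case_prod_unfold)
qed

text \<open>The exponential of a sum is a product of exponential series, and expanding the product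
  of absolutely convergent series yields one series over multi-indices.\<close>

lemma has_sum_exp_multiindex:
  fixes z :: "'d::finite \<Rightarrow> 'a::{real_normed_field,banach}"
  shows "((\<lambda>\<alpha>. \<Prod>i\<in>UNIV. z i ^ \<alpha> i / fact (\<alpha> i)) has_sum exp (\<Sum>i\<in>UNIV. z i)) UNIV"
proof -
  have abs: "(\<lambda>n. norm (z i ^ n / fact n)) summable_on UNIV" for i
    by (rule norm_summable_imp_summable_on)
      (use summable_norm_exp[of "z i"] in \<open>simp add: divide_inverse scaleR_conv_of_real mult.commute norm_mult norm_power norm_inverse\<close>)
  have val: "infsum (\<lambda>n. z i ^ n / fact n) UNIV = exp (z i)" for i
  proof (rule infsumI, rule norm_summable_imp_has_sum)
    show "summable (\<lambda>n. norm (z i ^ n / fact n))"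
      using summable_norm_exp[of "z i"]
      by (simp add: divide_inverse scaleR_conv_of_real mult.commute norm_mult norm_power norm_inverse)
    show "(\<lambda>n. z i ^ n / fact n) sums exp (z i)"
      using exp_converges[of "z i"] by (simp add: divide_inverse scaleR_conv_of_real mult.commute)
  qed
  have "(\<lambda>\<alpha>. norm (\<Prod>i\<in>UNIV. z i ^ \<alpha> i / fact (\<alpha> i))) summable_on UNIV"
    unfolding prod_norm[symmetric] by (rule summable_on_prod_multiindex[OF _ abs]) simp
  then have "(\<lambda>\<alpha>. \<Prod>i\<in>UNIV. z i ^ \<alpha> i / fact (\<alpha> i)) summable_on UNIV"
    by (rule abs_summable_summable)
  moreover have "infsum (\<lambda>\<alpha>. \<Prod>i\<in>UNIV. z i ^ \<alpha> i / fact (\<alpha> i)) (PiE UNIV (\<lambda>_. UNIV)) = exp (\<Sum>i\<in>UNIV. z i)"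
    by (subst infsum_prod_PiE_abs) (use abs val in \<open>auto simp: exp_sum\<close>)
  ultimately show ?thesis by (simp add: has_sum_iff)
qed

lemma has_sum_tail_bound:
  fixes a :: "'i \<Rightarrow> 'a::banach"
  assumes a: "(a has_sum s) A" and b: "(b has_sum B) A" and le: "\<And>i. i \<in> A \<Longrightarrow> norm (a i) \<le> b i"
    and S: "finite S" "S \<subseteq> A"
  shows "norm (s - sum a S) \<le> B - sum b S"
proof -
  have a': "(a has_sum s - sum a S) (A - S)" and b': "(b has_sum B - sum b S) (A - S)"
    by (rule has_sum_Diff[OF a has_sum_finiteI[OF S(1) refl] S(2)]
        has_sum_Diff[OF b has_sum_finiteI[OF S(1) refl] S(2)])+
  have s: "(\<lambda>i. norm (a i)) summable_on (A - S)"
    by (rule summable_on_comparison_test[OF has_sum_imp_summable[OF b']]) (use le in auto)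
  have "norm (s - sum a S) \<le> infsum (\<lambda>i. norm (a i)) (A - S)"
    by (rule norm_has_sum_bound[OF has_sum_infsum[OF s] a'])
  also have "\<dots> \<le> B - sum b S"
    by (rule has_sum_mono[OF has_sum_infsum[OF s] b']) (use le in auto)
  finally show ?thesis .
qed

context full_lattice
begin

text \<open>A weak encoding of vector-valued analyticity: norms of the coefficients are summable,
  but the sum is identified only through inner products. Calculations thereby take place among
  complex series, and identities that hold almost everywhere cause no trouble.\<close>

definition vector_analytic :: "real^'d \<Rightarrow> (real^'d \<Rightarrow> real^'d \<Rightarrow> complex^'m) \<Rightarrow> bool" where
  "vector_analytic k0 G \<longleftrightarrow> (\<exists>\<rho>>0. \<exists>c. (\<forall>\<alpha>. c \<alpha> \<in> torus_L2 L) \<and>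
     (\<lambda>\<alpha>. N (c \<alpha>) * \<rho> ^ mdeg \<alpha>) summable_on UNIV \<and>
     (\<forall>k. near \<rho> k0 k \<longrightarrow> G k \<in> torus_L2 L \<and>
        (\<forall>f. L2 f \<longrightarrow> ((\<lambda>\<alpha>. of_real (mpow (k - k0) \<alpha>) * H f (c \<alpha>)) has_sum H f (G k)) UNIV)))"

lemma vector_analytic_inner:
  fixes G :: "real^'d \<Rightarrow> real^'d \<Rightarrow> complex^'m"
  assumes G: "vector_analytic k0 G" and f: "L2 f"
  shows "analytic_near k0 (\<lambda>k. H f (G k))"
proof -
  obtain \<rho> c where \<rho>: "\<rho> > 0" and c: "\<And>\<alpha>. c \<alpha> \<in> torus_L2 L"
    and s: "(\<lambda>\<alpha>. N (c \<alpha>) * \<rho> ^ mdeg \<alpha>) summable_on UNIV"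
    and w: "\<And>k. near \<rho> k0 k \<Longrightarrow> ((\<lambda>\<alpha>. of_real (mpow (k - k0) \<alpha>) * H f (c \<alpha>)) has_sum H f (G k)) UNIV"
    using G f unfolding vector_analytic_def by blast
  have "(\<lambda>\<alpha>. N f * (N (c \<alpha>) * \<rho> ^ mdeg \<alpha>)) summable_on UNIV"
    by (rule summable_on_cmult_right[OF s])
  then have "(\<lambda>\<alpha>. norm (H f (c \<alpha>)) * \<rho> ^ mdeg \<alpha>) summable_on UNIV"
  proof (rule summable_on_comparison_test)
    fix \<alpha>
    show "norm (H f (c \<alpha>)) * \<rho> ^ mdeg \<alpha> \<le> N f * (N (c \<alpha>) * \<rho> ^ mdeg \<alpha>)"
      using mult_right_mono[OF Cauchy_Schwarz[OF f torus_L2_L2[OF c]], of "\<rho> ^ mdeg \<alpha>" \<alpha>] \<rho>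
      by (simp add: mult.assoc)
  qed (use \<rho> in auto)
  from power_series_le_grouped[OF \<rho> has_sum_infsum[OF this] order_refl w]
  show ?thesis using \<rho> analytic_nearI by blast
qed

lemma vector_analytic_cong:
  fixes G G' :: "real^'d \<Rightarrow> real^'d \<Rightarrow> complex^'m"
  assumes G: "vector_analytic k0 G"
    and ev: "eventually (\<lambda>k. G' k \<in> borel_measurable borel \<and> (AE r in lborel. G' k r = G k r)) (nhds k0)"
  shows "vector_analytic k0 G'"
proof -
  obtain \<rho> c where \<rho>: "\<rho> > 0" and c: "\<And>\<alpha>. c \<alpha> \<in> torus_L2 L"
    and s: "(\<lambda>\<alpha>. N (c \<alpha>) * \<rho> ^ mdeg \<alpha>) summable_on UNIV"
    and G: "\<And>k. near \<rho> k0 k \<Longrightarrow> G k \<in> torus_L2 L"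
    and w: "\<And>k (f :: real^'d \<Rightarrow> complex^'m). near \<rho> k0 k \<Longrightarrow> L2 f \<Longrightarrow>
      ((\<lambda>\<alpha>. of_real (mpow (k - k0) \<alpha>) * H f (c \<alpha>)) has_sum H f (G k)) UNIV"
    using G unfolding vector_analytic_def by blast
  obtain e where e: "e > 0"
    "\<And>k. k \<in> ball k0 e \<Longrightarrow> G' k \<in> borel_measurable borel \<and> (AE r in lborel. G' k r = G k r)"
    using ev unfolding eventually_nhds_metric by (auto simp: dist_commute)
  obtain \<rho>' where \<rho>': "\<rho>' > 0" "\<And>k. near \<rho>' k0 k \<Longrightarrow> k \<in> ball k0 e"
    using near_imp_ball[OF e(1)] by blast
  let ?\<rho> = "min \<rho> \<rho>'"
  show ?thesis
    unfolding vector_analytic_def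
  proof (intro exI[of _ ?\<rho>] exI[of _ c] conjI allI impI)
    show "?\<rho> > 0" using \<rho> \<rho>' by simp
    show "c \<alpha> \<in> torus_L2 L" for \<alpha> by (rule c)
    show "(\<lambda>\<alpha>. N (c \<alpha>) * ?\<rho> ^ mdeg \<alpha>) summable_on UNIV"
      by (rule summable_on_comparison_test[OF s])
        (use \<rho> \<rho>' in \<open>auto intro!: mult_left_mono power_mono simp: N_nonneg\<close>)
    fix k assume k: "near ?\<rho> k0 k"
    then have n: "near \<rho> k0 k" and b: "k \<in> ball k0 e"
      using near_mono \<rho>'(2) by (metis min.cobounded1 min.cobounded2)+
    note e2 = e(2)[OF b]
    show "G' k \<in> torus_L2 L" using torus_L2_cong_AE[OF G[OF n]] e2 by blast
    fix f :: "real^'d \<Rightarrow> complex^'m" assume f: "L2 f"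
    have "H f (G' k) = H f (G k)"
      using e2 by (intro cell_inner_cong_AE) (auto intro: L2_measurable[OF f] torus_L2_measurable G[OF n])
    then show "((\<lambda>\<alpha>. of_real (mpow (k - k0) \<alpha>) * H f (c \<alpha>)) has_sum H f (G' k)) UNIV"
      using w[OF n f] by simp
  qed
qed

text \<open>The Cauchy product of a scalar and a vector series. Its coefficients must again be
  elements of \<open>torus_L2\<close>, so the pairs of multi-indices have to be grouped into finite
  sums before testing with \<open>f\<close>.\<close>

lemma vector_analytic_smult:
  fixes G :: "real^'d \<Rightarrow> real^'d \<Rightarrow> complex^'m"
  assumes l: "analytic_near k0 l" and G: "vector_analytic k0 G"
  shows "vector_analytic k0 (\<lambda>k r. l k *s G k r)"
proof -
  obtain \<rho>1 b a1 b1 where \<rho>1: "\<rho>1 > 0" and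
    a1: "((\<lambda>\<alpha>. norm (a1 \<alpha>) * \<rho>1 ^ mdeg \<alpha>) has_sum b1) UNIV"
    "\<And>k. near \<rho>1 k0 k \<Longrightarrow> ((\<lambda>\<alpha>. of_real (mpow (k - k0) \<alpha>) * a1 \<alpha>) has_sum l k) UNIV"
    using l unfolding analytic_near_def power_series_le_def by blast
  obtain \<rho>2 c where \<rho>2: "\<rho>2 > 0" and c: "\<And>\<alpha>. c \<alpha> \<in> torus_L2 L"
    and s: "(\<lambda>\<alpha>. N (c \<alpha>) * \<rho>2 ^ mdeg \<alpha>) summable_on UNIV"
    and G: "\<And>k. near \<rho>2 k0 k \<Longrightarrow> G k \<in> torus_L2 L"
    and w: "\<And>k (f :: real^'d \<Rightarrow> complex^'m). near \<rho>2 k0 k \<Longrightarrow> L2 f \<Longrightarrow>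
      ((\<lambda>\<alpha>. of_real (mpow (k - k0) \<alpha>) * H f (c \<alpha>)) has_sum H f (G k)) UNIV"
    using G unfolding vector_analytic_def by blast
  define \<rho> where "\<rho> = min \<rho>1 \<rho>2"
  have \<rho>: "\<rho> > 0" "\<rho> \<le> \<rho>1" "\<rho> \<le> \<rho>2" using \<rho>1 \<rho>2 by (auto simp: \<rho>_def)
  have sa: "(\<lambda>\<alpha>. norm (of_real (norm (a1 \<alpha>) * \<rho> ^ mdeg \<alpha>) :: complex)) summable_on UNIV"
    by (rule summable_on_comparison_test[OF has_sum_imp_summable[OF a1(1)]])
      (use \<rho> in \<open>auto intro!: mult_left_mono power_mono simp: norm_mult norm_power\<close>)
  have sc: "(\<lambda>\<alpha>. norm (of_real (N (c \<alpha>) * \<rho> ^ mdeg \<alpha>) :: complex)) summable_on UNIV"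
    by (rule summable_on_comparison_test[OF s])
      (use \<rho> in \<open>auto intro!: mult_left_mono power_mono simp: norm_mult norm_power N_nonneg\<close>)
  \<comment> \<open>\<open>F \<gamma>\<close> is the box of multi-indices below
    \<open>\<gamma>\<close>. Inside it the truncated subtraction of \<open>sub\<close> is exact, so
    \<open>(\<alpha>, sub \<gamma> \<alpha>)\<close> runs once through the pairs with sum
    \<open>\<gamma>\<close>.\<close>
  define F :: "('d \<Rightarrow> nat) \<Rightarrow> ('d \<Rightarrow> nat) set" where "F \<gamma> = PiE UNIV (\<lambda>i. {..\<gamma> i})" for \<gamma>
  have finF: "finite (F \<gamma>)" for \<gamma> unfolding F_def by (rule finite_PiE) auto
  define sub :: "('d \<Rightarrow> nat) \<Rightarrow> ('d \<Rightarrow> nat) \<Rightarrow> 'd \<Rightarrow> nat" where "sub \<gamma> \<alpha> = (\<lambda>i. \<gamma> i - \<alpha> i)" for \<gamma> \<alpha>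
  have Fadd: "\<alpha> + sub \<gamma> \<alpha> = \<gamma>" if "\<alpha> \<in> F \<gamma>" for \<alpha> \<gamma>
    using that by (auto simp: F_def sub_def fun_eq_iff PiE_iff)
  have bij: "bij_betw (\<lambda>(\<gamma>, \<alpha>). (\<alpha>, sub \<gamma> \<alpha>)) (Sigma UNIV F) (UNIV \<times> UNIV)"
    by (rule bij_betwI[where g = "\<lambda>(\<alpha>, \<beta>). (\<alpha> + \<beta>, \<alpha>)"])
      (auto simp: F_def sub_def fun_eq_iff PiE_iff)
  define d where "d \<gamma> = (\<lambda>r. \<Sum>\<alpha>\<in>F \<gamma>. a1 \<alpha> *s c (sub \<gamma> \<alpha>) r)" for \<gamma>
  have dT: "d \<gamma> \<in> torus_L2 L" for \<gamma>
    unfolding d_def by (intro torus_L2_sum torus_L2_smult c)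
  have "(\<lambda>(x, y). norm (of_real (norm (a1 x) * \<rho> ^ mdeg x) :: complex) *
      norm (of_real (N (c y) * \<rho> ^ mdeg y) :: complex)) summable_on (UNIV \<times> UNIV)"
    by (rule has_sum_mult_pairs(2)[OF has_sum_infsum[OF abs_summable_summable[OF sa]] sa
          has_sum_infsum[OF abs_summable_summable[OF sc]] sc])
  then have "(\<lambda>(x, y). (norm (a1 x) * \<rho> ^ mdeg x) * (N (c y) * \<rho> ^ mdeg y)) summable_on (UNIV \<times> UNIV)"
    using \<rho> by (simp add: norm_mult norm_power N_nonneg)
  then have "(\<lambda>(\<gamma>, \<alpha>). (norm (a1 \<alpha>) * \<rho> ^ mdeg \<alpha>) * (N (c (sub \<gamma> \<alpha>)) * \<rho> ^ mdeg (sub \<gamma> \<alpha>)))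
      summable_on (Sigma UNIV F)"
    by (subst (asm) summable_on_reindex_bij_betw[OF bij, symmetric]) (simp add: case_prod_unfold)
  then have pairs: "(\<lambda>(\<gamma>, \<alpha>). norm (a1 \<alpha>) * N (c (sub \<gamma> \<alpha>)) * \<rho> ^ mdeg \<gamma>) summable_on (Sigma UNIV F)"
  proof (rule summable_on_cong[THEN iffD1, rotated])
    fix p assume "p \<in> Sigma UNIV F"
    then obtain \<gamma> \<alpha> where p: "p = (\<gamma>, \<alpha>)" "\<alpha> \<in> F \<gamma>" by auto
    have "\<rho> ^ mdeg \<gamma> = \<rho> ^ mdeg \<alpha> * \<rho> ^ mdeg (sub \<gamma> \<alpha>)"
      by (subst Fadd[OF p(2), symmetric]) (simp add: mdeg_add power_add)
    then show "(case p of (\<gamma>, \<alpha>) \<Rightarrow> (norm (a1 \<alpha>) * \<rho> ^ mdeg \<alpha>) * (N (c (sub \<gamma> \<alpha>)) * \<rho> ^ mdeg (sub \<gamma> \<alpha>))) =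
        (case p of (\<gamma>, \<alpha>) \<Rightarrow> norm (a1 \<alpha>) * N (c (sub \<gamma> \<alpha>)) * \<rho> ^ mdeg \<gamma>)"
      by (simp add: p)
  qed
  have "(\<lambda>\<gamma>. infsum (\<lambda>\<alpha>. case (\<gamma>, \<alpha>) of (\<gamma>, \<alpha>) \<Rightarrow> norm (a1 \<alpha>) * N (c (sub \<gamma> \<alpha>)) * \<rho> ^ mdeg \<gamma>) (F \<gamma>)) summable_on UNIV"
    by (rule summable_on_SigmaD[OF pairs]) (simp add: finF)
  then have rows: "(\<lambda>\<gamma>. \<Sum>\<alpha>\<in>F \<gamma>. norm (a1 \<alpha>) * N (c (sub \<gamma> \<alpha>)) * \<rho> ^ mdeg \<gamma>) summable_on UNIV"
    by (simp add: finF)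
  have Nsum: "N (\<lambda>r. \<Sum>i\<in>S. h i r) \<le> (\<Sum>i\<in>S. N (h i))" if "finite S" "\<And>i. i \<in> S \<Longrightarrow> L2 (h i)"
    for S :: "('d \<Rightarrow> nat) set" and h :: "_ \<Rightarrow> real^'d \<Rightarrow> complex^'m"
    using that
  proof (induction S rule: finite_induct)
    case empty
    then show ?case by (simp add: N_zero)
  next
    case (insert i S)
    then have "N (\<lambda>r. h i r + (\<Sum>i\<in>S. h i r)) \<le> N (h i) + N (\<lambda>r. \<Sum>i\<in>S. h i r)"
      by (intro N_triangle L2_sum) auto
    with insert show ?case by simp
  qed
  show ?thesis
    unfolding vector_analytic_def
  proof (intro exI[of _ \<rho>] exI[of _ d] conjI allI impI)
    show "(\<lambda>\<gamma>. N (d \<gamma>) * \<rho> ^ mdeg \<gamma>) summable_on UNIV"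
    proof (rule summable_on_comparison_test[OF rows])
      fix \<gamma>
      have "N (d \<gamma>) \<le> (\<Sum>\<alpha>\<in>F \<gamma>. N (\<lambda>r. a1 \<alpha> *s c (sub \<gamma> \<alpha>) r))"
        unfolding d_def by (intro Nsum finF L2_smult torus_L2_L2 c)
      then show "N (d \<gamma>) * \<rho> ^ mdeg \<gamma> \<le> (\<Sum>\<alpha>\<in>F \<gamma>. norm (a1 \<alpha>) * N (c (sub \<gamma> \<alpha>)) * \<rho> ^ mdeg \<gamma>)"
        using \<rho> by (simp add: N_smult sum_distrib_right[symmetric] mult_right_mono)
    qed (use \<rho> in \<open>simp add: N_nonneg\<close>)
    fix k assume k: "near \<rho> k0 k"
    have k1: "near \<rho>1 k0 k" and k2: "near \<rho>2 k0 k" using k near_mono \<rho> by blast+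
    show "(\<lambda>r. l k *s G k r) \<in> torus_L2 L" by (intro torus_L2_smult G k2)
    fix f :: "real^'d \<Rightarrow> complex^'m" assume f: "L2 f"
    have n1: "(\<lambda>\<alpha>. norm (of_real (mpow (k - k0) \<alpha>) * a1 \<alpha>)) summable_on UNIV"
      by (rule summable_on_comparison_test[OF sa])
        (use norm_mpow_term_le[OF k] \<rho> in \<open>auto simp: norm_mult norm_power\<close>)
    have n2: "(\<lambda>\<alpha>. norm (of_real (mpow (k - k0) \<alpha>) * H f (c \<alpha>))) summable_on UNIV"
    proof (rule summable_on_comparison_test[OF summable_on_cmult_right[OF sc]])
      fix \<alpha>
      have "norm (of_real (mpow (k - k0) \<alpha>) * H f (c \<alpha>)) \<le> norm (H f (c \<alpha>)) * \<rho> ^ mdeg \<alpha>"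
        by (rule norm_mpow_term_le[OF k])
      also have "\<dots> \<le> (N f * N (c \<alpha>)) * \<rho> ^ mdeg \<alpha>"
        using \<rho> by (intro mult_right_mono Cauchy_Schwarz f torus_L2_L2 c) auto
      finally show "norm (of_real (mpow (k - k0) \<alpha>) * H f (c \<alpha>)) \<le>
          N f * norm (of_real (N (c \<alpha>) * \<rho> ^ mdeg \<alpha>) :: complex)"
        using \<rho> by (simp add: norm_mult norm_power N_nonneg mult.assoc)
    qed auto
    have "((\<lambda>(x, y). (of_real (mpow (k - k0) x) * a1 x) * (of_real (mpow (k - k0) y) * H f (c y)))
        has_sum l k * H f (G k)) (UNIV \<times> UNIV)"
      by (rule has_sum_mult_pairs(1)[OF a1(2)[OF k1] n1 w[OF k2 f] n2])
    then have "((\<lambda>p. case (case p of (\<gamma>, \<alpha>) \<Rightarrow> (\<alpha>, sub \<gamma> \<alpha>)) of (x, y) \<Rightarrow>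
          (of_real (mpow (k - k0) x) * a1 x) * (of_real (mpow (k - k0) y) * H f (c y)))
        has_sum l k * H f (G k)) (Sigma UNIV F)"
      by (subst has_sum_reindex_bij_betw[OF bij])
    then have "((\<lambda>\<gamma>. of_real (mpow (k - k0) \<gamma>) * H f (d \<gamma>)) has_sum l k * H f (G k)) UNIV"
    proof (rule has_sum_SigmaD, goal_cases)
      case (1 \<gamma>)
      show ?case
      proof (rule has_sum_finiteI[OF finF])
        have "of_real (mpow (k - k0) \<gamma>) * H f (d \<gamma>) =
            (\<Sum>\<alpha>\<in>F \<gamma>. of_real (mpow (k - k0) \<gamma>) * (a1 \<alpha> * H f (c (sub \<gamma> \<alpha>))))"
          unfolding d_def
          by (subst cell_inner_sum_right) (auto intro: f L2_smult torus_L2_L2 c simp: cell_inner_smult_right sum_distrib_left)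
        also have "\<dots> = (\<Sum>\<alpha>\<in>F \<gamma>. (of_real (mpow (k - k0) \<alpha>) * a1 \<alpha>) *
            (of_real (mpow (k - k0) (sub \<gamma> \<alpha>)) * H f (c (sub \<gamma> \<alpha>))))"
        proof (rule sum.cong[OF refl])
          fix \<alpha> assume "\<alpha> \<in> F \<gamma>"
          have "mpow (k - k0) \<gamma> = mpow (k - k0) \<alpha> * mpow (k - k0) (sub \<gamma> \<alpha>)"
            by (subst Fadd[OF \<open>\<alpha> \<in> F \<gamma>\<close>, symmetric]) (rule mpow_add)
          then show "of_real (mpow (k - k0) \<gamma>) * (a1 \<alpha> * H f (c (sub \<gamma> \<alpha>))) =
            (of_real (mpow (k - k0) \<alpha>) * a1 \<alpha>) * (of_real (mpow (k - k0) (sub \<gamma> \<alpha>)) * H f (c (sub \<gamma> \<alpha>)))"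
            by simp
        qed
        finally show "of_real (mpow (k - k0) \<gamma>) * H f (d \<gamma>) =
            (\<Sum>y\<in>F \<gamma>. case case (\<gamma>, y) of (\<gamma>, \<alpha>) \<Rightarrow> (\<alpha>, sub \<gamma> \<alpha>) of (x, y) \<Rightarrow>
              (of_real (mpow (k - k0) x) * a1 x) * (of_real (mpow (k - k0) y) * H f (c y)))"
          by simp
      qed
    qed
    then show "((\<lambda>\<gamma>. of_real (mpow (k - k0) \<gamma>) * H f (d \<gamma>)) has_sum H f (\<lambda>r. l k *s G k r)) UNIV"
      by (simp add: cell_inner_smult_right)
  qed (use \<rho> dT in auto)
qed

text \<open>Recovers convergence in the seminorm from the weak encoding. This is what the original
  notion of analyticity asks for, and what moving a bounded operator through the series
  requires.\<close>

lemma vector_analytic_norm_convergent: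
  fixes v :: "real^'d \<Rightarrow> complex^'m"
  assumes c: "\<And>\<alpha>. c \<alpha> \<in> torus_L2 L" and \<rho>: "\<rho> > 0"
    and s: "(\<lambda>\<alpha>. N (c \<alpha>) * \<rho> ^ mdeg \<alpha>) summable_on UNIV" and k: "near \<rho> k0 k" and v: "L2 v"
    and w: "\<And>f. L2 f \<Longrightarrow> ((\<lambda>\<alpha>. of_real (mpow (k - k0) \<alpha>) * H f (c \<alpha>)) has_sum H f v) UNIV"
  shows "((\<lambda>S. N (\<lambda>r. v r - (\<Sum>\<alpha>\<in>S. of_real (mpow (k - k0) \<alpha>) *s c \<alpha> r))) \<longlongrightarrow> 0)
    (finite_subsets_at_top UNIV)"
proof (rule weak_sum_tendsto[OF _ v])
  show "L2 (\<lambda>r. of_real (mpow (k - k0) \<alpha>) *s c \<alpha> r)" for \<alpha>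
    by (intro L2_smult torus_L2_L2 c)
  show "(\<lambda>\<alpha>. N (\<lambda>r. complex_of_real (mpow (k - k0) \<alpha>) *s c \<alpha> r)) summable_on UNIV"
    by (rule summable_on_comparison_test[OF s])
      (use abs_mpow_near[OF k] in \<open>auto simp: N_smult N_nonneg mult.commute intro!: mult_left_mono\<close>)
  show "((\<lambda>\<alpha>. H f (\<lambda>r. complex_of_real (mpow (k - k0) \<alpha>) *s c \<alpha> r)) has_sum H f v) UNIV" if "L2 f" for f
    using w[OF that] by (simp add: cell_inner_smult_right)
qed

lemma vector_analytic_imp_real_analytic:
  fixes G :: "real^'d \<Rightarrow> real^'d \<Rightarrow> complex^'m"
  assumes "\<And>k0. vector_analytic k0 G"
  shows "real_analytic_wrt (torus_L2 L) N G"
  unfolding real_analytic_wrt_def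
proof
  fix k0
  obtain \<rho> c where \<rho>: "\<rho> > 0" and c: "\<And>\<alpha>. c \<alpha> \<in> torus_L2 L"
    and s: "(\<lambda>\<alpha>. N (c \<alpha>) * \<rho> ^ mdeg \<alpha>) summable_on UNIV"
    and G: "\<And>k. near \<rho> k0 k \<Longrightarrow> G k \<in> torus_L2 L"
    and w: "\<And>k (f :: real^'d \<Rightarrow> complex^'m). near \<rho> k0 k \<Longrightarrow> L2 f \<Longrightarrow>
      ((\<lambda>\<alpha>. of_real (mpow (k - k0) \<alpha>) * H f (c \<alpha>)) has_sum H f (G k)) UNIV"
    using assms[of k0] unfolding vector_analytic_def by blast
  have near: "near \<rho> k0 k" if "k \<in> ball k0 \<rho>" for k
    unfolding near_def
  proof
    fix i
    have "\<bar>(k - k0) $ i\<bar> \<le> norm (k - k0)" by (rule component_le_norm_cart)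
    then show "\<bar>k $ i - k0 $ i\<bar> \<le> \<rho>" using that by (simp add: dist_norm norm_minus_commute)
  qed
  have eq: "G k - (\<Sum>\<alpha>\<in>S. (\<Prod>i\<in>UNIV. (k $ i - k0 $ i) ^ \<alpha> i) *\<^sub>R c \<alpha>) =
      (\<lambda>r. G k r - (\<Sum>\<alpha>\<in>S. of_real (mpow (k - k0) \<alpha>) *s c \<alpha> r))" for k S
    by (rule ext) (simp add: sum_fun_eval scaleR_fun_def scaleR_vec_smult mpow_def)
  have lim: "((\<lambda>S. N (G k - (\<Sum>\<alpha>\<in>S. (\<Prod>i\<in>UNIV. (k $ i - k0 $ i) ^ \<alpha> i) *\<^sub>R c \<alpha>))) \<longlongrightarrow> 0)
      (finite_subsets_at_top UNIV)" if "k \<in> ball k0 \<rho>" for k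
    unfolding eq
    by (rule vector_analytic_norm_convergent[OF c \<rho> s near[OF that] torus_L2_L2[OF G[OF near[OF that]]]
          w[OF near[OF that]]])
  show "\<exists>c. \<exists>\<rho>>0. (\<forall>\<alpha>. c \<alpha> \<in> torus_L2 L) \<and> (\<forall>k\<in>ball k0 \<rho>.
      ((\<lambda>S. N (G k - (\<Sum>\<alpha>\<in>S. (\<Prod>i\<in>UNIV. (k $ i - k0 $ i) ^ \<alpha> i) *\<^sub>R c \<alpha>))) \<longlongrightarrow> 0) (finite_subsets_at_top UNIV))"
    using \<rho> c lim by blast
qed

lemma real_analytic_imp_vector_analytic:
  fixes G :: "real^'d \<Rightarrow> real^'d \<Rightarrow> complex^'m"
  assumes an: "real_analytic_wrt (torus_L2 L) N G" and G: "\<And>k. G k \<in> torus_L2 L"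
  shows "vector_analytic k0 G"
proof -
  have plus: "x + y = (\<lambda>r. x r + y r)" and scale: "a *\<^sub>R x = (\<lambda>r. complex_of_real a *s x r)"
    for x y :: "real^'d \<Rightarrow> complex^'m" and a
    by (auto simp: fun_eq_iff scaleR_fun_def scaleR_vec_smult)
  obtain c \<rho> where \<rho>: "\<rho> > 0" and c: "\<And>\<alpha>. c \<alpha> \<in> torus_L2 L"
    and s: "(\<lambda>\<alpha>. N (c \<alpha>) * \<rho> ^ mdeg \<alpha>) summable_on UNIV"
    and lim: "\<And>k. near \<rho> k0 k \<Longrightarrow>
      ((\<lambda>S. N (G k - (\<Sum>\<alpha>\<in>S. mpow (k - k0) \<alpha> *\<^sub>R c \<alpha>))) \<longlongrightarrow> 0) (finite_subsets_at_top UNIV)"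
  proof (rule real_analytic_wrt_abs_convergent[OF an])
    show "x + y \<in> torus_L2 L" if "x \<in> torus_L2 L" "y \<in> torus_L2 L" for x y :: "real^'d \<Rightarrow> complex^'m"
      unfolding plus by (rule torus_L2_add[OF that])
    show "a *\<^sub>R x \<in> torus_L2 L" if "x \<in> torus_L2 L" for x :: "real^'d \<Rightarrow> complex^'m" and a
      unfolding scale by (rule torus_L2_smult[OF that])
    show "N (x + y) \<le> N x + N y" if "x \<in> torus_L2 L" "y \<in> torus_L2 L" for x y :: "real^'d \<Rightarrow> complex^'m"
      unfolding plus by (intro N_triangle torus_L2_L2 that)
    show "N (a *\<^sub>R x) = \<bar>a\<bar> * N x" for x :: "real^'d \<Rightarrow> complex^'m" and a
      unfolding scale by (simp add: N_smult)
  qed (use G in auto)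
  show ?thesis
    unfolding vector_analytic_def
  proof (intro exI[of _ \<rho>] exI[of _ c] conjI allI impI \<rho> c s G)
    fix k and f :: "real^'d \<Rightarrow> complex^'m" assume k: "near \<rho> k0 k" and f: "L2 f"
    have eq: "G k - (\<Sum>\<alpha>\<in>S. mpow (k - k0) \<alpha> *\<^sub>R c \<alpha>) =
        (\<lambda>r. G k r - (\<Sum>\<alpha>\<in>S. of_real (mpow (k - k0) \<alpha>) *s c \<alpha> r))" for S
      by (rule ext) (simp add: sum_fun_eval scaleR_fun_def scaleR_vec_smult)
    have "((\<lambda>\<alpha>. H f (\<lambda>r. complex_of_real (mpow (k - k0) \<alpha>) *s c \<alpha> r)) has_sum H f (G k)) UNIV"
      by (rule tendsto_weak_sum[OF _ torus_L2_L2[OF G] f])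
        (use lim[OF k] in \<open>auto simp: eq intro: L2_smult torus_L2_L2 c\<close>)
    then show "((\<lambda>\<alpha>. of_real (mpow (k - k0) \<alpha>) * H f (c \<alpha>)) has_sum H f (G k)) UNIV"
      by (simp add: cell_inner_smult_right)
  qed
qed

subsection \<open>Bounded operators\<close>

abbreviation "opN \<equiv> torus_op_norm L"

lemma torus_opD:
  fixes T :: "(real^'d \<Rightarrow> complex^'m) \<Rightarrow> real^'d \<Rightarrow> complex^'m"
  assumes "T \<in> torus_bounded_ops L" "f \<in> torus_L2 L"
  shows "T f \<in> torus_L2 L" and "g \<in> torus_L2 L \<Longrightarrow> AE r in lborel. T (\<lambda>x. a *s f x + b *s g x) r = a *s T f r + b *s T g r"
  using assms by (auto simp: torus_bounded_ops_def)

lemma torus_op_bdd: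
  fixes T :: "(real^'d \<Rightarrow> complex^'m) \<Rightarrow> real^'d \<Rightarrow> complex^'m"
  assumes "T \<in> torus_bounded_ops L"
  shows "bdd_above ((\<lambda>f. N (T f)) ` {f \<in> torus_L2 L. N f \<le> 1})"
proof -
  obtain C where C: "\<And>f :: real^'d \<Rightarrow> complex^'m. f \<in> torus_L2 L \<Longrightarrow> N (T f) \<le> C * N f"
    using assms unfolding torus_bounded_ops_def by blast
  show ?thesis
  proof (rule bdd_aboveI2)
    fix f :: "real^'d \<Rightarrow> complex^'m" assume f: "f \<in> {f \<in> torus_L2 L. N f \<le> 1}"
    then have "N (T f) \<le> C * N f" using C by simp
    also have "\<dots> \<le> \<bar>C\<bar> * 1" using f by (intro mult_mono) (auto simp: N_nonneg)
    finally show "N (T f) \<le> \<bar>C\<bar>" by simp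
  qed
qed

lemma opN_le:
  fixes T :: "(real^'d \<Rightarrow> complex^'m) \<Rightarrow> real^'d \<Rightarrow> complex^'m"
  assumes T: "T \<in> torus_bounded_ops L" and f: "f \<in> torus_L2 L"
  shows "N (T f) \<le> opN T * N f"
proof (cases "N f = 0")
  \<comment> \<open>Vanishing seminorm does not mean \<open>f = 0\<close>, so \<open>f\<close>
    cannot be normalized; the a priori bound of the operator forces
    \<open>N (T f) = 0\<close>.\<close>
  case True
  obtain C where "N (T f) \<le> C * N f" using T f by (auto simp: torus_bounded_ops_def)
  then show ?thesis using True by simp
next
  case False
  then have pos: "N f > 0" using N_nonneg[of f] by simp
  define g where "g = (\<lambda>r. complex_of_real (1 / N f) *s f r)"
  have g: "g \<in> torus_L2 L" unfolding g_def by (rule torus_L2_smult[OF f])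
  have Ng: "N g = 1" using pos unfolding g_def by (simp only: N_smult) (simp add: norm_divide)
  have "AE r in lborel. T (\<lambda>x. complex_of_real (N f) *s g x + 0 *s g x) r = complex_of_real (N f) *s T g r + 0 *s T g r"
    by (rule torus_opD(2)[OF T g g])
  moreover have "(\<lambda>x. complex_of_real (N f) *s g x + 0 *s g x) = f"
    using pos by (auto simp: g_def fun_eq_iff vec_eq_iff)
  ultimately have "N (T f) = N (\<lambda>r. complex_of_real (N f) *s T g r)"
    by (intro cell_norm_cong_AE torus_L2_measurable torus_L2_smult torus_opD(1)[OF T] f g) auto
  also have "\<dots> = N f * N (T g)" using pos by (simp add: N_smult)
  also have "N (T g) \<le> opN T"
    unfolding torus_op_norm_def by (rule cSUP_upper[OF _ torus_op_bdd[OF T]]) (use g Ng in auto)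
  finally show ?thesis using pos by (simp add: mult.commute mult_left_mono)
qed

lemma opN_least:
  fixes T :: "(real^'d \<Rightarrow> complex^'m) \<Rightarrow> real^'d \<Rightarrow> complex^'m"
  assumes "\<And>f. f \<in> torus_L2 L \<Longrightarrow> N f \<le> 1 \<Longrightarrow> N (T f) \<le> b"
  shows "opN T \<le> b"
  unfolding torus_op_norm_def
proof (rule cSUP_least)
  have "(\<lambda>_. 0) \<in> {f :: real^'d \<Rightarrow> complex^'m. f \<in> torus_L2 L \<and> N f \<le> 1}"
    by (simp add: torus_L2_zero N_zero)
  then show "{f :: real^'d \<Rightarrow> complex^'m. f \<in> torus_L2 L \<and> N f \<le> 1} \<noteq> {}" by blast
qed (use assms in auto)

lemma opN_nonneg:
  fixes T :: "(real^'d \<Rightarrow> complex^'m) \<Rightarrow> real^'d \<Rightarrow> complex^'m"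
  assumes "T \<in> torus_bounded_ops L"
  shows "0 \<le> opN T"
proof -
  have "N (T (\<lambda>_. 0)) \<le> opN T"
    unfolding torus_op_norm_def
    by (rule cSUP_upper[OF _ torus_op_bdd[OF assms]]) (simp add: torus_L2_zero N_zero)
  then show ?thesis using N_nonneg[of "T (\<lambda>_. 0)"] by linarith
qed

lemma torus_op_add:
  fixes T :: "(real^'d \<Rightarrow> complex^'m) \<Rightarrow> real^'d \<Rightarrow> complex^'m"
  assumes T: "T \<in> torus_bounded_ops L" and S: "S \<in> torus_bounded_ops L"
  shows "T + S \<in> torus_bounded_ops L" and "opN (T + S) \<le> opN T + opN S"
proof -
  have le: "N ((T + S) f) \<le> (opN T + opN S) * N f" if f: "f \<in> torus_L2 L"
    for f :: "real^'d \<Rightarrow> complex^'m"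
  proof -
    have "N ((T + S) f) \<le> N (T f) + N (S f)"
      using N_triangle[OF torus_L2_L2[OF torus_opD(1)[OF T f]] torus_L2_L2[OF torus_opD(1)[OF S f]]]
      by (simp add: plus_fun_def)
    also have "\<dots> \<le> opN T * N f + opN S * N f" by (intro add_mono opN_le T S f)
    finally show ?thesis by (simp add: algebra_simps)
  qed
  show "T + S \<in> torus_bounded_ops L"
    unfolding torus_bounded_ops_def
  proof (intro CollectI conjI ballI allI)
    fix f g :: "real^'d \<Rightarrow> complex^'m" and a b assume f: "f \<in> torus_L2 L"
    show "(T + S) f \<in> torus_L2 L"
      using torus_L2_add[OF torus_opD(1)[OF T f] torus_opD(1)[OF S f]] by (simp add: plus_fun_def)
    assume g: "g \<in> torus_L2 L"
    from torus_opD(2)[OF T f g, of a b] torus_opD(2)[OF S f g, of a b]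
    show "AE r in lborel. (T + S) (\<lambda>x. a *s f x + b *s g x) r = a *s (T + S) f r + b *s (T + S) g r"
      by eventually_elim (simp add: vector_add_ldistrib)
  qed (use le in blast)
  show "opN (T + S) \<le> opN T + opN S"
  proof (rule opN_least)
    fix f :: "real^'d \<Rightarrow> complex^'m" assume f: "f \<in> torus_L2 L" "N f \<le> 1"
    have "(opN T + opN S) * N f \<le> opN T + opN S"
      using f opN_nonneg[OF T] opN_nonneg[OF S] by (intro mult_left_le) auto
    then show "N ((T + S) f) \<le> opN T + opN S" using le[OF f(1)] by linarith
  qed
qed

lemma torus_op_scale:
  fixes T :: "(real^'d \<Rightarrow> complex^'m) \<Rightarrow> real^'d \<Rightarrow> complex^'m"
  assumes T: "T \<in> torus_bounded_ops L"
  shows "a *\<^sub>R T \<in> torus_bounded_ops L" and "opN (a *\<^sub>R T) = \<bar>a\<bar> * opN T"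
proof -
  have ap: "(c *\<^sub>R U) f = (\<lambda>r. complex_of_real c *s U f r)" for c f
    and U :: "(real^'d \<Rightarrow> complex^'m) \<Rightarrow> real^'d \<Rightarrow> complex^'m"
    by (auto simp: scaleR_fun_def scaleR_vec_smult)
  have mem: "c *\<^sub>R T \<in> torus_bounded_ops L" for c
    unfolding torus_bounded_ops_def ap
  proof (intro CollectI conjI ballI allI exI)
    fix f g :: "real^'d \<Rightarrow> complex^'m" and a b assume f: "f \<in> torus_L2 L"
    show "(\<lambda>r. complex_of_real c *s T f r) \<in> torus_L2 L"
      by (intro torus_L2_smult torus_opD(1)[OF T f])
    have "N (\<lambda>r. complex_of_real c *s T f r) \<le> \<bar>c\<bar> * (opN T * N f)"
      by (simp add: N_smult opN_le[OF T f] mult_left_mono)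
    then show "N (\<lambda>r. complex_of_real c *s T f r) \<le> (\<bar>c\<bar> * opN T) * N f" by simp
    assume g: "g \<in> torus_L2 L"
    from torus_opD(2)[OF T f g, of a b]
    show "AE r in lborel. complex_of_real c *s T (\<lambda>x. a *s f x + b *s g x) r =
        a *s (complex_of_real c *s T f r) + b *s (complex_of_real c *s T g r)"
      by eventually_elim (simp add: vec_eq_iff algebra_simps)
  qed
  show "a *\<^sub>R T \<in> torus_bounded_ops L" by (rule mem)
  have le: "opN (c *\<^sub>R U) \<le> \<bar>c\<bar> * opN U" if U: "U \<in> torus_bounded_ops L"
    for c and U :: "(real^'d \<Rightarrow> complex^'m) \<Rightarrow> real^'d \<Rightarrow> complex^'m"
  proof (rule opN_least)
    fix f :: "real^'d \<Rightarrow> complex^'m" assume f: "f \<in> torus_L2 L" "N f \<le> 1"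
    have "opN U * N f \<le> opN U" using f opN_nonneg[OF U] by (intro mult_left_le) auto
    then have "N (U f) \<le> opN U" using opN_le[OF U f(1)] by linarith
    then show "N ((c *\<^sub>R U) f) \<le> \<bar>c\<bar> * opN U"
      unfolding ap by (simp add: N_smult mult_left_mono)
  qed
  show "opN (a *\<^sub>R T) = \<bar>a\<bar> * opN T"
  proof (cases "a = 0")
    case True
    then show ?thesis using le[OF T, of 0] opN_nonneg[OF mem[of 0]] by simp
  next
    case False
    have "opN T = opN ((1 / a) *\<^sub>R (a *\<^sub>R T))" using False by simp
    also have "\<dots> \<le> \<bar>1 / a\<bar> * opN (a *\<^sub>R T)" by (rule le[OF mem])
    finally have "\<bar>a\<bar> * opN T \<le> opN (a *\<^sub>R T)" using False by (simp add: field_simps)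
    then show ?thesis using le[OF T, of a] by simp
  qed
qed

lemma torus_op_sum:
  fixes T :: "(real^'d \<Rightarrow> complex^'m) \<Rightarrow> real^'d \<Rightarrow> complex^'m"
  assumes T: "T \<in> torus_bounded_ops L" and S: "finite S" and f: "\<And>i. i \<in> S \<Longrightarrow> f i \<in> torus_L2 L"
  shows "AE r in lborel. T (\<lambda>x. \<Sum>i\<in>S. a i *s f i x) r = (\<Sum>i\<in>S. a i *s T (f i) r)"
  using S f
proof (induction S rule: finite_induct)
  case empty
  have "AE r in lborel. T (\<lambda>x. 0 *s (\<lambda>_. 0) x + 0 *s (\<lambda>_. 0) x) r = 0 *s T (\<lambda>_. 0) r + 0 *s T (\<lambda>_. 0) r"
    by (rule torus_opD(2)[OF T torus_L2_zero torus_L2_zero])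
  then show ?case by simp
next
  case (insert i S)
  have "AE r in lborel. T (\<lambda>x. a i *s f i x + 1 *s (\<lambda>x. \<Sum>i\<in>S. a i *s f i x) x) r =
      a i *s T (f i) r + 1 *s T (\<lambda>x. \<Sum>i\<in>S. a i *s f i x) r"
    using insert by (intro torus_opD(2)[OF T] torus_L2_sum torus_L2_smult) auto
  moreover have "AE r in lborel. T (\<lambda>x. \<Sum>i\<in>S. a i *s f i x) r = (\<Sum>i\<in>S. a i *s T (f i) r)"
    using insert by simp
  ultimately show ?case using insert(1,2) by (auto elim!: eventually_elim2)
qed

text \<open>
  Unlike \<open>exp (- i k r)\<close>, this multiplier is lattice-periodic in \<open>r\<close>; it is analytic in \<open>k\<close> and
  transforms under \<open>k \<mapsto> k + K\<close> exactly as the periodic part of a periodic choice does.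
\<close>

definition cell_phase :: "real^'d \<Rightarrow> (real^'d \<Rightarrow> complex^'m) \<Rightarrow> real^'d \<Rightarrow> complex^'m" where
  "cell_phase k g = (\<lambda>r. cis (- (k \<bullet> cell_rep r)) *s g r)"

lemma cell_phase_torus: "g \<in> torus_L2 L \<Longrightarrow> cell_phase k g \<in> torus_L2 L"
  unfolding cell_phase_def
  by (rule torus_L2_mult[where b = 1]) (auto simp: cell_rep_add intro!: measurable_compose[OF _ measurable_cis])

text \<open>Because \<open>cell_rep\<close> is bounded, the exponential series in
  \<open>k - k0\<close> converges uniformly in \<open>r\<close>. Its coefficients are bounded
  periodic multipliers, and multiplying \<open>g\<close> by them gives the vector
  coefficients.\<close>

lemma cell_phase_analytic:
  fixes g :: "real^'d \<Rightarrow> complex^'m"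
  assumes g: "g \<in> torus_L2 L"
  shows "vector_analytic k0 (\<lambda>k. cell_phase k g)"
proof -
  obtain b where b: "b > 0" "\<And>r. norm (cell_rep r) \<le> b" using cell_rep_bounded by blast
  have bi: "\<bar>cell_rep r $ i\<bar> \<le> b" for r i
    using component_le_norm_cart[of "cell_rep r" i] b(2)[of r] by linarith
  define e where "e \<alpha> r = (\<Prod>i\<in>UNIV. (- \<i> * of_real (cell_rep r $ i)) ^ \<alpha> i / fact (\<alpha> i)) *
      cis (- (k0 \<bullet> cell_rep r))" for \<alpha> r
  define c where "c \<alpha> = (\<lambda>r. e \<alpha> r *s g r)" for \<alpha>
  \<comment> \<open>A bound for the multiplier \<open>e \<alpha>\<close> that is uniform in
    \<open>r\<close>; it is a term of the exponential series in \<open>CARD('d)\<close> variables at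
    the point with all coordinates \<open>b\<close>.\<close>
  define B where "B \<alpha> = (\<Prod>i\<in>(UNIV::'d set). b ^ \<alpha> i / fact (\<alpha> i))" for \<alpha>
  have B0: "0 \<le> B \<alpha>" for \<alpha> using b by (auto simp: B_def intro: prod_nonneg)
  have Bsum: "(B has_sum exp (\<Sum>i\<in>(UNIV::'d set). b)) UNIV"
    unfolding B_def by (rule has_sum_exp_multiindex)
  have e_meas [measurable]: "e \<alpha> \<in> borel_measurable borel" for \<alpha>
  proof -
    have "(\<lambda>r. - (k0 \<bullet> cell_rep r)) \<in> borel_measurable borel" by measurable
    then have "(\<lambda>r. cis (- (k0 \<bullet> cell_rep r))) \<in> borel_measurable borel"
      by (rule measurable_compose[OF _ measurable_cis])
    then show ?thesis
      unfolding e_def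
      by (intro borel_measurable_times borel_measurable_prod borel_measurable_divide borel_measurable_power
          borel_measurable_const measurable_compose[OF _ borel_measurable_of_real]
          measurable_vec_nth measurable_cell_rep measurable_ident_sets) auto
  qed
  have e_le: "norm (e \<alpha> r) \<le> B \<alpha>" for \<alpha> r
  proof -
    have "norm (e \<alpha> r) = (\<Prod>i\<in>UNIV. \<bar>cell_rep r $ i\<bar> ^ \<alpha> i / fact (\<alpha> i))"
      by (simp add: e_def norm_mult prod_norm[symmetric] norm_divide norm_power)
    also have "\<dots> \<le> B \<alpha>"
      unfolding B_def by (intro prod_mono conjI divide_right_mono power_mono bi) auto
    finally show ?thesis .
  qed
  have cT: "c \<alpha> \<in> torus_L2 L" for \<alpha>
    unfolding c_def by (rule torus_L2_mult[OF g e_meas e_le]) (simp add: e_def cell_rep_add)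
  have esum: "((\<lambda>\<alpha>. of_real (mpow (k - k0) \<alpha>) * e \<alpha> r) has_sum cis (- (k \<bullet> cell_rep r))) UNIV" for k r
  proof -
    let ?z = "\<lambda>i. - \<i> * of_real (cell_rep r $ i * (k $ i - k0 $ i))"
    have "((\<lambda>\<alpha>. (\<Prod>i\<in>UNIV. ?z i ^ \<alpha> i / fact (\<alpha> i)) * cis (- (k0 \<bullet> cell_rep r)))
        has_sum exp (\<Sum>i\<in>UNIV. ?z i) * cis (- (k0 \<bullet> cell_rep r))) UNIV"
      by (intro has_sum_cmult_left has_sum_exp_multiindex)
    also have "exp (\<Sum>i\<in>UNIV. ?z i) = cis (- ((k - k0) \<bullet> cell_rep r))"
      by (simp add: cis_conv_exp inner_vec_def sum_distrib_left sum_negf[symmetric] mult.commute mult.left_commute)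
    also have "\<dots> * cis (- (k0 \<bullet> cell_rep r)) = cis (- (k \<bullet> cell_rep r))"
      by (simp add: cis_mult inner_diff_left)
    also have "(\<lambda>\<alpha>. (\<Prod>i\<in>UNIV. ?z i ^ \<alpha> i / fact (\<alpha> i)) * cis (- (k0 \<bullet> cell_rep r))) =
        (\<lambda>\<alpha>. of_real (mpow (k - k0) \<alpha>) * e \<alpha> r)"
      by (rule ext) (simp add: e_def mpow_def prod.distrib[symmetric] power_mult_distrib[symmetric] mult_ac)
    finally show ?thesis .
  qed
  have sB: "(\<lambda>\<alpha>. N (c \<alpha>) * 1 ^ mdeg \<alpha>) summable_on UNIV"
  proof (rule summable_on_comparison_test[OF summable_on_cmult_left[OF has_sum_imp_summable[OF Bsum]]])
    show "N (c \<alpha>) * 1 ^ mdeg \<alpha> \<le> B \<alpha> * N g" for \<alpha>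
      unfolding c_def using N_mult_le[OF torus_L2_L2[OF g] e_meas e_le B0] by simp
  qed (simp add: N_nonneg)
  have weak: "((\<lambda>\<alpha>. of_real (mpow (k - k0) \<alpha>) * H f (c \<alpha>)) has_sum H f (cell_phase k g)) UNIV"
    if k: "near 1 k0 k" and f: "L2 f" for k and f :: "real^'d \<Rightarrow> complex^'m"
  proof -
    let ?E = "exp (\<Sum>i\<in>(UNIV::'d set). b)"
    have le: "norm (of_real (mpow (k - k0) \<alpha>) * e \<alpha> r) \<le> B \<alpha>" for \<alpha> r
      using norm_mpow_term_le[OF k, of \<alpha> "e \<alpha> r"] e_le[of \<alpha> r] by simp
    have tail: "N (\<lambda>r. cell_phase k g r - (\<Sum>\<alpha>\<in>S. of_real (mpow (k - k0) \<alpha>) *s c \<alpha> r)) \<le> (?E - sum B S) * N g"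
      if S: "finite S" for S
    proof -
      have eq: "cell_phase k g r - (\<Sum>\<alpha>\<in>S. of_real (mpow (k - k0) \<alpha>) *s c \<alpha> r) =
          (cis (- (k \<bullet> cell_rep r)) - (\<Sum>\<alpha>\<in>S. of_real (mpow (k - k0) \<alpha>) * e \<alpha> r)) *s g r" for r
        by (simp add: cell_phase_def c_def vec_eq_iff algebra_simps sum_distrib_left)
      have t: "norm (cis (- (k \<bullet> cell_rep r)) - (\<Sum>\<alpha>\<in>S. of_real (mpow (k - k0) \<alpha>) * e \<alpha> r)) \<le> ?E - sum B S" for r
        by (rule has_sum_tail_bound[OF esum Bsum le S]) auto
      show ?thesis
        unfolding eq
      proof (rule N_mult_le[OF torus_L2_L2[OF g] _ t])
        have "(\<lambda>r. - (k \<bullet> cell_rep r)) \<in> borel_measurable borel" by measurable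
        then have [measurable]: "(\<lambda>r. cis (- (k \<bullet> cell_rep r))) \<in> borel_measurable borel"
          by (rule measurable_compose[OF _ measurable_cis])
        show "(\<lambda>r. cis (- (k \<bullet> cell_rep r)) - (\<Sum>\<alpha>\<in>S. of_real (mpow (k - k0) \<alpha>) * e \<alpha> r)) \<in> borel_measurable borel"
          by measurable
        show "0 \<le> ?E - sum B S" using t[of 0] norm_ge_zero order_trans by blast
      qed
    qed
    have "((\<lambda>S. (?E - sum B S) * N g) \<longlongrightarrow> (?E - ?E) * N g) (finite_subsets_at_top UNIV)"
      using Bsum unfolding has_sum_def by (intro tendsto_intros)
    then have lim: "((\<lambda>S. (?E - sum B S) * N g) \<longlongrightarrow> 0) (finite_subsets_at_top UNIV)" by simp
    have "((\<lambda>S. N (\<lambda>r. cell_phase k g r - (\<Sum>\<alpha>\<in>S. of_real (mpow (k - k0) \<alpha>) *s c \<alpha> r))) \<longlongrightarrow> 0)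
        (finite_subsets_at_top UNIV)"
    proof (rule tendsto_sandwich[OF _ _ tendsto_const lim])
      show "\<forall>\<^sub>F S in finite_subsets_at_top UNIV. 0 \<le> N (\<lambda>r. cell_phase k g r -
          (\<Sum>\<alpha>\<in>S. of_real (mpow (k - k0) \<alpha>) *s c \<alpha> r))" by (simp add: N_nonneg)
      show "\<forall>\<^sub>F S in finite_subsets_at_top UNIV. N (\<lambda>r. cell_phase k g r -
          (\<Sum>\<alpha>\<in>S. of_real (mpow (k - k0) \<alpha>) *s c \<alpha> r)) \<le> (?E - sum B S) * N g"
        by (rule eventually_finite_subsets_at_top_weakI) (rule tail)
    qed
    then have "((\<lambda>\<alpha>. H f (\<lambda>r. complex_of_real (mpow (k - k0) \<alpha>) *s c \<alpha> r)) has_sum H f (cell_phase k g)) UNIV"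
      by (intro tendsto_weak_sum f L2_smult torus_L2_L2 cT cell_phase_torus g)
    then show ?thesis by (simp add: cell_inner_smult_right)
  qed
  show ?thesis
    unfolding vector_analytic_def
    using cT sB cell_phase_torus[OF g] weak zero_less_one by blast
qed

text \<open>Combining the operator series with the vector series gives a double series of matrix
  elements, majorized by \<open>N f * opN (C \<beta>) * N (c \<alpha>)\<close> and regrouped by
  total degree. For a fixed vector \<open>g\<close> the coefficients are simply
  \<open>C \<beta> g\<close>.\<close>

lemma operator_analytic_apply:
  fixes T :: "real^'d \<Rightarrow> (real^'d \<Rightarrow> complex^'m) \<Rightarrow> real^'d \<Rightarrow> complex^'m"
  assumes an: "real_analytic_wrt (torus_bounded_ops L) opN T"
    and T: "\<And>k. T k \<in> torus_bounded_ops L"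
    and G: "vector_analytic k0 G" and f: "L2 f"
  shows "analytic_near k0 (\<lambda>k. H f (T k (G k)))"
    and "g \<in> torus_L2 L \<Longrightarrow> vector_analytic k0 (\<lambda>k. T k g)"
proof -
  obtain C \<rho>1 where \<rho>1: "\<rho>1 > 0" and C: "\<And>\<alpha>. C \<alpha> \<in> torus_bounded_ops L"
    and sC: "(\<lambda>\<alpha>. opN (C \<alpha>) * \<rho>1 ^ mdeg \<alpha>) summable_on UNIV"
    and lim: "\<And>k. near \<rho>1 k0 k \<Longrightarrow>
      ((\<lambda>S. opN (T k - (\<Sum>\<alpha>\<in>S. mpow (k - k0) \<alpha> *\<^sub>R C \<alpha>))) \<longlongrightarrow> 0) (finite_subsets_at_top UNIV)"
    by (rule real_analytic_wrt_abs_convergent[OF an])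
      (use T in \<open>auto intro: torus_op_add torus_op_scale\<close>)
  have diffop: "T k - (\<Sum>\<alpha>\<in>S. mpow (k - k0) \<alpha> *\<^sub>R C \<alpha>) \<in> torus_bounded_ops L" if "finite S" for k S
  proof -
    have "(\<Sum>\<alpha>\<in>S. (- mpow (k - k0) \<alpha>) *\<^sub>R C \<alpha>) + T k \<in> torus_bounded_ops L"
      using that
    proof (induction S rule: finite_induct)
      case (insert x S)
      have "(- mpow (k - k0) x) *\<^sub>R C x + ((\<Sum>\<alpha>\<in>S. (- mpow (k - k0) \<alpha>) *\<^sub>R C \<alpha>) + T k) \<in> torus_bounded_ops L"
        by (intro torus_op_add(1) torus_op_scale(1) C insert.IH)
      then show ?case by (simp only: sum.insert[OF insert.hyps] add.assoc)
    qed (simp add: T)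
    then have "T k + - (\<Sum>\<alpha>\<in>S. mpow (k - k0) \<alpha> *\<^sub>R C \<alpha>) \<in> torus_bounded_ops L"
      by (simp only: scaleR_minus_left sum_negf add.commute)
    then show ?thesis by simp
  qed
  have Tsum: "((\<lambda>\<beta>. of_real (mpow (k - k0) \<beta>) * H f (C \<beta> g)) has_sum H f (T k g)) UNIV"
    if k: "near \<rho>1 k0 k" and g: "g \<in> torus_L2 L" and f: "L2 f" for k g f
  proof -
    have "((\<lambda>S. N (\<lambda>r. T k g r - (\<Sum>\<beta>\<in>S. of_real (mpow (k - k0) \<beta>) *s C \<beta> g r))) \<longlongrightarrow> 0)
        (finite_subsets_at_top UNIV)"
    proof (rule tendsto_sandwich[OF _ _ tendsto_const tendsto_mult_left_zero[OF lim[OF k], of "N g"]])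
      show "\<forall>\<^sub>F S in finite_subsets_at_top UNIV.
          0 \<le> N (\<lambda>r. T k g r - (\<Sum>\<beta>\<in>S. of_real (mpow (k - k0) \<beta>) *s C \<beta> g r))" by (simp add: N_nonneg)
      show "\<forall>\<^sub>F S in finite_subsets_at_top UNIV.
          N (\<lambda>r. T k g r - (\<Sum>\<beta>\<in>S. of_real (mpow (k - k0) \<beta>) *s C \<beta> g r))
          \<le> opN (T k - (\<Sum>\<alpha>\<in>S. mpow (k - k0) \<alpha> *\<^sub>R C \<alpha>)) * N g"
      proof (rule eventually_finite_subsets_at_top_weakI)
        fix S :: "('d \<Rightarrow> nat) set" assume "finite S"
        have "(T k - (\<Sum>\<alpha>\<in>S. mpow (k - k0) \<alpha> *\<^sub>R C \<alpha>)) g =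
            (\<lambda>r. T k g r - (\<Sum>\<beta>\<in>S. of_real (mpow (k - k0) \<beta>) *s C \<beta> g r))"
          by (rule ext) (simp add: sum_fun_eval scaleR_fun_def scaleR_vec_smult)
        then show "N (\<lambda>r. T k g r - (\<Sum>\<beta>\<in>S. of_real (mpow (k - k0) \<beta>) *s C \<beta> g r))
            \<le> opN (T k - (\<Sum>\<alpha>\<in>S. mpow (k - k0) \<alpha> *\<^sub>R C \<alpha>)) * N g"
          using opN_le[OF diffop[OF \<open>finite S\<close>] g, of k] by simp
      qed
    qed
    then have "((\<lambda>\<beta>. H f (\<lambda>r. of_real (mpow (k - k0) \<beta>) *s C \<beta> g r)) has_sum H f (T k g)) UNIV"
      by (intro tendsto_weak_sum f L2_smult torus_L2_L2 torus_opD(1)[OF C] torus_opD(1)[OF T] g)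
    then show ?thesis by (simp add: cell_inner_smult_right)
  qed
  show "vector_analytic k0 (\<lambda>k. T k g)" if g: "g \<in> torus_L2 L"
    unfolding vector_analytic_def
  proof (intro exI[of _ \<rho>1] exI[of _ "\<lambda>\<beta>. C \<beta> g"] conjI allI impI \<rho>1 torus_opD(1)[OF C] torus_opD(1)[OF T] g Tsum)
    show "(\<lambda>\<alpha>. N (C \<alpha> g) * \<rho>1 ^ mdeg \<alpha>) summable_on UNIV"
    proof (rule summable_on_comparison_test[OF summable_on_cmult_right[OF sC]])
      fix \<alpha>
      have "N (C \<alpha> g) * \<rho>1 ^ mdeg \<alpha> \<le> (opN (C \<alpha>) * N g) * \<rho>1 ^ mdeg \<alpha>"
        using \<rho>1 by (intro mult_right_mono opN_le C g) auto
      then show "N (C \<alpha> g) * \<rho>1 ^ mdeg \<alpha> \<le> N g * (opN (C \<alpha>) * \<rho>1 ^ mdeg \<alpha>)" by (simp add: mult_ac)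
    qed (use \<rho>1 in \<open>auto simp: N_nonneg\<close>)
  qed
  obtain \<rho>2 c where \<rho>2: "\<rho>2 > 0" and c: "\<And>\<alpha>. c \<alpha> \<in> torus_L2 L"
    and sc: "(\<lambda>\<alpha>. N (c \<alpha>) * \<rho>2 ^ mdeg \<alpha>) summable_on UNIV"
    and GT: "\<And>k. near \<rho>2 k0 k \<Longrightarrow> G k \<in> torus_L2 L"
    and w: "\<And>k (f :: real^'d \<Rightarrow> complex^'m). near \<rho>2 k0 k \<Longrightarrow> L2 f \<Longrightarrow>
      ((\<lambda>\<alpha>. of_real (mpow (k - k0) \<alpha>) * H f (c \<alpha>)) has_sum H f (G k)) UNIV"
    using G unfolding vector_analytic_def by blast
  define \<rho> where "\<rho> = min \<rho>1 \<rho>2"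
  have \<rho>: "\<rho> > 0" "\<rho> \<le> \<rho>1" "\<rho> \<le> \<rho>2" using \<rho>1 \<rho>2 by (auto simp: \<rho>_def)
  let ?m = "\<lambda>p. H f (C (fst p) (c (snd p)))"
  have Hle: "norm (H f (C \<beta> (c \<alpha>))) \<le> N f * (opN (C \<beta>) * N (c \<alpha>))" for \<alpha> \<beta>
    using order_trans[OF Cauchy_Schwarz[OF f torus_L2_L2[OF torus_opD(1)[OF C c]]]
        mult_left_mono[OF opN_le[OF C c] N_nonneg]] .
  have sC': "(\<lambda>\<alpha>. norm (of_real (opN (C \<alpha>) * \<rho> ^ mdeg \<alpha>) :: complex)) summable_on UNIV"
    by (rule summable_on_comparison_test[OF sC])
      (use \<rho> opN_nonneg[OF C] in \<open>auto intro!: mult_left_mono power_mono simp: norm_mult norm_power\<close>)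
  have sc': "(\<lambda>\<alpha>. norm (of_real (N (c \<alpha>) * \<rho> ^ mdeg \<alpha>) :: complex)) summable_on UNIV"
    by (rule summable_on_comparison_test[OF sc])
      (use \<rho> in \<open>auto intro!: mult_left_mono power_mono simp: norm_mult norm_power N_nonneg\<close>)
  have "(\<lambda>(x, y). norm (of_real (opN (C x) * \<rho> ^ mdeg x) :: complex) *
      norm (of_real (N (c y) * \<rho> ^ mdeg y) :: complex)) summable_on (UNIV \<times> UNIV)"
    by (rule has_sum_mult_pairs(2)[OF has_sum_infsum[OF abs_summable_summable[OF sC']] sC'
          has_sum_infsum[OF abs_summable_summable[OF sc']] sc'])
  then have "(\<lambda>p. N f * (norm (of_real (opN (C (fst p)) * \<rho> ^ mdeg (fst p)) :: complex) *
      norm (of_real (N (c (snd p)) * \<rho> ^ mdeg (snd p)) :: complex))) summable_on (UNIV \<times> UNIV)"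
    by (intro summable_on_cmult_right) (simp add: case_prod_unfold)
  then have sm: "(\<lambda>p. norm (?m p) * \<rho> ^ mdeg (fst p + snd p)) summable_on (UNIV \<times> UNIV)"
  proof (rule summable_on_comparison_test)
    fix p :: "('d \<Rightarrow> nat) \<times> ('d \<Rightarrow> nat)"
    have "norm (?m p) * \<rho> ^ mdeg (fst p + snd p) \<le>
        (N f * (opN (C (fst p)) * N (c (snd p)))) * \<rho> ^ mdeg (fst p + snd p)"
      using \<rho> by (intro mult_right_mono Hle) auto
    then show "norm (?m p) * \<rho> ^ mdeg (fst p + snd p) \<le>
        N f * (norm (of_real (opN (C (fst p)) * \<rho> ^ mdeg (fst p)) :: complex) *
        norm (of_real (N (c (snd p)) * \<rho> ^ mdeg (snd p)) :: complex))"
      using \<rho> opN_nonneg[OF C] by (simp add: norm_mult norm_power N_nonneg mdeg_add power_add mult_ac)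
  qed (use \<rho> in auto)
  have "power_series_le \<rho> k0 (\<lambda>k. H f (T k (G k)))
      (infsum (\<lambda>p. norm (?m p) * \<rho> ^ mdeg (fst p + snd p)) (UNIV \<times> UNIV))"
  proof (rule power_series_le_grouped[OF \<rho>(1) has_sum_infsum[OF sm] order_refl])
    fix k assume k: "near \<rho> k0 k"
    have k1: "near \<rho>1 k0 k" and k2: "near \<rho>2 k0 k" using k near_mono \<rho> by blast+
    have "(\<lambda>p. norm (of_real (mpow (k - k0) (fst p + snd p)) * ?m p)) summable_on (UNIV \<times> UNIV)"
      by (rule summable_on_comparison_test[OF sm]) (use norm_mpow_term_le[OF k] in auto)
    then have s: "(\<lambda>p. of_real (mpow (k - k0) (fst p + snd p)) * ?m p) summable_on (UNIV \<times> UNIV)"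
      by (rule abs_summable_summable)
    show "((\<lambda>p. of_real (mpow (k - k0) (fst p + snd p)) * ?m p) has_sum H f (T k (G k))) (UNIV \<times> UNIV)"
    proof (rule has_sum_SigmaI[OF _ Tsum[OF k1 GT[OF k2] f] s])
      fix \<beta>
      \<comment> \<open>The operator \<open>C \<beta>\<close> is linear almost everywhere and only
        for finite sums. Its boundedness carries it through the infinite series, once the remainders
        \<open>?v S\<close> are known to tend to zero in the seminorm.\<close>
      let ?v = "\<lambda>S r. G k r - (\<Sum>\<alpha>\<in>S. of_real (mpow (k - k0) \<alpha>) *s c \<alpha> r)"
      have lim0: "((\<lambda>S. N (?v S)) \<longlongrightarrow> 0) (finite_subsets_at_top UNIV)"
        by (rule vector_analytic_norm_convergent[OF c \<rho>2 sc k2 torus_L2_L2[OF GT[OF k2]] w[OF k2]])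
      have "((\<lambda>S. N (\<lambda>r. C \<beta> (G k) r - (\<Sum>\<alpha>\<in>S. of_real (mpow (k - k0) \<alpha>) *s C \<beta> (c \<alpha>) r))) \<longlongrightarrow> 0)
          (finite_subsets_at_top UNIV)"
      proof (rule tendsto_sandwich[OF _ _ tendsto_const tendsto_mult_right_zero[OF lim0, of "opN (C \<beta>)"]])
        show "\<forall>\<^sub>F S in finite_subsets_at_top UNIV.
            0 \<le> N (\<lambda>r. C \<beta> (G k) r - (\<Sum>\<alpha>\<in>S. of_real (mpow (k - k0) \<alpha>) *s C \<beta> (c \<alpha>) r))"
          by (simp add: N_nonneg)
        show "\<forall>\<^sub>F S in finite_subsets_at_top UNIV.
            N (\<lambda>r. C \<beta> (G k) r - (\<Sum>\<alpha>\<in>S. of_real (mpow (k - k0) \<alpha>) *s C \<beta> (c \<alpha>) r)) \<le> opN (C \<beta>) * N (?v S)"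
        proof (rule eventually_finite_subsets_at_top_weakI)
          fix S :: "('d \<Rightarrow> nat) set" assume S: "finite S"
          let ?s = "\<lambda>r. \<Sum>\<alpha>\<in>S. of_real (mpow (k - k0) \<alpha>) *s c \<alpha> r"
          have sT: "?s \<in> torus_L2 L" by (intro torus_L2_sum torus_L2_smult c)
          have vT: "?v S \<in> torus_L2 L"
            using torus_L2_add[OF GT[OF k2] torus_L2_smult[OF sT, of "-1"]] by simp
          have "AE r in lborel. C \<beta> (\<lambda>x. 1 *s G k x + (-1) *s ?s x) r = 1 *s C \<beta> (G k) r + (-1) *s C \<beta> ?s r"
            by (rule torus_opD(2)[OF C GT[OF k2] sT])
          then have "AE r in lborel. C \<beta> (?v S) r = C \<beta> (G k) r - C \<beta> ?s r" by simp
          then have "AE r in lborel. C \<beta> (G k) r - (\<Sum>\<alpha>\<in>S. of_real (mpow (k - k0) \<alpha>) *s C \<beta> (c \<alpha>) r) = C \<beta> (?v S) r"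
            using torus_op_sum[OF C S c, of \<beta> "\<lambda>\<alpha>. of_real (mpow (k - k0) \<alpha>)" "\<lambda>\<alpha>. \<alpha>"]
            by eventually_elim simp
          then have "N (\<lambda>r. C \<beta> (G k) r - (\<Sum>\<alpha>\<in>S. of_real (mpow (k - k0) \<alpha>) *s C \<beta> (c \<alpha>) r)) = N (C \<beta> (?v S))"
            by (intro cell_norm_cong_AE torus_L2_measurable[OF torus_opD(1)[OF C vT]] L2_measurable
                L2_diff L2_sum L2_smult torus_L2_L2 torus_opD(1)[OF C] GT[OF k2] c)
          then show "N (\<lambda>r. C \<beta> (G k) r - (\<Sum>\<alpha>\<in>S. of_real (mpow (k - k0) \<alpha>) *s C \<beta> (c \<alpha>) r)) \<le> opN (C \<beta>) * N (?v S)"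
            using opN_le[OF C vT] by simp
        qed
      qed
      then have "((\<lambda>\<alpha>. H f (\<lambda>r. complex_of_real (mpow (k - k0) \<alpha>) *s C \<beta> (c \<alpha>) r)) has_sum H f (C \<beta> (G k))) UNIV"
        by (intro tendsto_weak_sum f L2_smult torus_L2_L2 torus_opD(1)[OF C] GT[OF k2] c)
      from has_sum_cmult_right[OF this, of "of_real (mpow (k - k0) \<beta>)"]
      show "((\<lambda>\<alpha>. of_real (mpow (k - k0) (fst (\<beta>, \<alpha>) + snd (\<beta>, \<alpha>))) * ?m (\<beta>, \<alpha>)) has_sum
          of_real (mpow (k - k0) \<beta>) * H f (C \<beta> (G k))) UNIV"
        by (simp add: cell_inner_smult_right mpow_add mult.assoc)
    qed
  qed
  then show "analytic_near k0 (\<lambda>k. H f (T k (G k)))" using \<rho>(1) analytic_nearI by blast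
qed

end

section \<open>The reciprocal lattice and trigonometric polynomials\<close>

lemma cis_cong_2pi: "cis (2 * pi * of_int n) = 1"
  by (rule cis_multiple_2pi) simp

lemma cis_eq_1_imp: "cis x = 1 \<Longrightarrow> \<exists>n::int. x = 2 * pi * of_int n"
proof -
  assume "cis x = 1"
  then have "exp (\<i> * of_real x) = 1" by (simp only: cis_conv_exp)
  then obtain n :: int where "x = of_int (2 * n) * pi" unfolding exp_eq_1 by auto
  then show ?thesis by (auto simp: mult_ac)
qed

lemma cis_2pi_eq_imp_diff_Ints:
  assumes "cis (2 * pi * x) = cis (2 * pi * y)"
  shows "x - y \<in> \<int>"
proof -
  have "cis (2 * pi * (x - y)) = cis (2 * pi * x) * cis (- (2 * pi * y))"
    by (simp add: cis_mult right_diff_distrib)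
  also have "\<dots> = 1" using assms by (simp add: cis_mult)
  finally obtain n :: int where "2 * pi * (x - y) = 2 * pi * of_int n" using cis_eq_1_imp by blast
  then have "x - y = of_int n" by simp
  then show ?thesis by simp
qed

lemma linear_coordinate_analytic: "analytic_near k0 (\<lambda>k. of_real ((M *v k) $ i))"
  for M :: "real^'d^'d"
  using analytic_near_matrix[OF analytic_near_coordinate] .

context full_lattice
begin

section \<open>The dual basis and the reciprocal lattice\<close>

definition reciprocal_basis :: "real^'d^'d" where
  "reciprocal_basis = (2 * pi) *\<^sub>R transpose (matrix_inv basis)"

lemma reciprocal_basis_inner: "(reciprocal_basis *v x) \<bullet> y = 2 * pi * (x \<bullet> coords y)"
proof -
  have "(transpose (matrix_inv basis) *v x) \<bullet> y = x \<bullet> coords y"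
    unfolding coords_def by (simp add: transpose_matrix_vector dot_lmul_matrix)
  then show ?thesis by (simp add: reciprocal_basis_def scaleR_matrix_vector_assoc[symmetric])
qed

lemma reciprocal_lattice_inner: "K \<in> reciprocal_lattice L \<Longrightarrow> R \<in> L \<Longrightarrow> cis (K \<bullet> R) = 1"
  unfolding reciprocal_lattice_def using cis_cong_2pi by force

lemma full_rank_reciprocal: "full_rank_lattice (reciprocal_lattice L)"
  unfolding full_rank_lattice_def lattice_basis_def
proof (intro exI[of _ reciprocal_basis] conjI)
  have AB: "transpose basis ** transpose (matrix_inv basis) = mat 1"
    "transpose (matrix_inv basis) ** transpose basis = mat 1"
  proof -
    have "matrix_inv basis ** basis = mat 1" "basis ** matrix_inv basis = mat 1"
      by (simp_all add: matrix_eq matrix_vector_mul_assoc[symmetric] coords_def[symmetric])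
    then show "transpose basis ** transpose (matrix_inv basis) = mat 1"
      "transpose (matrix_inv basis) ** transpose basis = mat 1"
      by (simp_all add: matrix_transpose_mul[symmetric] transpose_mat)
  qed
  show "invertible reciprocal_basis"
    unfolding invertible_def
  proof (intro exI[of _ "(1 / (2 * pi)) *\<^sub>R transpose basis"] conjI)
    show "reciprocal_basis ** ((1 / (2 * pi)) *\<^sub>R transpose basis) = mat 1"
      "((1 / (2 * pi)) *\<^sub>R transpose basis) ** reciprocal_basis = mat 1"
      using AB
      by (simp_all add: reciprocal_basis_def matrix_eq matrix_vector_mul_assoc[symmetric]
          scaleR_matrix_vector_assoc[symmetric] matrix_vector_mult_scaleR)
  qed
  show "reciprocal_lattice L = range (\<lambda>n. reciprocal_basis *v (\<chi> i. of_int (n i)))"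
  proof (intro equalityI subsetI)
    fix K assume K: "K \<in> reciprocal_lattice L"
    \<comment> \<open>\<open>K\<close> is determined by its pairings with the primitive vectors of
      the lattice, and these pairings supply its integer coordinates in the dual basis.\<close>
    have "\<exists>n::int. K \<bullet> (basis *v axis i 1) = 2 * pi * of_int n" for i
    proof -
      have "coords (basis *v axis i 1) $ j \<in> \<int>" for j by (simp add: axis_def)
      then have "basis *v axis i 1 \<in> L" unfolding mem_lattice_iff by blast
      then show ?thesis using K by (auto simp: reciprocal_lattice_def)
    qed
    then obtain n :: "'d \<Rightarrow> int" where n: "\<And>i. K \<bullet> (basis *v axis i 1) = 2 * pi * of_int (n i)" by metis
    have "K \<bullet> y = (reciprocal_basis *v (\<chi> i. of_int (n i))) \<bullet> y" for y
    proof -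
      have "coords y = (\<Sum>i\<in>UNIV. coords y $ i *\<^sub>R axis i 1)"
        using basis_expansion[of "coords y"] by (simp add: scalar_mult_eq_scaleR)
      then have "basis *v coords y = basis *v (\<Sum>i\<in>UNIV. coords y $ i *\<^sub>R axis i 1)" by simp
      also have "\<dots> = (\<Sum>i\<in>UNIV. coords y $ i *\<^sub>R (basis *v axis i 1))"
        by (simp only: linear_sum[OF matrix_vector_mul_linear] matrix_vector_mult_scaleR)
      finally have eq: "basis *v coords y = (\<Sum>i\<in>UNIV. coords y $ i *\<^sub>R (basis *v axis i 1))" .
      have "K \<bullet> (basis *v coords y) = (\<Sum>i\<in>UNIV. coords y $ i * (K \<bullet> (basis *v axis i 1)))"
        unfolding eq inner_sum_right by simp
      moreover have "(reciprocal_basis *v (\<chi> i. of_int (n i))) \<bullet> y =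
          (\<Sum>i\<in>UNIV. coords y $ i * (2 * pi * of_int (n i)))"
        unfolding reciprocal_basis_inner unfolding inner_vec_def
        by (simp add: sum_distrib_left mult.commute mult.left_commute)
      ultimately show ?thesis by (simp only: n basis_coords(1))
    qed
    then have "K = reciprocal_basis *v (\<chi> i. of_int (n i))" by (rule vector_eq_rdot[THEN iffD1, OF allI])
    then show "K \<in> range (\<lambda>n. reciprocal_basis *v (\<chi> i. of_int (n i)))" by blast
  next
    fix K assume "K \<in> range (\<lambda>n. reciprocal_basis *v (\<chi> i. of_int (n i)))"
    then obtain n :: "'d \<Rightarrow> int" where K: "K = reciprocal_basis *v (\<chi> i. of_int (n i))" by blast
    show "K \<in> reciprocal_lattice L"
      unfolding reciprocal_lattice_def
    proof (intro CollectI ballI)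
      fix R assume "R \<in> L"
      then have "(\<Sum>i\<in>UNIV. of_int (n i) * coords R $ i) \<in> \<int>"
        by (intro Ints_sum Ints_mult) (auto simp: mem_lattice_iff)
      then obtain m :: int where "(\<Sum>i\<in>UNIV. of_int (n i) * coords R $ i) = of_int m" by (auto elim: Ints_cases)
      then have "(\<chi> i. of_int (n i)) \<bullet> coords R = of_int m" by (simp add: inner_vec_def)
      then show "\<exists>n::int. K \<bullet> R = 2 * pi * of_int n"
        by (auto simp: K reciprocal_basis_inner)
    qed
  qed
qed

lemma reciprocal_basis_axis: "reciprocal_basis *v axis i 1 \<in> reciprocal_lattice L"
  unfolding reciprocal_lattice_def
proof (intro CollectI ballI)
  fix R assume "R \<in> L"
  then have "coords R $ i \<in> \<int>" by (simp add: mem_lattice_iff)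
  then obtain m :: int where "coords R $ i = of_int m" by (auto elim: Ints_cases)
  then show "\<exists>n::int. (reciprocal_basis *v axis i 1) \<bullet> R = 2 * pi * of_int n"
    by (auto simp: reciprocal_basis_inner inner_axis')
qed

lemma mem_lattice_if_reciprocal:
  assumes "\<And>K. K \<in> reciprocal_lattice L \<Longrightarrow> \<exists>n::int. K \<bullet> R = 2 * pi * of_int n"
  shows "R \<in> L"
  unfolding mem_lattice_iff
proof
  fix i
  show "coords R $ i \<in> \<int>"
    using assms[OF reciprocal_basis_axis[of i]] by (auto simp: reciprocal_basis_inner inner_axis')
qed

text \<open>
  Lattice-periodic functions factor through the compact torus \<open>(S\<^sup>1)\<^sup>d\<close>, where the theorem of
  Stone and Weierstrass applies.
\<close>

definition torus_embedding :: "real^'d \<Rightarrow> complex^'d" where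
  "torus_embedding k = (\<chi> i. cis (2 * pi * coords k $ i))"

lemma torus_embedding_eq_iff: "torus_embedding k = torus_embedding k' \<longleftrightarrow> k - k' \<in> L"
proof
  assume eq: "torus_embedding k = torus_embedding k'"
  show "k - k' \<in> L"
    unfolding mem_lattice_iff coords_diff vector_minus_component
  proof
    fix i
    have "torus_embedding k $ i = torus_embedding k' $ i" using eq by simp
    then show "coords k $ i - coords k' $ i \<in> \<int>"
      unfolding torus_embedding_def vec_lambda_beta by (rule cis_2pi_eq_imp_diff_Ints)
  qed
next
  assume d: "k - k' \<in> L"
  have "cis (2 * pi * coords k $ i) = cis (2 * pi * coords k' $ i)" for i
  proof -
    have "coords k $ i - coords k' $ i \<in> \<int>" using d by (simp add: mem_lattice_iff coords_diff)
    then have "cis (2 * pi * (coords k $ i - coords k' $ i)) = 1" by (rule cis_multiple_2pi)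
    then have "cis (2 * pi * (coords k $ i - coords k' $ i)) * cis (2 * pi * coords k' $ i) = cis (2 * pi * coords k' $ i)"
      by simp
    then show ?thesis by (simp add: cis_mult algebra_simps)
  qed
  then show "torus_embedding k = torus_embedding k'" by (simp add: torus_embedding_def)
qed

lemma continuous_torus_embedding: "continuous_on S torus_embedding"
  unfolding torus_embedding_def[abs_def] coords_def
  by (intro continuous_on_vec_lambda continuous_intros
      matrix_vector_mult_linear_continuous_on continuous_on_component)

text \<open>The half-open cell is not compact; the image of the closed unit cube under the basis
  takes its place in compactness arguments.\<close>

lemma compact_cell_cover:
  obtains S where "compact S" "unit_cell L \<subseteq> S"
proof
  show "compact ((*v) basis ` cbox 0 1)"
    by (intro compact_continuous_image matrix_vector_mult_linear_continuous_on compact_cbox)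
  show "unit_cell L \<subseteq> (*v) basis ` cbox 0 1"
  proof
    fix r assume "r \<in> unit_cell L"
    then have "coords r \<in> cbox 0 1"
      by (auto simp: mem_cell_iff mem_box_cart less_imp_le)
    then show "r \<in> (*v) basis ` cbox 0 1" by (intro image_eqI[of _ _ "coords r"]) auto
  qed
qed

text \<open>Polynomial functions are generated by linear functionals. A real-linear functional of
  the embedding is a combination of sines and cosines of the lattice coordinates, and those are
  analytic.\<close>

lemma real_polynomial_torus_analytic:
  fixes g :: "complex^'d \<Rightarrow> real"
  assumes "real_polynomial_function g"
  shows "analytic_near k0 (\<lambda>k. of_real (g (torus_embedding k)))"
  using assms
proof (induction g rule: real_polynomial_function.induct)
  case (linear f)
  interpret bounded_linear f by fact
  have fE: "f (torus_embedding k) = (\<Sum>i\<in>UNIV. cos (2 * pi * coords k $ i) * f (axis i 1) +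
      sin (2 * pi * coords k $ i) * f (axis i \<i>))" for k
  proof -
    have "torus_embedding k = (\<Sum>i\<in>UNIV. cos (2 * pi * coords k $ i) *\<^sub>R axis i 1 +
        sin (2 * pi * coords k $ i) *\<^sub>R axis i \<i>)"
      unfolding vec_eq_iff sum_component
    proof
      fix j
      have "(\<Sum>i\<in>UNIV. (cos (2 * pi * coords k $ i) *\<^sub>R axis i 1 + sin (2 * pi * coords k $ i) *\<^sub>R axis i \<i>) $ j) =
          (\<Sum>i\<in>UNIV. if i = j then cis (2 * pi * coords k $ i) else 0)"
        by (intro sum.cong) (auto simp: axis_def complex_eq_iff)
      then show "torus_embedding k $ j =
          (\<Sum>i\<in>UNIV. (cos (2 * pi * coords k $ i) *\<^sub>R axis i 1 + sin (2 * pi * coords k $ i) *\<^sub>R axis i \<i>) $ j)"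
        by (simp add: torus_embedding_def)
    qed
    then show ?thesis by (simp add: sum add scaleR)
  qed
  have lin: "analytic_near k0 (\<lambda>k. of_real (2 * pi) * of_real (coords k $ i))" for i
    unfolding coords_def by (intro analytic_near_mult analytic_near_const linear_coordinate_analytic)
  have c: "analytic_near k0 (\<lambda>k. of_real (cos (2 * pi * coords k $ i)))"
    and s: "analytic_near k0 (\<lambda>k. of_real (sin (2 * pi * coords k $ i)))" for i
    using analytic_near_compose[OF lin[of i], of cos] analytic_near_compose[OF lin[of i], of sin]
    by (simp_all add: cos_of_real[symmetric] sin_of_real[symmetric] analytic_on_cos analytic_on_sin)
  show ?case
    unfolding fE of_real_sum of_real_add of_real_mult
    by (intro analytic_near_sum analytic_near_add analytic_near_mult analytic_near_const c s) auto
qed (auto intro: analytic_near_const analytic_near_add analytic_near_mult)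

text \<open>A continuous map from a compact set onto its image in a Hausdorff space is a quotient
  map. Hence a continuous periodic function descends to a continuous function on the embedded torus,
  is approximated there by a polynomial, and the polynomial is pulled back.\<close>

lemma periodic_analytic_approximation:
  fixes c :: "real^'d \<Rightarrow> complex"
  assumes cont: "continuous_on UNIV c" and per: "\<And>k K. K \<in> L \<Longrightarrow> c (k + K) = c k" and \<epsilon>: "\<epsilon> > 0"
  obtains t where "\<And>k. norm (t k - c k) < \<epsilon>" "\<And>k K. K \<in> L \<Longrightarrow> t (k + K) = t k"
    "\<And>k0. analytic_near k0 t"
proof -
  obtain S where S: "compact S" "unit_cell L \<subseteq> S" using compact_cell_cover .
  let ?E = torus_embedding
  have rep: "cell_rep k \<in> S" "?E (cell_rep k) = ?E k" for k
    using S(2) cell_rep_in lattice_minus[OF diff_cell_rep[of k]] by (auto simp: torus_embedding_eq_iff)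
  \<comment> \<open>Two preimages of a point of the torus differ by a lattice vector, so periodicity
    of \<open>c\<close> makes the chosen preimage immaterial.\<close>
  define c' where "c' z = c (SOME k. ?E k = z)" for z
  have c': "c' (?E k) = c k" for k
  proof -
    have "?E (SOME k'. ?E k' = ?E k) = ?E k" by (rule someI) simp
    then have "(SOME k'. ?E k' = ?E k) - k \<in> L" by (simp add: torus_embedding_eq_iff)
    from per[OF this, of k] show ?thesis by (simp add: c'_def)
  qed
  have "continuous_on (?E ` S) c'"
    unfolding continuous_openin_preimage_eq
  proof (intro allI impI)
    fix V :: "complex set" assume V: "open V"
    have "S \<inter> ?E -` (?E ` S \<inter> c' -` V) = S \<inter> c -` V"
    proof (intro equalityI subsetI)
      fix x assume "x \<in> S \<inter> ?E -` (?E ` S \<inter> c' -` V)"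
      then have "x \<in> S" "c' (?E x) \<in> V" by simp_all
      then show "x \<in> S \<inter> c -` V" by (simp add: c')
    next
      fix x assume x: "x \<in> S \<inter> c -` V"
      then have "c' (?E x) \<in> V" "?E x \<in> ?E ` S" by (simp_all add: c')
      then show "x \<in> S \<inter> ?E -` (?E ` S \<inter> c' -` V)" using x by simp
    qed
    moreover have "openin (top_of_set S) (S \<inter> c -` V)"
      using continuous_on_subset[OF cont] V by (auto simp: continuous_openin_preimage_eq)
    ultimately have "openin (top_of_set S) (S \<inter> ?E -` (?E ` S \<inter> c' -` V))" by simp
    then show "openin (top_of_set (?E ` S)) (?E ` S \<inter> c' -` V)"
      using Abstract_Topology_2.continuous_imp_quotient_map[OF continuous_torus_embedding refl S(1)] by blast
  qed
  moreover have "compact (?E ` S)" by (intro compact_continuous_image continuous_torus_embedding S)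
  ultimately obtain g where g: "polynomial_function g" "\<And>z. z \<in> ?E ` S \<Longrightarrow> norm (c' z - g z) < \<epsilon>"
    using Stone_Weierstrass_polynomial_function[of "?E ` S" c' \<epsilon>] \<epsilon> by blast
  have "real_polynomial_function (\<lambda>z. Re (g z))" "real_polynomial_function (\<lambda>z. Im (g z))"
    using g(1) bounded_linear_Re bounded_linear_Im unfolding polynomial_function_def o_def by blast+
  from this[THEN real_polynomial_torus_analytic]
  have "analytic_near k0 (\<lambda>k. of_real (Re (g (?E k))) + \<i> * of_real (Im (g (?E k))))" for k0
    by (intro analytic_near_add analytic_near_mult analytic_near_const)
  then have an: "analytic_near k0 (\<lambda>k. g (?E k))" for k0 by (simp add: complex_eq[symmetric])
  show ?thesis
  proof
    show "norm (g (?E k) - c k) < \<epsilon>" for k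
    proof -
      have "?E k \<in> ?E ` S" using rep[of k] by (metis image_eqI)
      from g(2)[OF this] show ?thesis by (simp add: c' norm_minus_commute)
    qed
    show "g (?E (k + K)) = g (?E k)" if "K \<in> L" for k K
    proof -
      have "?E (k + K) = ?E k" using that by (simp add: torus_embedding_eq_iff)
      then show ?thesis by simp
    qed
  qed (rule an)
qed

end

section \<open>Analytic gauges\<close>

lemma herm_inner_smult_left: "herm_inner (c *s u) v = cnj c * herm_inner u v"
  by (subst (1 2) herm_inner_cnj) (simp add: herm_inner_smult_right)

lemma measurable_cis_inner [measurable]: "(\<lambda>r. cis (k \<bullet> r)) \<in> borel_measurable borel"
  "(\<lambda>r. cis (- (k \<bullet> r))) \<in> borel_measurable borel"
  by (intro borel_measurable_continuous_onI continuous_intros)+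

locale analytic_band = full_lattice L for L :: "(real^'d) set" +
  fixes B :: "real^'d \<Rightarrow> (real^'d \<Rightarrow> complex^'m) set"
  assumes band_line: "\<And>k. \<exists>\<phi>. bloch_function L k \<phi> \<and> cell_norm L \<phi> = 1 \<and> B k = ae_span \<phi>"
    and analytic: "analytic_projection L B"
begin

lemma bloch_torus:
  assumes "bloch_function L k \<phi>"
  shows "(\<lambda>r. cis (- (k \<bullet> r)) *s \<phi> r) \<in> torus_L2 L"
  unfolding torus_L2_iff
proof (intro conjI allI impI ballI)
  have \<phi>: "\<phi> \<in> borel_measurable borel" "compact S \<Longrightarrow> square_integrable_on S \<phi>" for S
    using assms by (auto simp: bloch_function_def locally_square_integrable_def square_integrable_on_def)
  show m: "(\<lambda>r. cis (- (k \<bullet> r)) *s \<phi> r) \<in> borel_measurable borel"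
    by (intro measurable_vec_smult measurable_cis_inner \<phi>)
  show "square_integrable_on S (\<lambda>r. cis (- (k \<bullet> r)) *s \<phi> r)" if "compact S" for S
    by (rule square_integrable_on_bound[OF \<phi>(2)[OF that] m, where b = 1])
      (use that in \<open>auto simp: borel_compact\<close>)
  fix R assume "R \<in> L"
  then have "AE r in lborel. \<phi> (r + R) = cis (k \<bullet> R) *s \<phi> r"
    using assms by (auto simp: bloch_function_def)
  then show "AE r in lborel. cis (- (k \<bullet> (r + R))) *s \<phi> (r + R) = cis (- (k \<bullet> r)) *s \<phi> r"
    by eventually_elim (simp add: vector_smult_assoc cis_mult inner_add_right)
qed

section \<open>Normalized choices and their phase freedom\<close>

lemma choice_measurable:
  assumes "band_choice L B \<psi>"
  shows "\<psi> k \<in> borel_measurable borel"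
proof -
  obtain \<phi> where "B k = ae_span \<phi>" using band_line by blast
  moreover have "\<psi> k \<in> B k" using assms by (auto simp: band_choice_def)
  ultimately show ?thesis by (simp add: ae_span_def)
qed

lemma choice_phase:
  assumes "band_choice L B \<psi>" "bloch_function L k \<phi>" "cell_norm L \<phi> = 1" "B k = ae_span \<phi>"
  obtains c where "norm c = 1" "AE r in lborel. \<psi> k r = c *s \<phi> r"
proof -
  have "\<psi> k \<in> ae_span \<phi>" "N (\<psi> k) = 1" using assms by (auto simp: band_choice_def)
  then obtain c where c: "AE r in lborel. \<psi> k r = c *s \<phi> r" and m: "\<psi> k \<in> borel_measurable borel"
    by (auto simp: ae_span_def)
  have "\<phi> \<in> borel_measurable borel" using assms(2) by (auto simp: bloch_function_def locally_square_integrable_def)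
  then have "N (\<psi> k) = N (\<lambda>r. c *s \<phi> r)"
    using c m by (intro cell_norm_cong_AE measurable_vec_smult) auto
  then have "norm c = 1" using \<open>N (\<psi> k) = 1\<close> assms(3) by (simp add: N_smult)
  then show ?thesis using c that by blast
qed

lemma choice_torus:
  assumes "band_choice L B \<psi>"
  shows "periodic_part \<psi> k \<in> torus_L2 L"
proof -
  obtain \<phi> where \<phi>: "bloch_function L k \<phi>" "cell_norm L \<phi> = 1" "B k = ae_span \<phi>" using band_line by blast
  obtain c where c: "AE r in lborel. \<psi> k r = c *s \<phi> r" using choice_phase[OF assms \<phi>] by blast
  show ?thesis
  proof (rule torus_L2_cong_AE[OF torus_L2_smult[OF bloch_torus[OF \<phi>(1)], of c]])
    show "periodic_part \<psi> k \<in> borel_measurable borel"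
      unfolding periodic_part_def by (intro measurable_vec_smult measurable_cis_inner choice_measurable assms)
    show "AE r in lborel. periodic_part \<psi> k r = c *s (cis (- (k \<bullet> r)) *s \<phi> r)"
      using c by eventually_elim (simp add: periodic_part_def vector_smult_assoc mult.commute)
  qed
qed

lemma choice_L2: "band_choice L B \<psi> \<Longrightarrow> L2 (periodic_part \<psi> k)"
  by (rule torus_L2_L2[OF choice_torus])

lemma choice_norm: "band_choice L B \<psi> \<Longrightarrow> N (periodic_part \<psi> k) = 1"
  unfolding periodic_part_def by (subst N_unimodular) (auto simp: band_choice_def)

lemma choice_inner_self: "band_choice L B \<psi> \<Longrightarrow> H (periodic_part \<psi> k) (periodic_part \<psi> k) = 1"
  by (simp add: cell_inner_self choice_norm)

lemma choice_unique:
  assumes "band_choice L B \<psi>" "band_choice L B \<psi>'"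
  obtains c where "norm c = 1" "AE r in lborel. periodic_part \<psi>' k r = c *s periodic_part \<psi> k r"
proof -
  obtain \<phi> where \<phi>: "bloch_function L k \<phi>" "cell_norm L \<phi> = 1" "B k = ae_span \<phi>" using band_line by blast
  obtain a where a: "norm a = 1" "AE r in lborel. \<psi> k r = a *s \<phi> r" using choice_phase[OF assms(1) \<phi>] .
  obtain b where b: "norm b = 1" "AE r in lborel. \<psi>' k r = b *s \<phi> r" using choice_phase[OF assms(2) \<phi>] .
  have a0: "a \<noteq> 0" using a(1) by auto
  show ?thesis
  proof
    show "norm (b / a) = 1" using a b by (simp add: norm_divide)
    show "AE r in lborel. periodic_part \<psi>' k r = (b / a) *s periodic_part \<psi> k r"
      using a(2) b(2) by eventually_elim (simp add: periodic_part_def vector_smult_assoc a0 mult.commute)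
  qed
qed

lemma choice_smult:
  assumes "band_choice L B \<psi>" "\<And>k. norm (c k) = 1"
  shows "band_choice L B (\<lambda>k r. c k *s \<psi> k r)"
  unfolding band_choice_def
proof (intro allI conjI)
  fix k
  obtain \<phi> where \<phi>: "bloch_function L k \<phi>" "cell_norm L \<phi> = 1" "B k = ae_span \<phi>" using band_line by blast
  obtain a where a: "AE r in lborel. \<psi> k r = a *s \<phi> r" using choice_phase[OF assms(1) \<phi>] by blast
  have "AE r in lborel. c k *s \<psi> k r = (c k * a) *s \<phi> r"
    using a by eventually_elim (simp add: vector_smult_assoc)
  then show "(\<lambda>r. c k *s \<psi> k r) \<in> B k"
    unfolding \<phi>(3) ae_span_def
    using measurable_vec_smult[OF _ choice_measurable[OF assms(1)], of "\<lambda>_. c k"] by auto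
  show "N (\<lambda>r. c k *s \<psi> k r) = 1" using assms by (simp add: N_smult band_choice_def)
qed

lemma periodic_part_smult: "periodic_part (\<lambda>k r. c k *s \<psi> k r) k = (\<lambda>r. c k *s periodic_part \<psi> k r)"
  by (simp add: periodic_part_def vector_smult_assoc mult.commute)

section \<open>The band projection as an analytic family of operators\<close>

definition proj :: "real^'d \<Rightarrow> (real^'d \<Rightarrow> complex^'m) \<Rightarrow> real^'d \<Rightarrow> complex^'m" where
  "proj k f = (\<lambda>r. cis (- (k \<bullet> r)) *s line_projection L (B k) (\<lambda>x. cis (k \<bullet> x) *s f x) r)"

text \<open>This is the choice term hidden inside \<open>line_projection\<close>. With it
  \<open>proj\<close> is a rank-one operator by pure computation, and other choices are compared
  with it afterwards.\<close>

definition canonical_choice :: "real^'d \<Rightarrow> real^'d \<Rightarrow> complex^'m" where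
  "canonical_choice k = (SOME \<psi>. \<psi> \<in> B k \<and> cell_norm L \<psi> = 1)"

lemma canonical_choice: "band_choice L B canonical_choice"
  unfolding band_choice_def
proof
  fix k
  obtain \<phi> where \<phi>: "bloch_function L k \<phi>" "cell_norm L \<phi> = 1" "B k = ae_span \<phi>" using band_line by blast
  then have "\<phi> \<in> B k"
    by (auto simp: ae_span_def bloch_function_def locally_square_integrable_def intro!: exI[of _ 1])
  with \<phi>(2) show "canonical_choice k \<in> B k \<and> cell_norm L (canonical_choice k) = 1"
    unfolding canonical_choice_def by (intro someI[of "\<lambda>\<psi>. \<psi> \<in> B k \<and> cell_norm L \<psi> = 1"]) simp
qed

lemma proj_canonical:
  "proj k f = (\<lambda>r. H (periodic_part canonical_choice k) f *s periodic_part canonical_choice k r)"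
proof -
  have "H (canonical_choice k) (\<lambda>x. cis (k \<bullet> x) *s f x) = H (periodic_part canonical_choice k) f"
    by (simp add: cell_inner_def periodic_part_def herm_inner_smult_left herm_inner_smult_right cis_cnj)
  then show ?thesis
    by (simp add: proj_def line_projection_def Let_def canonical_choice_def[symmetric] periodic_part_def
        vector_smult_assoc mult.commute)
qed

text \<open>Replacing the unit vector by a multiple with phase \<open>c\<close> changes the
  projection by the factor \<open>cnj c * c = 1\<close>.\<close>

lemma proj_eq:
  assumes \<psi>: "band_choice L B \<psi>" and f: "f \<in> borel_measurable borel"
  shows "AE r in lborel. proj k f r = H (periodic_part \<psi> k) f *s periodic_part \<psi> k r"
proof -
  let ?u = "periodic_part \<psi> k"
  obtain c where c: "norm c = 1" "AE r in lborel. periodic_part canonical_choice k r = c *s ?u r"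
    using choice_unique[OF \<psi> canonical_choice] .
  have "H (periodic_part canonical_choice k) f = H (\<lambda>r. c *s ?u r) f"
    using c(2) f choice_L2[OF canonical_choice] choice_L2[OF \<psi>]
    by (intro cell_inner_cong_AE) (auto intro: L2_measurable L2_smult)
  then have e: "proj k f r = (cnj c * H ?u f) *s periodic_part canonical_choice k r" for r
    by (simp add: proj_canonical cell_inner_smult_left)
  have "AE r in lborel. proj k f r = ((cnj c * c) * H ?u f) *s ?u r"
    using c(2) by eventually_elim (simp add: e vector_smult_assoc mult.commute mult.left_commute)
  moreover have "cnj c * c = 1" using c(1) complex_norm_square[of c] by (simp add: mult.commute)
  ultimately show ?thesis by simp
qed

lemma proj_torus: "proj k f \<in> torus_L2 L"
  unfolding proj_canonical by (intro torus_L2_smult choice_torus canonical_choice)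

lemma proj_bounded: "proj k \<in> torus_bounded_ops L"
  unfolding torus_bounded_ops_def
proof (intro CollectI conjI ballI allI exI[of _ 1] proj_torus)
  let ?u = "periodic_part canonical_choice k"
  fix f g :: "real^'d \<Rightarrow> complex^'m" and a b assume f: "f \<in> torus_L2 L"
  have "N (proj k f) = norm (H ?u f)"
    by (simp add: proj_canonical N_smult choice_norm[OF canonical_choice])
  also have "\<dots> \<le> 1 * N f"
    using Cauchy_Schwarz[OF choice_L2[OF canonical_choice] torus_L2_L2[OF f], of k]
    by (simp add: choice_norm[OF canonical_choice])
  finally show "N (proj k f) \<le> 1 * N f" .
  assume g: "g \<in> torus_L2 L"
  have "H ?u (\<lambda>x. a *s f x + b *s g x) = a * H ?u f + b * H ?u g"
    by (subst cell_inner_add_right)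
      (auto intro: choice_L2[OF canonical_choice] L2_smult torus_L2_L2 f g simp: cell_inner_smult_right)
  then show "AE r in lborel. proj k (\<lambda>x. a *s f x + b *s g x) r = a *s proj k f r + b *s proj k g r"
    by (simp add: proj_canonical vector_smult_assoc vector_sadd_rdistrib)
qed

lemma proj_analytic: "real_analytic_wrt (torus_bounded_ops L) opN proj"
  using analytic unfolding analytic_projection_def proj_def[abs_def] .

text \<open>The left-hand side does not depend on the gauge, so products of two overlaps are
  analytic although a single overlap need not be. All analyticity of gauges is extracted from such
  products.\<close>

lemma inner_proj:
  assumes \<psi>: "band_choice L B \<psi>" and f: "L2 f" and g: "g \<in> borel_measurable borel"
  shows "H f (proj k g) = H (periodic_part \<psi> k) g * H f (periodic_part \<psi> k)"
proof -
  have "H f (proj k g) = H f (\<lambda>r. H (periodic_part \<psi> k) g *s periodic_part \<psi> k r)"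
    by (intro cell_inner_cong_AE L2_measurable f L2_smult choice_L2 \<psi> proj_eq g
        torus_L2_measurable[OF proj_torus]) auto
  then show ?thesis by (simp add: cell_inner_smult_right)
qed

section \<open>Gauges characterized by analytic overlaps\<close>

definition analytic_gauge :: "(real^'d \<Rightarrow> real^'d \<Rightarrow> complex^'m) \<Rightarrow> bool" where
  "analytic_gauge \<psi> \<longleftrightarrow> band_choice L B \<psi> \<and>
     (\<forall>k0. analytic_near k0 (\<lambda>k. H (periodic_part \<psi> k0) (periodic_part \<psi> k)))"

lemma analytic_gauge_vector_analytic:
  assumes "analytic_gauge \<psi>"
  shows "vector_analytic k0 (periodic_part \<psi>)"
proof -
  let ?u = "periodic_part \<psi>"
  have \<psi>: "band_choice L B \<psi>" and h: "analytic_near k0 (\<lambda>k. H (?u k0) (?u k))"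
    using assms by (auto simp: analytic_gauge_def)
  let ?h = "\<lambda>k. cnj (H (?u k0) (?u k))"
  have h': "analytic_near k0 ?h" by (rule analytic_near_cnj[OF h])
  have h1: "?h k0 = 1" by (simp add: choice_inner_self[OF \<psi>])
  have "analytic_near k0 (\<lambda>k. inverse (?h k))"
    by (rule analytic_near_compose[OF h', of inverse]) (use h1 in \<open>auto intro!: analytic_on_inverse\<close>)
  moreover have "vector_analytic k0 (\<lambda>k. proj k (?u k0))"
    by (rule operator_analytic_apply(2)[OF proj_analytic proj_bounded cell_phase_analytic L2_zero])
      (use choice_torus[OF \<psi>] torus_L2_zero in auto)
  ultimately have va: "vector_analytic k0 (\<lambda>k r. inverse (?h k) *s proj k (?u k0) r)"
    by (rule vector_analytic_smult)
  have "(?h \<longlongrightarrow> 1) (nhds k0)"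
    using analytic_near_isCont[OF h'] h1 by (metis isCont_def tendsto_at_iff_tendsto_nhds)
  then have ev: "eventually (\<lambda>k. ?h k \<noteq> 0) (nhds k0)"
    by (rule tendsto_imp_eventually_ne) simp
  show ?thesis
  proof (rule vector_analytic_cong[OF va])
    show "\<forall>\<^sub>F k in nhds k0. ?u k \<in> borel_measurable borel \<and>
        (AE r in lborel. ?u k r = inverse (?h k) *s proj k (?u k0) r)"
      using ev
    proof eventually_elim
      case (elim k)
      have "AE r in lborel. proj k (?u k0) r = H (?u k) (?u k0) *s ?u k r"
        by (intro proj_eq \<psi> L2_measurable choice_L2)
      moreover have "H (?u k) (?u k0) = ?h k" by (rule cell_inner_cnj)
      ultimately have "AE r in lborel. ?u k r = inverse (?h k) *s proj k (?u k0) r"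
        using elim by (auto simp: vector_smult_assoc)
      then show ?case using L2_measurable[OF choice_L2[OF \<psi>]] by blast
    qed
  qed
qed

lemma analytic_gauge_imp_analytic_choice:
  "analytic_gauge \<psi> \<Longrightarrow> analytic_choice L \<psi>"
  unfolding analytic_choice_def
  by (rule vector_analytic_imp_real_analytic) (rule analytic_gauge_vector_analytic)

text \<open>For unit vectors the squared distance is \<open>2 - 2 * Re\<close> of the overlap, so
  continuity in norm follows from continuity of one scalar function.\<close>

lemma analytic_choice_imp_continuous:
  assumes \<psi>: "band_choice L B \<psi>" and an: "analytic_choice L \<psi>"
  shows "continuous_choice L \<psi>"
  unfolding continuous_choice_def
proof
  fix k0
  let ?u = "periodic_part \<psi>" and ?h = "\<lambda>k. H (periodic_part \<psi> k0) (periodic_part \<psi> k)"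
  have "vector_analytic k0 ?u"
    using an unfolding analytic_choice_def
    by (rule real_analytic_imp_vector_analytic) (rule choice_torus[OF \<psi>])
  then have "isCont ?h k0"
    by (intro analytic_near_isCont vector_analytic_inner choice_L2 \<psi>)
  then have "((\<lambda>k. 2 - 2 * Re (?h k)) \<longlongrightarrow> 2 - 2 * Re (?h k0)) (at k0)"
    unfolding isCont_def by (intro tendsto_intros)
  then have lim: "((\<lambda>k. 2 - 2 * Re (?h k)) \<longlongrightarrow> 0) (at k0)"
    by (simp add: choice_inner_self[OF \<psi>])
  have "(N (?u k - ?u k0))\<^sup>2 = 2 - 2 * Re (?h k)" for k
  proof -
    have "?u k - ?u k0 = (\<lambda>r. ?u k r + (-1) *s ?u k0 r)" by (simp add: fun_eq_iff)
    moreover have "H (?u k) (?u k0) = cnj (?h k)" by (rule cell_inner_cnj)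
    ultimately show ?thesis
      using N_square_add[OF choice_L2[OF \<psi>, of k] L2_smult[OF choice_L2[OF \<psi>, of k0], of "-1"]]
        cell_inner_smult_right[of "?u k" "-1" "?u k0"] N_smult[of "-1" "?u k0"]
      by (simp add: choice_norm[OF \<psi>])
  qed
  then have "N (?u k - ?u k0) = sqrt (2 - 2 * Re (?h k))" for k
    using real_sqrt_unique[OF _ N_nonneg] by metis
  then show "((\<lambda>k. N (?u k - ?u k0)) \<longlongrightarrow> 0) (at k0)"
    using tendsto_real_sqrt[OF lim] by simp
qed

end

subsection \<open>From continuous to analytic gauges\<close>

context analytic_band
begin

lemma N_cell_phase: "N (cell_phase k f) = N f"
  unfolding cell_phase_def by (rule N_unimodular) simp

text \<open>\<open>r\<close> and \<open>cell_rep r\<close> differ by a lattice vector, on which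
  \<open>K\<close> is a multiple of \<open>2 * pi\<close>; in the extra factor
  \<open>cell_rep r\<close> may thus be replaced by \<open>r\<close>.\<close>

lemma cell_phase_reciprocal:
  assumes K: "K \<in> reciprocal_lattice L"
  shows "cell_phase (k + K) f r = cis (- (K \<bullet> r)) *s cell_phase k f r"
proof -
  have "cis (K \<bullet> (r - cell_rep r)) = 1"
    by (rule reciprocal_lattice_inner[OF K diff_cell_rep])
  then have "cis (- (K \<bullet> r)) * cis (K \<bullet> (r - cell_rep r)) = cis (- (K \<bullet> r))" by simp
  then have "cis (- (K \<bullet> cell_rep r)) = cis (- (K \<bullet> r))"
    by (simp add: cis_mult inner_diff_right)
  moreover have "cis (- ((k + K) \<bullet> cell_rep r)) = cis (- (K \<bullet> cell_rep r)) * cis (- (k \<bullet> cell_rep r))"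
    by (simp add: cis_mult inner_add_left) (rule arg_cong[where f = cis], linarith)
  ultimately have "cis (- ((k + K) \<bullet> cell_rep r)) = cis (- (K \<bullet> r)) * cis (- (k \<bullet> cell_rep r))"
    by simp
  then show ?thesis by (simp add: cell_phase_def vector_smult_assoc)
qed

lemma periodic_choice_reciprocal:
  assumes "periodic_choice L \<psi>" "K \<in> reciprocal_lattice L"
  shows "AE r in lborel. periodic_part \<psi> (k + K) r = cis (- (K \<bullet> r)) *s periodic_part \<psi> k r"
proof -
  have "AE r in lborel. \<psi> (k + K) r = \<psi> k r"
    using assms by (simp add: periodic_choice_def)
  then show ?thesis
    by eventually_elim (simp add: periodic_part_def inner_add_left cis_mult add.commute vector_smult_assoc)
qed

lemma cell_inner_unimodular:
  assumes "\<And>r. norm (c r) = 1"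
  shows "H (\<lambda>r. c r *s f r) (\<lambda>r. c r *s g r) = H f g"
proof -
  have "c r * cnj (c r) = 1" for r
    using assms complex_norm_square[of "c r"] by simp
  then show ?thesis
    by (simp add: cell_inner_def herm_inner_smult_left herm_inner_smult_right mult.assoc[symmetric])
qed

text \<open>Both arguments acquire the same unimodular factor \<open>exp (- i K r)\<close>, which
  the inner product cancels. This is the purpose of \<open>cell_phase\<close>.\<close>

lemma overlap_periodic:
  assumes \<psi>: "band_choice L B \<psi>" and per: "periodic_choice L \<psi>" and f: "f \<in> torus_L2 L"
    and K: "K \<in> reciprocal_lattice L"
  shows "H (periodic_part \<psi> (k + K)) (cell_phase (k + K) f) = H (periodic_part \<psi> k) (cell_phase k f)"
proof -
  have "H (periodic_part \<psi> (k + K)) (cell_phase (k + K) f) =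
      H (\<lambda>r. cis (- (K \<bullet> r)) *s periodic_part \<psi> k r) (\<lambda>r. cis (- (K \<bullet> r)) *s cell_phase k f r)"
    by (rule cell_inner_cong_AE)
      (auto intro!: L2_measurable[OF choice_L2[OF \<psi>]] torus_L2_measurable[OF cell_phase_torus[OF f]]
        measurable_vec_smult measurable_cis_inner periodic_choice_reciprocal per K
        simp: cell_phase_reciprocal[OF K])
  also have "\<dots> = H (periodic_part \<psi> k) (cell_phase k f)"
    by (rule cell_inner_unimodular) simp
  finally show ?thesis .
qed

text \<open>Both arguments move with \<open>k\<close>. The change of the first costs at most its
  seminorm distance times \<open>N f\<close>; the second is then tested against the fixed vector at
  \<open>k0\<close>, where its weak analyticity suffices.\<close>

lemma overlap_continuous:
  assumes \<psi>: "band_choice L B \<psi>" and cont: "continuous_choice L \<psi>" and f: "f \<in> torus_L2 L"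
  shows "continuous_on UNIV (\<lambda>k. H (periodic_part \<psi> k) (cell_phase k f))"
proof (rule continuous_at_imp_continuous_on, rule ballI)
  fix k0
  let ?u = "periodic_part \<psi>" and ?M = "\<lambda>k. cell_phase k f"
  note u = choice_L2[OF \<psi>]
  have M: "L2 (?M k)" for k by (intro torus_L2_L2 cell_phase_torus f)
  have lim1: "((\<lambda>k. N (?u k - ?u k0) * N f) \<longlongrightarrow> 0) (at k0)"
    using cont unfolding continuous_choice_def by (intro tendsto_mult_left_zero) simp
  have "isCont (\<lambda>k. H (?u k0) (?M k)) k0"
    by (rule analytic_near_isCont[OF vector_analytic_inner[OF cell_phase_analytic[OF f] u]])
  then have lim2: "((\<lambda>k. H (?u k0) (?M k)) \<longlongrightarrow> H (?u k0) (?M k0)) (at k0)"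
    by (simp add: isCont_def)
  have "((\<lambda>k. H (?u k - ?u k0) (?M k)) \<longlongrightarrow> 0) (at k0)"
  proof (rule tendsto_norm_zero_cancel, rule tendsto_sandwich[OF _ _ tendsto_const lim1])
    have "norm (H (?u k - ?u k0) (?M k)) \<le> N (?u k - ?u k0) * N f" for k
    proof -
      have "L2 (?u k - ?u k0)" using L2_diff[OF u[of k] u[of k0]] by (simp add: fun_diff_def)
      from Cauchy_Schwarz[OF this M[of k]] show ?thesis by (simp add: N_cell_phase)
    qed
    then show "\<forall>\<^sub>F k in at k0. norm (H (?u k - ?u k0) (?M k)) \<le> N (?u k - ?u k0) * N f" by simp
  qed simp
  from tendsto_add[OF this lim2]
  have "((\<lambda>k. H (?u k - ?u k0) (?M k) + H (?u k0) (?M k)) \<longlongrightarrow> H (?u k0) (?M k0)) (at k0)" by simp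
  moreover have "H (?u k - ?u k0) (?M k) + H (?u k0) (?M k) = H (?u k) (?M k)" for k
    using cell_inner_diff_left[OF M[of k] u[of k] u[of k0]] by (simp add: fun_diff_def)
  ultimately show "isCont (\<lambda>k. H (?u k) (?M k)) k0" by (simp add: isCont_def)
qed

text \<open>
  The new gauge is the normalization of \<open>\<eta> \<psi>\<close>, where \<open>\<eta> k \<psi> k = P(k) (\<Sum>q. t\<^sub>q(k) f\<^sub>q)\<close>
  for finitely many trial functions \<open>f\<^sub>q\<close> on the cell and trigonometric polynomials \<open>t\<^sub>q\<close>
  that approximate the overlaps \<open>\<langle>f\<^sub>q, \<psi> k\<rangle>\<close>. Its matrix elements only involve the projection.
\<close>

lemma continuous_imp_analytic_gauge:
  assumes \<psi>: "band_choice L B \<psi>" and cont: "continuous_choice L \<psi>" and per: "periodic_choice L \<psi>"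
  obtains \<psi>' where "analytic_gauge \<psi>'" "periodic_choice L \<psi>'"
proof -
  interpret RL: full_lattice "reciprocal_lattice L"
    by unfold_locales (rule full_rank_reciprocal)
  let ?u = "periodic_part \<psi>"
  \<comment> \<open>The trial function is built so that at the wavevector \<open>q\<close> its
    phased version is the band vector itself. Hence \<open>g q q = 1\<close>, and \<open>g q\<close>
    stays large near \<open>q\<close>.\<close>
  define f where "f q = cell_phase (- q) (?u q)" for q
  have fT: "f q \<in> torus_L2 L" for q unfolding f_def by (intro cell_phase_torus choice_torus \<psi>)
  have Nf: "N (f q) = 1" for q by (simp add: f_def N_cell_phase choice_norm[OF \<psi>])
  define g where "g q k = H (?u k) (cell_phase k (f q))" for q k
  have gcont: "continuous_on UNIV (g q)" for q
    unfolding g_def by (rule overlap_continuous[OF \<psi> cont fT])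
  have gper: "g q (k + K) = g q k" if "K \<in> reciprocal_lattice L" for q k K
    unfolding g_def by (rule overlap_periodic[OF \<psi> per fT that])
  have gle: "norm (g q k) \<le> 1" for q k
    using Cauchy_Schwarz[OF choice_L2[OF \<psi>] torus_L2_L2[OF cell_phase_torus[OF fT]], of k k q]
    by (simp add: g_def N_cell_phase Nf choice_norm[OF \<psi>])
  have "cell_phase q (f q) = ?u q" for q
    by (auto simp: f_def cell_phase_def vector_smult_assoc cis_mult)
  then have gqq: "g q q = 1" for q by (simp add: g_def choice_inner_self[OF \<psi>])
  obtain S where S: "compact S" "unit_cell (reciprocal_lattice L) \<subseteq> S" using RL.compact_cell_cover .
  define U where "U q = {k. norm (g q k) > 1 / 2}" for q
  have "open (U q)" for q
    unfolding U_def by (intro open_Collect_less continuous_intros gcont)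
  moreover have "S \<subseteq> (\<Union>q\<in>S. U q)" using gqq by (auto simp: U_def)
  ultimately obtain Q where Q: "finite Q" "S \<subseteq> (\<Union>q\<in>Q. U q)"
    using compactE_image[OF S(1), of S U] by metis
  define n where "n = real (card Q)"
  \<comment> \<open>The approximation errors of the \<open>n\<close> summands of
    \<open>\<eta>\<close> then add up to less than \<open>1/4\<close>, a lower bound for the sum of
    the squares of \<open>norm (g q k)\<close>; the \<open>1\<close> covers an empty cover.\<close>
  define \<epsilon> where "\<epsilon> = 1 / (8 * (n + 1))"
  have \<epsilon>: "\<epsilon> > 0" by (simp add: \<epsilon>_def n_def add_nonneg_pos)
  have "\<exists>t. (\<forall>k. norm (t k - cnj (g q k)) < \<epsilon>) \<and> (\<forall>k. \<forall>K\<in>reciprocal_lattice L. t (k + K) = t k) \<and>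
      (\<forall>k0. analytic_near k0 t)" for q
    by (rule RL.periodic_analytic_approximation[of "\<lambda>k. cnj (g q k)", OF _ _ \<epsilon>])
      (auto intro: continuous_intros gcont simp: gper)
  then obtain t where t: "\<And>q k. norm (t q k - cnj (g q k)) < \<epsilon>"
    "\<And>q k K. K \<in> reciprocal_lattice L \<Longrightarrow> t q (k + K) = t q k" "\<And>q k0. analytic_near k0 (t q)"
    by metis
  define \<eta> where "\<eta> k = (\<Sum>q\<in>Q. t q k * g q k)" for k
  have \<eta>per: "\<eta> (k + K) = \<eta> k" if "K \<in> reciprocal_lattice L" for k K
    by (simp add: \<eta>_def gper t(2) that)
  \<comment> \<open>With the exact coefficients \<open>cnj (g q k)\<close> the sum would be the
    positive number formed by the squared overlaps. By periodicity it is enough to look at the cell,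
    where some trial function has overlap above \<open>1/2\<close>.\<close>
  have \<eta>0: "\<eta> k \<noteq> 0" for k
  proof -
    let ?k = "RL.cell_rep k"
    have eq: "\<eta> ?k = \<eta> k" using \<eta>per[OF RL.diff_cell_rep[of k], of ?k] by simp
    have "?k \<in> S" using RL.cell_rep_in S(2) by blast
    then obtain q0 where q0: "q0 \<in> Q" "norm (g q0 ?k) > 1 / 2" using Q(2) by (auto simp: U_def)
    have "1 / 4 \<le> (norm (g q0 ?k))\<^sup>2"
      using power_mono[of "1/2" "norm (g q0 ?k)" 2] q0(2) by (simp add: power2_eq_square)
    also have "\<dots> \<le> (\<Sum>q\<in>Q. (norm (g q ?k))\<^sup>2)"
      using q0(1) Q(1) by (intro member_le_sum) auto
    finally have big: "1 / 4 \<le> (\<Sum>q\<in>Q. (norm (g q ?k))\<^sup>2)" .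
    have "norm (\<eta> ?k - of_real (\<Sum>q\<in>Q. (norm (g q ?k))\<^sup>2)) \<le> (\<Sum>q\<in>Q. norm ((t q ?k - cnj (g q ?k)) * g q ?k))"
    proof -
      have "\<eta> ?k - of_real (\<Sum>q\<in>Q. (norm (g q ?k))\<^sup>2) = (\<Sum>q\<in>Q. (t q ?k - cnj (g q ?k)) * g q ?k)"
        unfolding \<eta>_def of_real_sum complex_norm_square sum_subtractf[symmetric]
        by (simp add: algebra_simps)
      then show ?thesis by (simp add: norm_sum)
    qed
    also have "\<dots> \<le> (\<Sum>q\<in>Q. \<epsilon> * 1)"
      unfolding norm_mult using t(1) gle \<epsilon> by (intro sum_mono mult_mono) (auto intro: less_imp_le)
    also have "\<dots> < 1 / 4"
      by (simp add: \<epsilon>_def n_def[symmetric]) (simp add: n_def field_simps)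
    finally have "\<bar>\<Sum>q\<in>Q. (norm (g q ?k))\<^sup>2\<bar> < 1 / 4" if "\<eta> ?k = 0"
      unfolding that by (simp only: diff_0 norm_minus_cancel norm_of_real)
    with big have "\<eta> ?k \<noteq> 0" by auto
    with eq show ?thesis by simp
  qed
  define c where "c k = \<eta> k / of_real (norm (\<eta> k))" for k
  have c1: "norm (c k) = 1" for k using \<eta>0[of k] by (simp add: c_def norm_divide)
  define \<psi>' where "\<psi>' = (\<lambda>k r. c k *s \<psi> k r)"
  have \<psi>': "band_choice L B \<psi>'" unfolding \<psi>'_def by (rule choice_smult[OF \<psi> c1])
  have u': "periodic_part \<psi>' k = (\<lambda>r. c k *s ?u k r)" for k unfolding \<psi>'_def by (rule periodic_part_smult)
  have "periodic_choice L \<psi>'"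
    unfolding periodic_choice_def
  proof (intro allI ballI)
    fix k K assume K: "K \<in> reciprocal_lattice L"
    have "AE r in lborel. \<psi> (k + K) r = \<psi> k r" using per K by (simp add: periodic_choice_def)
    then show "AE r in lborel. \<psi>' (k + K) r = \<psi>' k r"
      by eventually_elim (simp add: \<psi>'_def c_def \<eta>per[OF K])
  qed
  moreover have "analytic_gauge \<psi>'"
    unfolding analytic_gauge_def
  proof (intro conjI allI \<psi>')
    fix k0
    let ?f = "periodic_part \<psi>' k0"
    have fT': "?f \<in> torus_L2 L" and fL: "L2 ?f" by (intro choice_torus choice_L2 \<psi>')+
    \<comment> \<open>Here \<open>h k\<close> equals \<open>\<eta> k\<close> times the old overlap
      and \<open>p k\<close> is the squared modulus of that overlap. The new overlap is
      \<open>h k * sqrt (p k)\<close> divided by \<open>norm (h k)\<close>, an expression in matrix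
      elements of the projection and their conjugates alone.\<close>
    define h where "h k = (\<Sum>q\<in>Q. t q k * H ?f (proj k (cell_phase k (f q))))" for k
    define p where "p k = H ?f (proj k ?f)" for k
    have ha: "analytic_near k0 h"
      unfolding h_def
      by (intro analytic_near_sum analytic_near_mult t(3) Q(1)
          operator_analytic_apply(1)[OF proj_analytic proj_bounded cell_phase_analytic[OF fT] fL])
    have pa: "analytic_near k0 p"
      unfolding p_def
      by (intro vector_analytic_inner[OF operator_analytic_apply(2)[OF proj_analytic proj_bounded
              cell_phase_analytic[OF fT'] fL fT']] fL)
    have h_eq: "h k = \<eta> k * H ?f (?u k)" for k
      using inner_proj[OF \<psi> fL torus_L2_measurable[OF cell_phase_torus[OF fT]]]
      by (simp add: h_def \<eta>_def g_def sum_distrib_right mult.assoc)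
    have p_eq: "p k = of_real ((norm (H ?f (?u k)))\<^sup>2)" for k
      unfolding p_def complex_norm_square
      using inner_proj[OF \<psi> fL torus_L2_measurable[OF fT'], of k] cell_inner_cnj[of "?u k" ?f]
      by (simp add: mult.commute)
    have hh_eq: "h k * cnj (h k) = of_real ((norm (h k))\<^sup>2)" for k by (rule complex_norm_square[symmetric])
    have f0: "norm (H ?f (?u k0)) = 1"
    proof -
      have "H ?f (?u k0) = cnj (c k0)"
        by (simp add: u' cell_inner_smult_left choice_inner_self[OF \<psi>])
      then show ?thesis by (simp add: c1)
    qed
    then have h0: "h k0 \<noteq> 0" using \<eta>0[of k0] by (auto simp: h_eq)
    \<comment> \<open>The principal root is analytic off the nonpositive real axis, and both
      radicands are positive at \<open>k0\<close>.\<close>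
    have csq: "analytic_near k0 (\<lambda>k. csqrt (F k))" if "analytic_near k0 F" "F k0 = of_real x" "x > 0" for F x
      by (rule analytic_near_compose[OF that(1), of csqrt])
        (use that in \<open>auto intro!: analytic_on_subset[OF analytic_on_csqrt]\<close>)
    have pa': "analytic_near k0 (\<lambda>k. csqrt (p k))"
      by (rule csq[OF pa p_eq]) (simp add: f0)
    have ha': "analytic_near k0 (\<lambda>k. csqrt (h k * cnj (h k)))"
      by (rule csq[OF analytic_near_mult[OF ha analytic_near_cnj[OF ha]] hh_eq]) (simp add: h0)
    have "analytic_near k0 (\<lambda>k. inverse (csqrt (h k * cnj (h k))))"
      by (rule analytic_near_compose[OF ha', of inverse]) (use h0 in \<open>auto intro!: analytic_on_inverse simp: complex_eq_iff\<close>)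
    then have F: "analytic_near k0 (\<lambda>k. h k * csqrt (p k) * inverse (csqrt (h k * cnj (h k))))"
      by (intro analytic_near_mult ha pa')
    have "(h \<longlongrightarrow> h k0) (nhds k0)"
      using analytic_near_isCont[OF ha] by (metis isCont_def tendsto_at_iff_tendsto_nhds)
    then have "eventually (\<lambda>k. h k \<noteq> 0) (nhds k0)" using h0 by (rule tendsto_imp_eventually_ne)
    then show "analytic_near k0 (\<lambda>k. H (periodic_part \<psi>' k0) (periodic_part \<psi>' k))"
    proof (rule analytic_near_cong[OF F eventually_mono])
      fix k assume hk: "h k \<noteq> 0"
      then have a0: "norm (H ?f (?u k)) \<noteq> 0" by (auto simp: h_eq)
      have "csqrt (p k) = of_real (norm (H ?f (?u k)))"
        unfolding p_eq by (subst csqrt_of_real_nonneg) auto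
      moreover have "csqrt (h k * cnj (h k)) = of_real (norm (h k))"
        unfolding hh_eq by (subst csqrt_of_real_nonneg) auto
      ultimately have "h k * csqrt (p k) * inverse (csqrt (h k * cnj (h k))) =
          h k * of_real (norm (H ?f (?u k))) / of_real (norm (h k))"
        by (simp add: divide_inverse)
      also have "\<dots> = c k * H ?f (?u k)"
        using a0 by (simp add: h_eq norm_mult c_def)
      also have "\<dots> = H ?f (periodic_part \<psi>' k)"
        unfolding u'[of k] by (simp add: cell_inner_smult_right)
      finally show "h k * csqrt (p k) * inverse (csqrt (h k * cnj (h k))) =
          H (periodic_part \<psi>' k0) (periodic_part \<psi>' k)" .
    qed
  qed
  ultimately show ?thesis using that by blast
qed

end

section \<open>The action of the space group\<close>

lemma (in full_lattice) lattice_scale_int: "x \<in> L \<Longrightarrow> of_int m *\<^sub>R x \<in> L"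
  by (auto simp: mem_lattice_iff coords_def matrix_vector_mult_scaleR)

text \<open>Additivity on a lattice gives homogeneity over the integers, so the map is determined by
  its values on a lattice basis, and these extend to a linear functional on the whole space.\<close>

lemma (in full_lattice) additive_imp_inner:
  fixes f :: "real^'d \<Rightarrow> real"
  assumes add: "\<And>x y. x \<in> L \<Longrightarrow> y \<in> L \<Longrightarrow> f (x + y) = f x + f y"
  obtains w where "\<And>x. x \<in> L \<Longrightarrow> f x = x \<bullet> w"
proof
  have f0: "f 0 = 0" using add[OF lattice_zero lattice_zero] by simp
  have fneg: "f (- x) = - f x" if "x \<in> L" for x
    using add[OF that lattice_minus[OF that]] f0 by simp
  have fnat: "f (of_nat n *\<^sub>R x) = of_nat n * f x" if "x \<in> L" for x and n :: nat
  proof (induction n)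
    case (Suc n)
    have "f (x + of_nat n *\<^sub>R x) = f x + f (of_nat n *\<^sub>R x)"
      using lattice_scale_int[OF that, of "int n"] by (intro add that) simp
    then show ?case using Suc by (simp add: algebra_simps)
  qed (simp add: f0)
  have fint: "f (of_int m *\<^sub>R x) = of_int m * f x" if "x \<in> L" for x and m :: int
  proof (cases "0 \<le> m")
    case True
    then show ?thesis using fnat[OF that, of "nat m"] by simp
  next
    case False
    then have "f (- (of_nat (nat (- m)) *\<^sub>R x)) = of_int m * f x"
      using fneg[OF lattice_scale_int[OF that, of "- m"]] fnat[OF that, of "nat (- m)"] by simp
    then show ?thesis using False by simp
  qed
  let ?b = "\<lambda>i. basis *v axis i 1"
  have b: "?b i \<in> L" for i by (auto simp: mem_lattice_iff axis_def)
  have fsum: "(\<Sum>i\<in>J. of_int (m i) *\<^sub>R ?b i) \<in> L \<and>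
      f (\<Sum>i\<in>J. of_int (m i) *\<^sub>R ?b i) = (\<Sum>i\<in>J. of_int (m i) * f (?b i))"
    if "finite J" for J and m :: "'d \<Rightarrow> int"
    using that
    by (induction J rule: finite_induct) (auto simp: f0 lattice_zero add fint b lattice_scale_int intro: lattice_add)
  \<comment> \<open>The vector whose pairing with each basis vector is the value of \<open>f\<close>
    there.\<close>
  let ?w = "transpose (matrix_inv basis) *v (\<chi> i. f (?b i))"
  fix x assume "x \<in> L"
  then have "\<forall>i. \<exists>m::int. coords x $ i = of_int m" by (auto simp: mem_lattice_iff elim: Ints_cases)
  then obtain m :: "'d \<Rightarrow> int" where m: "\<And>i. coords x $ i = of_int (m i)" by metis
  have "coords x = (\<Sum>i\<in>UNIV. coords x $ i *\<^sub>R axis i 1)"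
    using basis_expansion[of "coords x"] by (simp add: scalar_mult_eq_scaleR)
  then have "basis *v coords x = basis *v (\<Sum>i\<in>UNIV. coords x $ i *\<^sub>R axis i 1)" by simp
  also have "\<dots> = (\<Sum>i\<in>UNIV. of_int (m i) *\<^sub>R ?b i)"
    by (simp only: linear_sum[OF matrix_vector_mul_linear] matrix_vector_mult_scaleR m)
  finally have "f x = (\<Sum>i\<in>UNIV. of_int (m i) * f (?b i))"
    using fsum[of UNIV m] by simp
  also have "\<dots> = coords x \<bullet> (\<chi> i. f (?b i))"
    by (simp add: inner_vec_def m)
  also have "\<dots> = x \<bullet> ?w"
    unfolding coords_def by (metis dot_lmul_matrix inner_commute transpose_matrix_vector)
  finally show "f x = x \<bullet> ?w" .
qed

text \<open>The values are integer multiples of \<open>2 * pi\<close>, a discrete set, and the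
  domain is connected.\<close>

lemma cis_eq_one_continuous_constant:
  fixes f :: "real^'d \<Rightarrow> real"
  assumes cont: "continuous_on UNIV f" and one: "\<And>k. cis (f k) = 1"
  shows "f x = f y"
proof -
  have "f constant_on UNIV"
  proof (rule continuous_discrete_range_constant[OF connected_UNIV cont])
    fix x :: "real^'d"
    show "\<exists>e>0. \<forall>y. y \<in> UNIV \<and> f y \<noteq> f x \<longrightarrow> e \<le> norm (f y - f x)"
    proof (intro exI[of _ "2 * pi"] conjI allI impI)
      fix y assume ne: "y \<in> UNIV \<and> f y \<noteq> f x"
      have "cis (f y - f x) = 1" by (simp add: one cis_divide[symmetric])
      then obtain n :: int where n: "f y - f x = 2 * pi * of_int n" using cis_eq_1_imp by blast
      then have "n \<noteq> 0" using ne by auto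
      then have "1 \<le> \<bar>real_of_int n\<bar>" by linarith
      then have "2 * pi * 1 \<le> 2 * pi * \<bar>real_of_int n\<bar>" by (intro mult_left_mono) auto
      then show "2 * pi \<le> norm (f y - f x)" by (simp add: n abs_mult mult_ac)
    qed simp
  qed
  then show ?thesis by (auto simp: constant_on_def)
qed

text \<open>The effect on scalars of passing them through a unitary or an antiunitary operator, in
  one notation, so that group laws need no case distinction.\<close>

definition cj :: "real \<Rightarrow> complex \<Rightarrow> complex" where
  "cj \<sigma> z = (if \<sigma> = 1 then z else cnj z)"

lemma cj_cis: "\<sigma> = 1 \<or> \<sigma> = -1 \<Longrightarrow> cj \<sigma> (cis x) = cis (\<sigma> * x)"
  by (auto simp: cj_def cis_cnj)

lemma analytic_near_cj: "analytic_near k0 f \<Longrightarrow> analytic_near k0 (\<lambda>k. cj \<sigma> (f k))"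
  unfolding cj_def by (cases "\<sigma> = 1") (simp_all add: analytic_near_cnj)

section \<open>Point group, space group and spinor representation of a symmetric band\<close>

locale symmetric_band = analytic_band L B
  for L :: "(real^'d) set" and B :: "real^'d \<Rightarrow> (real^'d \<Rightarrow> complex^'m) set" +
  fixes P :: "'p monoid" and ch :: "'p \<Rightarrow> real^'d^'d" and s :: "'p \<Rightarrow> real" and Ebar :: 'p
    and D :: "'p \<Rightarrow> complex^'m \<Rightarrow> complex^'m"
  assumes point_group: "double_point_group P ch s Ebar L"
    and spinor_rep: "spinor_representation P s Ebar D"
    and simple: "simple_band P ch s L D B"
begin

sublocale P: group P
  using point_group by (simp add: double_point_group_def)

lemma finite_P: "finite (carrier P)"
  using point_group by (simp add: double_point_group_def)

lemma orthogonal: "p \<in> carrier P \<Longrightarrow> orthogonal_matrix (ch p)"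
  and s_cases: "p \<in> carrier P \<Longrightarrow> s p = 1 \<or> s p = -1"
  and ch_lattice: "p \<in> carrier P \<Longrightarrow> (*v) (ch p) ` L = L"
  and ch_mult: "q \<in> carrier P \<Longrightarrow> p \<in> carrier P \<Longrightarrow> ch (q \<otimes>\<^bsub>P\<^esub> p) = ch q ** ch p"
  and s_mult: "q \<in> carrier P \<Longrightarrow> p \<in> carrier P \<Longrightarrow> s (q \<otimes>\<^bsub>P\<^esub> p) = s q * s p"
  using point_group by (auto simp: double_point_group_def)

lemma ch_one: "ch \<one>\<^bsub>P\<^esub> = mat 1" and s_one: "s \<one>\<^bsub>P\<^esub> = 1"
  using point_group unfolding double_point_group_def by blast+

lemma s_square: "p \<in> carrier P \<Longrightarrow> s p * s p = 1"
  using s_cases by force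

lemma ch_lattice_mem: "p \<in> carrier P \<Longrightarrow> R \<in> L \<Longrightarrow> ch p *v R \<in> L"
  using ch_lattice by blast

lemma ch_transpose_mem:
  assumes "p \<in> carrier P" "R \<in> L"
  shows "transpose (ch p) *v R \<in> L"
proof -
  obtain R' where "R' \<in> L" "R = ch p *v R'" using ch_lattice[OF assms(1)] assms(2) by blast
  then show ?thesis by (simp add: orthogonal_matrix_mult_self[OF orthogonal[OF assms(1)]])
qed

lemma orthogonal_transpose: "p \<in> carrier P \<Longrightarrow> orthogonal_matrix (transpose (ch p))"
  using orthogonal by (simp add: orthogonal_matrix_def)

lemma inner_ch: "(ch p *v x) \<bullet> y = x \<bullet> (transpose (ch p) *v y)"
  by (metis dot_lmul_matrix inner_commute transpose_matrix_vector transpose_transpose)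

lemma ch_inv:
  assumes p: "p \<in> carrier P"
  shows "ch (inv\<^bsub>P\<^esub> p) = transpose (ch p)"
proof -
  have "ch (inv\<^bsub>P\<^esub> p) ** ch p = mat 1"
    using ch_mult[of "inv\<^bsub>P\<^esub> p" p] p by (simp add: ch_one)
  then have "ch (inv\<^bsub>P\<^esub> p) ** (ch p ** transpose (ch p)) = transpose (ch p)"
    by (simp add: matrix_mul_assoc)
  then show ?thesis using orthogonal[OF p] by (simp add: orthogonal_matrix_def)
qed

text \<open>Makes the inverse that occurs in \<open>spinor_act\<close> computable: in a group a left
  inverse found by hand is the inverse.\<close>

lemma group_space_group: "group (space_group P ch L)"
proof (rule groupI)
  fix x y assume "x \<in> carrier (space_group P ch L)" "y \<in> carrier (space_group P ch L)"
  then show "x \<otimes>\<^bsub>space_group P ch L\<^esub> y \<in> carrier (space_group P ch L)"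
    by (auto simp: space_group_def intro!: lattice_add ch_lattice_mem)
next
  fix x y z assume "x \<in> carrier (space_group P ch L)" "y \<in> carrier (space_group P ch L)"
    "z \<in> carrier (space_group P ch L)"
  then show "x \<otimes>\<^bsub>space_group P ch L\<^esub> y \<otimes>\<^bsub>space_group P ch L\<^esub> z =
      x \<otimes>\<^bsub>space_group P ch L\<^esub> (y \<otimes>\<^bsub>space_group P ch L\<^esub> z)"
    by (auto simp: space_group_def P.m_assoc ch_mult matrix_vector_right_distrib
        matrix_vector_mul_assoc[symmetric] add.assoc)
next
  fix x assume "x \<in> carrier (space_group P ch L)"
  then obtain p R where x: "x = (p, R)" "p \<in> carrier P" "R \<in> L" by (auto simp: space_group_def)
  show "\<exists>y\<in>carrier (space_group P ch L). y \<otimes>\<^bsub>space_group P ch L\<^esub> x = \<one>\<^bsub>space_group P ch L\<^esub>"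
    using x by (intro bexI[of _ "(inv\<^bsub>P\<^esub> p, - (transpose (ch p) *v R))"])
      (auto simp: space_group_def ch_inv intro!: lattice_minus ch_transpose_mem)
qed (auto simp: space_group_def lattice_zero ch_one)

lemma space_act_inv:
  assumes p: "p \<in> carrier P" and R: "R \<in> L"
  shows "space_act ch (inv\<^bsub>space_group P ch L\<^esub> (p, R)) r = transpose (ch p) *v (r - R)"
proof -
  have "inv\<^bsub>space_group P ch L\<^esub> (p, R) = (inv\<^bsub>P\<^esub> p, - (transpose (ch p) *v R))"
    by (rule group.inv_equality[OF group_space_group])
      (use p R in \<open>auto simp: space_group_def ch_inv intro!: lattice_minus ch_transpose_mem\<close>)
  then show ?thesis
    by (simp add: space_act_def ch_inv[OF p] matrix_vector_mult_diff_distrib)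
qed

lemma spinor_act_eq:
  "p \<in> carrier P \<Longrightarrow> R \<in> L \<Longrightarrow> spinor_act P ch L D (p, R) f r = D p (f (transpose (ch p) *v (r - R)))"
  by (simp add: spinor_act_def space_act_inv)

lemma D_add: "p \<in> carrier P \<Longrightarrow> D p (u + v) = D p u + D p v"
  and D_smult: "p \<in> carrier P \<Longrightarrow> D p (c *s u) = cj (s p) c *s D p u"
  and D_inner: "p \<in> carrier P \<Longrightarrow> herm_inner (D p u) (D p v) = cj (s p) (herm_inner u v)"
  and D_bij: "p \<in> carrier P \<Longrightarrow> bij (D p)"
  using spinor_rep s_cases[of p]
  by (auto simp: spinor_representation_def unitary_op_def antiunitary_op_def cj_def)

lemma D_mult: "q \<in> carrier P \<Longrightarrow> p \<in> carrier P \<Longrightarrow> D (q \<otimes>\<^bsub>P\<^esub> p) v = D q (D p v)"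
  using spinor_rep unfolding spinor_representation_def by (metis comp_apply)

lemma D_norm: "p \<in> carrier P \<Longrightarrow> norm (D p v) = norm v"
proof -
  assume p: "p \<in> carrier P"
  have "complex_of_real ((norm (D p v))\<^sup>2) = cj (s p) (of_real ((norm v)\<^sup>2))"
    unfolding herm_inner_self[symmetric] by (rule D_inner[OF p])
  then have "complex_of_real ((norm (D p v))\<^sup>2) = of_real ((norm v)\<^sup>2)" by (simp add: cj_def split: if_splits)
  then have "(norm (D p v))\<^sup>2 = (norm v)\<^sup>2" by (simp only: of_real_eq_iff)
  then show ?thesis by simp
qed

lemma D_bounded_linear: "p \<in> carrier P \<Longrightarrow> bounded_linear (D p)"
proof (rule bounded_linear_intro[where K = 1])
  assume p: "p \<in> carrier P"
  show "D p (x + y) = D p x + D p y" for x y by (rule D_add[OF p])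
  show "D p (a *\<^sub>R x) = a *\<^sub>R D p x" for a x
    by (simp add: scaleR_vec_smult D_smult[OF p] cj_def)
  show "norm (D p x) \<le> norm x * 1" for x by (simp add: D_norm[OF p])
qed

lemma D_measurable:
  assumes p: "p \<in> carrier P" and f: "f \<in> borel_measurable M"
  shows "(\<lambda>x. D p (f x)) \<in> borel_measurable M"
  by (rule measurable_compose[OF f])
    (intro borel_measurable_continuous_onI linear_continuous_on D_bounded_linear p)

section \<open>Point group action on functions, wavevectors and phases\<close>

definition act :: "'p \<Rightarrow> (real^'d \<Rightarrow> complex^'m) \<Rightarrow> real^'d \<Rightarrow> complex^'m" where
  "act p f = (\<lambda>r. D p (f (transpose (ch p) *v r)))"

text \<open>The factor \<open>s p\<close> appears because an antiunitary operator conjugates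
  \<open>exp (i k r)\<close> and thus reverses the wavevector.\<close>

definition rot :: "'p \<Rightarrow> real^'d \<Rightarrow> real^'d" where
  "rot p k = s p *\<^sub>R (ch p *v k)"

lemma rot_mult: "q \<in> carrier P \<Longrightarrow> p \<in> carrier P \<Longrightarrow> rot (q \<otimes>\<^bsub>P\<^esub> p) k = rot q (rot p k)"
  by (simp add: rot_def s_mult ch_mult matrix_vector_mul_assoc[symmetric] matrix_vector_mult_scaleR)

lemma rot_add: "rot p (k + l) = rot p k + rot p l"
  by (simp add: rot_def matrix_vector_right_distrib scaleR_add_right)

lemma rot_zero: "rot p 0 = 0"
  by (simp add: rot_def)

lemma rot_minus: "rot p (- k) = - rot p k"
  using rot_add[of p k "- k"] rot_zero[of p] by (simp add: eq_neg_iff_add_eq_0 add.commute)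

lemma rot_inner: "rot p k \<bullet> r = k \<bullet> (s p *\<^sub>R (transpose (ch p) *v r))"
  by (simp add: rot_def inner_ch)

lemma rot_matrix: "rot p k = (s p *\<^sub>R ch p) *v k"
  by (simp add: rot_def scaleR_matrix_vector_assoc)

lemma rot_reciprocal:
  assumes "p \<in> carrier P" "K \<in> reciprocal_lattice L"
  shows "rot p K \<in> reciprocal_lattice L"
  unfolding reciprocal_lattice_def
proof (intro CollectI ballI)
  fix R assume "R \<in> L"
  then obtain n :: int where n: "K \<bullet> (transpose (ch p) *v R) = 2 * pi * of_int n"
    using ch_transpose_mem[OF assms(1)] assms(2) unfolding reciprocal_lattice_def by blast
  show "\<exists>n::int. rot p K \<bullet> R = 2 * pi * of_int n"
    using s_cases[OF assms(1)]
  proof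
    assume "s p = 1"
    then show ?thesis using n by (auto simp: rot_inner)
  next
    assume "s p = -1"
    then show ?thesis using n by (auto simp: rot_inner intro!: exI[of _ "- n"])
  qed
qed

lemma act_measurable:
  "p \<in> carrier P \<Longrightarrow> f \<in> borel_measurable borel \<Longrightarrow> act p f \<in> borel_measurable borel"
  unfolding act_def
  by (intro D_measurable measurable_compose[OF measurable_matrix_mult])

lemma act_smult: "p \<in> carrier P \<Longrightarrow> act p (\<lambda>r. c *s f r) = (\<lambda>r. cj (s p) c *s act p f r)"
  by (simp add: act_def D_smult)

lemma act_mult:
  "q \<in> carrier P \<Longrightarrow> p \<in> carrier P \<Longrightarrow> act (q \<otimes>\<^bsub>P\<^esub> p) f = act q (act p f)"
  by (simp add: act_def D_mult ch_mult matrix_transpose_mul matrix_vector_mul_assoc[symmetric])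

lemma act_cong_AE:
  assumes "p \<in> carrier P" "AE r in lborel. f r = g r"
  shows "AE r in lborel. act p f r = act p g r"
  using AE_lborel_orthogonal[OF orthogonal_transpose[OF assms(1)] assms(2)]
  by eventually_elim (simp add: act_def)

lemma act_phase:
  assumes "p \<in> carrier P"
  shows "act p (\<lambda>r. cis (k \<bullet> r) *s f r) = (\<lambda>r. cis (rot p k \<bullet> r) *s act p f r)"
  by (simp add: act_def D_smult[OF assms] cj_cis[OF s_cases[OF assms]] rot_inner)

text \<open>\<open>D p\<close> preserves the pointwise product up to conjugation, and the rotated
  argument does not change the cell integral of a periodic function.\<close>

lemma act_inner:
  assumes p: "p \<in> carrier P" and f: "f \<in> torus_L2 L" and g: "g \<in> torus_L2 L"
  shows "H (act p f) (act p g) = cj (s p) (H f g)"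
proof -
  note [measurable] = torus_L2_measurable[OF f] torus_L2_measurable[OF g]
  let ?F = "\<lambda>r. herm_inner (f r) (g r)"
  have "H (act p f) (act p g) = (LINT r:unit_cell L|lborel. cj (s p) (?F (transpose (ch p) *v r)))"
    by (simp add: cell_inner_def act_def D_inner[OF p])
  also have "\<dots> = (LINT r:unit_cell L|lborel. cj (s p) (?F r))"
  proof (rule cell_integral_orthogonal[OF _ _ orthogonal_transpose[OF p]])
    have "(\<lambda>r. herm_inner (f r) (g r)) \<in> borel_measurable borel" by measurable
    then show "(\<lambda>r. cj (s p) (?F r)) \<in> borel_measurable borel"
      unfolding cj_def
      using measurable_compose[of ?F borel borel cnj borel] borel_measurable_continuous_onI[OF continuous_on_cnj[OF continuous_on_id]]
      by simp
    fix R assume R: "R \<in> L"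
    from torus_L2_periodic[OF f R] torus_L2_periodic[OF g R]
    show "AE r in lborel. cj (s p) (?F (r + R)) = cj (s p) (?F r)" by eventually_elim simp
  next
    show "(*v) (transpose (ch p)) ` L = L"
    proof (intro equalityI subsetI)
      fix R assume "R \<in> L"
      then show "R \<in> (*v) (transpose (ch p)) ` L"
        using ch_lattice_mem[OF p] orthogonal_matrix_mult_self(2)[OF orthogonal[OF p], of R]
        by (intro image_eqI[of _ _ "ch p *v R"]) auto
    qed (auto intro: ch_transpose_mem[OF p])
  qed
  also have "\<dots> = cj (s p) (H f g)"
  proof (cases "s p = 1")
    case False
    have "H g f = (LINT r:unit_cell L|lborel. cnj (?F r))"
      unfolding cell_inner_def by (subst herm_inner_cnj) simp
    then show ?thesis using False cell_inner_cnj[of g f] by (simp add: cj_def)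
  qed (simp add: cj_def cell_inner_def)
  finally show ?thesis .
qed

text \<open>An inner product instead of a chosen scalar: the phase becomes a function of the gauge,
  to which statements about analyticity and periodicity can be applied.\<close>

definition rho :: "(real^'d \<Rightarrow> real^'d \<Rightarrow> complex^'m) \<Rightarrow> 'p \<Rightarrow> real^'d \<Rightarrow> complex" where
  "rho \<psi> p k = H (periodic_part \<psi> (rot p k)) (act p (periodic_part \<psi> k))"

lemma phase_unique:
  assumes "band_choice L B \<psi>" "AE r in lborel. a *s periodic_part \<psi> k r = b *s periodic_part \<psi> k r"
  shows "a = b"
proof -
  let ?u = "periodic_part \<psi> k"
  have "H ?u (\<lambda>r. a *s ?u r) = H ?u (\<lambda>r. b *s ?u r)"
    by (intro cell_inner_cong_AE L2_measurable L2_smult choice_L2 assms) auto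
  then show ?thesis by (simp add: cell_inner_smult_right choice_inner_self[OF assms(1)])
qed

text \<open>The band symmetry for the element with zero translation relates Bloch functions. The
  plane wave \<open>exp (i k r)\<close> becomes the one of \<open>rot p k\<close> under the action,
  so dividing it out leaves the same scalar between the periodic parts.\<close>

lemma rho:
  assumes \<psi>: "band_choice L B \<psi>" and p: "p \<in> carrier P"
  shows "AE r in lborel. act p (periodic_part \<psi> k) r = rho \<psi> p k *s periodic_part \<psi> (rot p k) r"
    and "norm (rho \<psi> p k) = 1"
proof -
  let ?u = "periodic_part \<psi>"
  have "(p, 0) \<in> carrier (space_group P ch L)" by (simp add: space_group_def p lattice_zero)
  moreover have "\<forall>\<psi>. band_choice L B \<psi> \<longrightarrow> (\<forall>g\<in>carrier (space_group P ch L). \<forall>k. \<exists>\<rho>. norm \<rho> = 1 \<and>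
      (AE r in lborel. spinor_act P ch L D g (\<psi> k) r = \<rho> *s \<psi> (s (fst g) *\<^sub>R (ch (fst g) *v k)) r))"
    using simple unfolding simple_band_def by blast
  ultimately have "\<exists>\<rho>. norm \<rho> = 1 \<and> (AE r in lborel. spinor_act P ch L D (p, 0) (\<psi> k) r =
      \<rho> *s \<psi> (s (fst (p, 0 :: real^'d)) *\<^sub>R (ch (fst (p, 0 :: real^'d)) *v k)) r)"
    using \<psi> by blast
  then obtain \<rho> where \<rho>: "norm \<rho> = 1"
    "AE r in lborel. spinor_act P ch L D (p, 0) (\<psi> k) r = \<rho> *s \<psi> (s p *\<^sub>R (ch p *v k)) r"
    by auto
  have "\<psi> l r = cis (l \<bullet> r) *s ?u l r" for l r
    by (simp add: periodic_part_def vector_smult_assoc cis_mult)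
  then have \<psi>u: "\<psi> l = (\<lambda>r. cis (l \<bullet> r) *s ?u l r)" for l by blast
  have "spinor_act P ch L D (p, 0) (\<psi> k) r = cis (rot p k \<bullet> r) *s act p (?u k) r" for r
  proof -
    have "spinor_act P ch L D (p, 0) (\<psi> k) r = act p (\<psi> k) r"
      by (simp add: spinor_act_eq[OF p lattice_zero] act_def)
    also have "\<dots> = cis (rot p k \<bullet> r) *s act p (?u k) r"
      by (subst \<psi>u) (simp add: act_phase[OF p])
    finally show ?thesis .
  qed
  note sp = this
  have ae: "AE r in lborel. act p (?u k) r = \<rho> *s ?u (rot p k) r"
    using \<rho>(2)
  proof eventually_elim
    case (elim r)
    then have "cis (rot p k \<bullet> r) *s act p (?u k) r = \<rho> *s (cis (rot p k \<bullet> r) *s ?u (rot p k) r)"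
      unfolding sp rot_def[symmetric] by (subst (asm) (1) \<psi>u) simp
    then have "cis (- (rot p k \<bullet> r)) *s (cis (rot p k \<bullet> r) *s act p (?u k) r) =
        cis (- (rot p k \<bullet> r)) *s (\<rho> *s (cis (rot p k \<bullet> r) *s ?u (rot p k) r))" by simp
    moreover have "cis (- (rot p k \<bullet> r)) * (\<rho> * cis (rot p k \<bullet> r)) = \<rho>"
      by (simp add: mult.left_commute cis_mult)
    ultimately show ?case by (simp add: vector_smult_assoc cis_mult)
  qed
  have "rho \<psi> p k = H (?u (rot p k)) (\<lambda>r. \<rho> *s ?u (rot p k) r)"
    unfolding rho_def using ae
    by (intro cell_inner_cong_AE L2_measurable L2_smult choice_L2 \<psi> act_measurable p) auto
  then have "rho \<psi> p k = \<rho>" by (simp add: cell_inner_smult_right choice_inner_self[OF \<psi>])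
  then show "AE r in lborel. act p (?u k) r = rho \<psi> p k *s ?u (rot p k) r" "norm (rho \<psi> p k) = 1"
    using ae \<rho>(1) by simp_all
qed

text \<open>Acting with \<open>p\<close> and then with \<open>q\<close> must agree with acting by
  the product. The phase of \<open>p\<close> is pulled through the action of \<open>q\<close>, where
  an antiunitary \<open>q\<close> conjugates it.\<close>

lemma rho_mult:
  assumes \<psi>: "band_choice L B \<psi>" and q: "q \<in> carrier P" and p: "p \<in> carrier P"
  shows "rho \<psi> (q \<otimes>\<^bsub>P\<^esub> p) k = cj (s q) (rho \<psi> p k) * rho \<psi> q (rot p k)"
proof (rule phase_unique[OF \<psi>, THEN sym])
  let ?u = "periodic_part \<psi>"
  have "AE r in lborel. act q (act p (?u k)) r = act q (\<lambda>r. rho \<psi> p k *s ?u (rot p k) r) r"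
    by (rule act_cong_AE[OF q rho(1)[OF \<psi> p]])
  moreover have "AE r in lborel. act q (?u (rot p k)) r = rho \<psi> q (rot p k) *s ?u (rot q (rot p k)) r"
    by (rule rho(1)[OF \<psi> q])
  moreover have "AE r in lborel. act (q \<otimes>\<^bsub>P\<^esub> p) (?u k) r = rho \<psi> (q \<otimes>\<^bsub>P\<^esub> p) k *s ?u (rot (q \<otimes>\<^bsub>P\<^esub> p) k) r"
    using q p by (intro rho(1)[OF \<psi>]) simp
  ultimately show "AE r in lborel. (cj (s q) (rho \<psi> p k) * rho \<psi> q (rot p k)) *s ?u (rot (q \<otimes>\<^bsub>P\<^esub> p) k) r =
      rho \<psi> (q \<otimes>\<^bsub>P\<^esub> p) k *s ?u (rot (q \<otimes>\<^bsub>P\<^esub> p) k) r"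
    by eventually_elim (simp add: act_mult[OF q p] act_smult[OF q] rot_mult[OF q p] vector_smult_assoc)
qed

text \<open>Shifting \<open>k\<close> by \<open>K\<close> multiplies both vectors by
  \<open>exp (- i K' r)\<close> with \<open>K' = rot p K\<close>, again a reciprocal lattice vector,
  and the common factor cancels.\<close>

lemma rho_periodic:
  assumes \<psi>: "band_choice L B \<psi>" and per: "periodic_choice L \<psi>" and p: "p \<in> carrier P"
    and K: "K \<in> reciprocal_lattice L"
  shows "rho \<psi> p (k + K) = rho \<psi> p k"
proof -
  let ?u = "periodic_part \<psi>"
  have "AE r in lborel. act p (?u (k + K)) r = act p (\<lambda>r. cis ((- K) \<bullet> r) *s ?u k r) r"
    using periodic_choice_reciprocal[OF per K, of k] by (intro act_cong_AE p) simp
  then have 1: "AE r in lborel. act p (?u (k + K)) r = cis (- (rot p K \<bullet> r)) *s act p (?u k) r"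
    unfolding act_phase[OF p] rot_minus by simp
  have 2: "AE r in lborel. ?u (rot p k + rot p K) r = cis (- (rot p K \<bullet> r)) *s ?u (rot p k) r"
    by (rule periodic_choice_reciprocal[OF per rot_reciprocal[OF p K]])
  have "rho \<psi> p (k + K) = H (\<lambda>r. cis (- (rot p K \<bullet> r)) *s ?u (rot p k) r)
      (\<lambda>r. cis (- (rot p K \<bullet> r)) *s act p (?u k) r)"
    unfolding rho_def rot_add
    by (intro cell_inner_cong_AE 1 2 measurable_vec_smult measurable_cis_inner act_measurable p
        L2_measurable choice_L2 \<psi>)
  also have "\<dots> = rho \<psi> p k" unfolding rho_def by (rule cell_inner_unimodular) simp
  finally show ?thesis .
qed

text \<open>The action preserves overlaps up to conjugation. The overlap of the vectors at
  \<open>k0\<close> and \<open>k\<close> therefore equals, up to the two phases, the one at the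
  rotated wavevectors; the latter is \<open>1\<close> at \<open>k0\<close>, so the equation can be
  solved for the phase at \<open>k\<close>.\<close>

lemma rho_analytic:
  assumes \<psi>: "analytic_gauge \<psi>" and p: "p \<in> carrier P"
  shows "analytic_near k0 (rho \<psi> p)"
proof -
  let ?u = "periodic_part \<psi>" and ?k1 = "rot p k0"
  have ch: "band_choice L B \<psi>" and an: "analytic_near k (\<lambda>l. H (?u k) (?u l))" for k
    using \<psi> by (auto simp: analytic_gauge_def)
  define h where "h k = H (?u k0) (?u k)" for k
  define h1 where "h1 k = H (?u ?k1) (?u (rot p k))" for k
  have ha: "analytic_near k0 h" unfolding h_def by (rule an)
  have h1a: "analytic_near k0 h1"
    using analytic_near_matrix[of "s p *\<^sub>R ch p" k0 "\<lambda>l. H (?u ?k1) (?u l)"] an[of ?k1]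
    by (simp add: h1_def[abs_def] rot_matrix[symmetric])
  have h10: "h1 k0 = 1" by (simp add: h1_def choice_inner_self[OF ch])
  have key: "cj (s p) (h k) = cnj (rho \<psi> p k0) * (rho \<psi> p k * h1 k)" for k
  proof -
    have "cj (s p) (h k) = H (act p (?u k0)) (act p (?u k))"
      unfolding h_def by (rule act_inner[symmetric, OF p choice_torus[OF ch] choice_torus[OF ch]])
    also have "\<dots> = H (\<lambda>r. rho \<psi> p k0 *s ?u ?k1 r) (\<lambda>r. rho \<psi> p k *s ?u (rot p k) r)"
      by (intro cell_inner_cong_AE rho ch p act_measurable L2_measurable L2_smult choice_L2)
    finally show ?thesis by (simp add: cell_inner_smult_left cell_inner_smult_right h1_def)
  qed
  have "analytic_near k0 (\<lambda>k. inverse (h1 k))"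
    by (rule analytic_near_compose[OF h1a, of inverse]) (use h10 in \<open>auto intro!: analytic_on_inverse\<close>)
  then have F: "analytic_near k0 (\<lambda>k. rho \<psi> p k0 * cj (s p) (h k) * inverse (h1 k))"
    by (intro analytic_near_mult analytic_near_const analytic_near_cj ha)
  have "(h1 \<longlongrightarrow> h1 k0) (nhds k0)"
    using analytic_near_isCont[OF h1a] by (metis isCont_def tendsto_at_iff_tendsto_nhds)
  then have "eventually (\<lambda>k. h1 k \<noteq> 0) (nhds k0)"
    by (rule tendsto_imp_eventually_ne) (simp add: h10)
  then show ?thesis
  proof (rule analytic_near_cong[OF F eventually_mono])
    fix k assume "h1 k \<noteq> 0"
    moreover have "rho \<psi> p k0 * cnj (rho \<psi> p k0) = 1"
      using rho(2)[OF ch p, of k0] complex_norm_square[of "rho \<psi> p k0"] by simp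
    ultimately show "rho \<psi> p k0 * cj (s p) (h k) * inverse (h1 k) = rho \<psi> p k"
      unfolding key by (simp add: mult.assoc[symmetric])
  qed
qed

end

subsection \<open>Linearizing the phases\<close>

lemma (in full_lattice) reciprocal_inner_zero:
  assumes "\<And>K. K \<in> reciprocal_lattice L \<Longrightarrow> K \<bullet> w = 0"
  shows "w = 0"
proof -
  have "coords w $ i = 0" for i
    using assms[OF reciprocal_basis_axis[of i]] by (simp add: reciprocal_basis_inner inner_axis')
  then have "coords w = 0" by (simp add: vec_eq_iff)
  then show ?thesis using basis_coords(1)[of w] by simp
qed

context symmetric_band
begin

lemma rho_smult:
  assumes p: "p \<in> carrier P"
  shows "rho (\<lambda>k r. c k *s \<psi> k r) p k = cnj (c (rot p k)) * (cj (s p) (c k) * rho \<psi> p k)"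
  unfolding rho_def periodic_part_smult act_smult[OF p]
  by (simp add: cell_inner_smult_left cell_inner_smult_right)

text \<open>Wavevector space is contractible, so a continuous logarithm exists globally. It need not
  be periodic; its increments under reciprocal vectors record the winding of the phase.\<close>

lemma rho_lift:
  assumes \<psi>: "analytic_gauge \<psi>" and p: "p \<in> carrier P"
  shows "\<exists>\<theta>. continuous_on UNIV \<theta> \<and> (\<forall>k. rho \<psi> p k = cis (\<theta> k))"
proof -
  have ch: "band_choice L B \<psi>" using \<psi> by (simp add: analytic_gauge_def)
  have "continuous_on UNIV (rho \<psi> p)"
    by (intro continuous_at_imp_continuous_on ballI analytic_near_isCont rho_analytic \<psi> p)
  moreover have "rho \<psi> p k \<noteq> 0" for k using rho(2)[OF ch p, of k] by auto
  ultimately obtain g where g: "continuous_on UNIV g" "\<And>k. rho \<psi> p k = exp (g k)"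
    using continuous_logarithm_on_contractible[of UNIV "rho \<psi> p"] contractible_UNIV by auto
  have "Re (g k) = 0" for k
    using rho(2)[OF ch p, of k] by (simp add: g(2) norm_exp_eq_Re)
  then have "exp (g k) = cis (Im (g k))" for k by (simp add: exp_eq_polar)
  then show ?thesis
    using g by (intro exI[of _ "\<lambda>k. Im (g k)"]) (auto intro: continuous_intros)
qed

text \<open>
  A continuous logarithm \<open>\<theta>\<^sub>p\<close> of the phase is the sum of a linear function, a constant and a
  periodic function \<open>\<phi>\<^sub>p\<close> that vanishes at \<open>0\<close>. The \<open>\<phi>\<^sub>p\<close> form an additive cocycle of the
  finite group, which is the coboundary of its average \<open>\<xi>\<close>.
\<close>

lemma linear_phase_gauge:
  assumes \<psi>: "analytic_gauge \<psi>" and per: "periodic_choice L \<psi>"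
  obtains \<psi>' R a where "analytic_gauge \<psi>'" "periodic_choice L \<psi>'"
    "\<And>p. p \<in> carrier P \<Longrightarrow> R p \<in> L"
    "\<And>q p. q \<in> carrier P \<Longrightarrow> p \<in> carrier P \<Longrightarrow>
      R (q \<otimes>\<^bsub>P\<^esub> p) = s p *\<^sub>R (transpose (ch p) *v R q) + s q *\<^sub>R R p"
    "\<And>p k. p \<in> carrier P \<Longrightarrow> rho \<psi>' p k = cis (k \<bullet> R p + a p)"
proof -
  interpret RL: full_lattice "reciprocal_lattice L"
    by unfold_locales (rule full_rank_reciprocal)
  have ch: "band_choice L B \<psi>" and an: "analytic_near k (\<lambda>l. H (periodic_part \<psi> k) (periodic_part \<psi> l))" for k
    using \<psi> by (auto simp: analytic_gauge_def)
  have "\<forall>p\<in>carrier P. \<exists>\<theta>. continuous_on UNIV \<theta> \<and> (\<forall>k. rho \<psi> p k = cis (\<theta> k))"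
    using rho_lift[OF \<psi>] by blast
  then obtain \<theta> where \<theta>cont: "\<And>p. p \<in> carrier P \<Longrightarrow> continuous_on UNIV (\<theta> p)"
    and \<theta>: "\<And>p k. p \<in> carrier P \<Longrightarrow> rho \<psi> p k = cis (\<theta> p k)" by metis
  \<comment> \<open>The phase is periodic, so each increment is a multiple of \<open>2 * pi\<close>,
    and continuity in \<open>k\<close> makes it constant. Increments are then additive in
    \<open>K\<close>, which yields the linear part \<open>R p\<close>.\<close>
  have shift: "\<theta> p (k + K) - \<theta> p k = \<theta> p K - \<theta> p 0"
    if p: "p \<in> carrier P" and K: "K \<in> reciprocal_lattice L" for p k K
  proof -
    have "continuous_on UNIV (\<lambda>k. \<theta> p (k + K) - \<theta> p k)"
      by (intro continuous_on_diff \<theta>cont p continuous_on_compose2[OF \<theta>cont[OF p]] continuous_intros) auto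
    moreover have "cis (\<theta> p (k + K) - \<theta> p k) = 1" for k
      using rho_periodic[OF ch per p K, of k] by (simp add: \<theta>[OF p] cis_divide[symmetric])
    ultimately have "\<theta> p (k + K) - \<theta> p k = \<theta> p (0 + K) - \<theta> p 0"
      by (rule cis_eq_one_continuous_constant)
    then show ?thesis by simp
  qed
  have "\<exists>w. \<forall>K\<in>reciprocal_lattice L. \<theta> p K - \<theta> p 0 = K \<bullet> w" if p: "p \<in> carrier P" for p
  proof -
    have add: "\<theta> p (x + y) - \<theta> p 0 = (\<theta> p x - \<theta> p 0) + (\<theta> p y - \<theta> p 0)"
      if "x \<in> reciprocal_lattice L" "y \<in> reciprocal_lattice L" for x y
      using shift[OF p that(2), of x] by simp
    obtain w where "\<And>K. K \<in> reciprocal_lattice L \<Longrightarrow> \<theta> p K - \<theta> p 0 = K \<bullet> w"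
      by (rule RL.additive_imp_inner[of "\<lambda>K. \<theta> p K - \<theta> p 0"]) (use add in auto)
    then show ?thesis by blast
  qed
  then have "\<forall>p\<in>carrier P. \<exists>w. \<forall>K\<in>reciprocal_lattice L. \<theta> p K - \<theta> p 0 = K \<bullet> w" by blast
  from bchoice[OF this] obtain R where
    R: "\<And>p K. p \<in> carrier P \<Longrightarrow> K \<in> reciprocal_lattice L \<Longrightarrow> \<theta> p K - \<theta> p 0 = K \<bullet> R p"
    by blast
  \<comment> \<open>The increments are multiples of \<open>2 * pi\<close>, that is,
    \<open>R p\<close> pairs integrally with the reciprocal lattice, whose dual is the original
    lattice.\<close>
  have RL: "R p \<in> L" if p: "p \<in> carrier P" for p
  proof (rule mem_lattice_if_reciprocal)
    fix K assume K: "K \<in> reciprocal_lattice L"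
    have "cis (\<theta> p K - \<theta> p 0) = 1"
      using rho_periodic[OF ch per p K, of 0] by (simp add: \<theta>[OF p] cis_divide[symmetric])
    then show "\<exists>n::int. K \<bullet> R p = 2 * pi * of_int n"
      unfolding R[OF p K] by (rule cis_eq_1_imp)
  qed
  define \<phi> where "\<phi> p k = \<theta> p k - k \<bullet> R p - \<theta> p 0" for p k
  have \<phi>0: "\<phi> p 0 = 0" for p by (simp add: \<phi>_def)
  have \<phi>per: "\<phi> p (k + K) = \<phi> p k" if "p \<in> carrier P" "K \<in> reciprocal_lattice L" for p k K
    using shift[OF that, of k] R[OF that] by (simp add: \<phi>_def inner_add_left)
  have \<phi>K: "\<phi> p K = 0" if "p \<in> carrier P" "K \<in> reciprocal_lattice L" for p K
    using \<phi>per[OF that, of 0] by (simp add: \<phi>0)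
  have coc: "R (q \<otimes>\<^bsub>P\<^esub> p) = s p *\<^sub>R (transpose (ch p) *v R q) + s q *\<^sub>R R p \<and>
      (\<forall>k. \<phi> (q \<otimes>\<^bsub>P\<^esub> p) k = \<phi> q (rot p k) + s q * \<phi> p k)"
    if q: "q \<in> carrier P" and p: "p \<in> carrier P" for q p
  proof -
    let ?qp = "q \<otimes>\<^bsub>P\<^esub> p"
    have qp: "?qp \<in> carrier P" using q p by simp
    define c where "c k = \<theta> ?qp k - \<theta> q (rot p k) - s q * \<theta> p k" for k
    have rcont: "continuous_on UNIV (rot p)"
      unfolding rot_matrix[abs_def] by (rule matrix_vector_mult_linear_continuous_on)
    have c: "c k = c 0" for k
    proof (rule cis_eq_one_continuous_constant)
      show "continuous_on UNIV c"
        unfolding c_def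
        by (intro continuous_on_diff continuous_on_mult continuous_on_const \<theta>cont qp p
            continuous_on_compose2[OF \<theta>cont[OF q] rcont]) auto
      fix k
      have "cis (\<theta> ?qp k) = cis (s q * \<theta> p k) * cis (\<theta> q (rot p k))"
        using rho_mult[OF ch q p, of k] by (simp add: \<theta> q p qp cj_cis[OF s_cases[OF q]])
      then show "cis (c k) = 1"
        by (simp add: c_def cis_divide[symmetric] cis_mult add.commute)
    qed
    \<comment> \<open>The cocycle law holds for the full logarithms up to a constant. On reciprocal
      vectors the periodic parts vanish, so the linear defect \<open>w\<close> is zero; linear and
      periodic parts then obey the law separately.\<close>
    define w where "w = s p *\<^sub>R (transpose (ch p) *v R q) + s q *\<^sub>R R p - R ?qp"
    have E: "\<phi> ?qp k - \<phi> q (rot p k) - s q * \<phi> p k = k \<bullet> w" for k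
      using c[of k]
      by (simp add: \<phi>_def c_def w_def rot_zero rot_inner inner_add_right inner_diff_right algebra_simps)
    have "K \<bullet> w = 0" if K: "K \<in> reciprocal_lattice L" for K
      using E[of K] \<phi>K qp q p K rot_reciprocal[OF p K] by simp
    then have "w = 0" by (rule reciprocal_inner_zero)
    then show ?thesis using E by (auto simp: w_def algebra_simps)
  qed
  define n where "n = real (card (carrier P))"
  have n: "n > 0" using finite_P P.one_closed by (auto simp: n_def card_gt_0_iff)
  \<comment> \<open>Multiplied by \<open>s q\<close>, the cocycle law contains
    \<open>\<phi> p\<close> with coefficient one for every \<open>q\<close>. Summation over the
    group and right translation by \<open>p\<close> then exhibit \<open>\<phi> p\<close> as a
    coboundary of the average.\<close>
  define \<xi> where "\<xi> k = - (1 / n) * (\<Sum>q\<in>carrier P. s q * \<phi> q k)" for k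
  have \<xi>rot: "\<xi> (rot p k) = s p * \<xi> k + \<phi> p k" if p: "p \<in> carrier P" for p k
  proof -
    have bij: "bij_betw (\<lambda>q. q \<otimes>\<^bsub>P\<^esub> p) (carrier P) (carrier P)"
      by (rule bij_betwI[where g = "\<lambda>q. q \<otimes>\<^bsub>P\<^esub> inv\<^bsub>P\<^esub> p"]) (use p in \<open>auto simp: P.m_assoc\<close>)
    have "(\<Sum>q\<in>carrier P. s q * \<phi> q (rot p k)) =
        (\<Sum>q\<in>carrier P. s p * (s (q \<otimes>\<^bsub>P\<^esub> p) * \<phi> (q \<otimes>\<^bsub>P\<^esub> p) k) - \<phi> p k)"
    proof (rule sum.cong[OF refl])
      fix q assume q: "q \<in> carrier P"
      have "s p * (s (q \<otimes>\<^bsub>P\<^esub> p) * \<phi> (q \<otimes>\<^bsub>P\<^esub> p) k) =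
          (s p * s p) * (s q * \<phi> q (rot p k)) + (s p * s p) * ((s q * s q) * \<phi> p k)"
        using coc[OF q p] s_mult[OF q p] by (simp add: algebra_simps)
      then show "s q * \<phi> q (rot p k) = s p * (s (q \<otimes>\<^bsub>P\<^esub> p) * \<phi> (q \<otimes>\<^bsub>P\<^esub> p) k) - \<phi> p k"
        by (simp add: s_square[OF p] s_square[OF q])
    qed
    also have "\<dots> = s p * (\<Sum>q\<in>carrier P. s (q \<otimes>\<^bsub>P\<^esub> p) * \<phi> (q \<otimes>\<^bsub>P\<^esub> p) k) - n * \<phi> p k"
      by (simp add: sum_subtractf sum_distrib_left n_def)
    also have "(\<Sum>q\<in>carrier P. s (q \<otimes>\<^bsub>P\<^esub> p) * \<phi> (q \<otimes>\<^bsub>P\<^esub> p) k) = (\<Sum>q\<in>carrier P. s q * \<phi> q k)"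
      by (rule sum.reindex_bij_betw[OF bij])
    finally show ?thesis using n by (simp add: \<xi>_def field_simps)
  qed
  have \<xi>per: "\<xi> (k + K) = \<xi> k" if "K \<in> reciprocal_lattice L" for k K
    unfolding \<xi>_def using \<phi>per that by simp
  define \<psi>' where "\<psi>' = (\<lambda>k r. cis (\<xi> k) *s \<psi> k r)"
  have ch': "band_choice L B \<psi>'" unfolding \<psi>'_def by (rule choice_smult[OF ch]) simp
  \<comment> \<open>The continuous logarithm is analytic because near \<open>k0\<close> it moves by
    less than \<open>pi\<close>, where it agrees with the principal logarithm of the phase relative
    to \<open>k0\<close>.\<close>
  have \<theta>an: "analytic_near k0 (\<lambda>k. of_real (\<theta> p k))" if p: "p \<in> carrier P" for p k0
  proof -
    have r: "analytic_near k0 (\<lambda>k. rho \<psi> p k * cnj (rho \<psi> p k0))"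
      by (intro analytic_near_mult analytic_near_const rho_analytic \<psi> p)
    have "rho \<psi> p k0 * cnj (rho \<psi> p k0) = 1" by (simp add: \<theta>[OF p] cis_cnj cis_mult)
    then have "analytic_near k0 (\<lambda>k. ln (rho \<psi> p k * cnj (rho \<psi> p k0)))"
      by (intro analytic_near_compose[OF r, of ln]) (auto intro!: analytic_intros)
    then have F: "analytic_near k0 (\<lambda>k. of_real (\<theta> p k0) + (- \<i>) * ln (rho \<psi> p k * cnj (rho \<psi> p k0)))"
      by (intro analytic_near_add analytic_near_mult analytic_near_const)
    have "isCont (\<theta> p) k0"
      using \<theta>cont[OF p] by (simp add: continuous_on_eq_continuous_at)
    then have "((\<lambda>k. dist (\<theta> p k) (\<theta> p k0)) \<longlongrightarrow> 0) (nhds k0)"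
      unfolding isCont_def by (metis tendsto_at_iff_tendsto_nhds tendsto_dist_iff)
    then have "eventually (\<lambda>k. dist (\<theta> p k) (\<theta> p k0) < pi) (nhds k0)"
      by (rule order_tendstoD) simp
    then show ?thesis
    proof (rule analytic_near_cong[OF F eventually_mono])
      fix k assume "dist (\<theta> p k) (\<theta> p k0) < pi"
      then have b: "\<bar>\<theta> p k - \<theta> p k0\<bar> < pi" by (simp add: dist_real_def)
      have "rho \<psi> p k * cnj (rho \<psi> p k0) = exp (\<i> * of_real (\<theta> p k - \<theta> p k0))"
        by (simp add: \<theta>[OF p] cis_cnj cis_mult cis_conv_exp[symmetric] del: of_real_diff)
      then have "ln (rho \<psi> p k * cnj (rho \<psi> p k0)) = \<i> * of_real (\<theta> p k - \<theta> p k0)"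
        using b by (simp only:) (rule Ln_exp, auto)
      then show "of_real (\<theta> p k0) + (- \<i>) * ln (rho \<psi> p k * cnj (rho \<psi> p k0)) = of_real (\<theta> p k)"
        by simp
    qed
  qed
  have lin: "analytic_near k0 (\<lambda>k. of_real (k \<bullet> v))" for k0 v :: "real^'d"
    unfolding inner_vec_def inner_real_def of_real_sum of_real_mult
    by (intro analytic_near_sum analytic_near_mult analytic_near_const analytic_near_coordinate) auto
  have \<phi>an: "analytic_near k0 (\<lambda>k. of_real (\<phi> p k))" if p: "p \<in> carrier P" for p k0
    using analytic_near_add[OF \<theta>an[OF p] analytic_near_add[OF lin[of k0 "- R p"]
          analytic_near_const[of k0 "of_real (- \<theta> p 0)"]]]
    by (simp add: \<phi>_def[abs_def] algebra_simps)
  have "analytic_near k0 (\<lambda>k. of_real (- (1 / n)) * (\<Sum>q\<in>carrier P. of_real (s q) * of_real (\<phi> q k)))" for k0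
    by (intro analytic_near_mult analytic_near_const analytic_near_sum finite_P \<phi>an)
  then have "analytic_near k0 (\<lambda>k. of_real (\<xi> k))" for k0
    by (simp add: \<xi>_def[abs_def])
  then have "analytic_near k0 (\<lambda>k. \<i> * of_real (\<xi> k))" for k0
    by (intro analytic_near_mult analytic_near_const)
  then have \<xi>an: "analytic_near k0 (\<lambda>k. cis (\<xi> k))" for k0
    unfolding cis_conv_exp by (rule analytic_near_compose) (auto intro!: analytic_intros)
  show ?thesis
  proof
    show "analytic_gauge \<psi>'"
      unfolding analytic_gauge_def
    proof (intro conjI allI ch')
      fix k0
      have "analytic_near k0 (\<lambda>k. cnj (cis (\<xi> k0)) * (cis (\<xi> k) * H (periodic_part \<psi> k0) (periodic_part \<psi> k)))"
        by (intro analytic_near_mult analytic_near_const \<xi>an an)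
      then show "analytic_near k0 (\<lambda>k. H (periodic_part \<psi>' k0) (periodic_part \<psi>' k))"
        unfolding \<psi>'_def periodic_part_smult by (simp add: cell_inner_smult_left cell_inner_smult_right)
    qed
    show "periodic_choice L \<psi>'"
      unfolding periodic_choice_def
    proof (intro allI ballI)
      fix k K assume K: "K \<in> reciprocal_lattice L"
      have "AE r in lborel. \<psi> (k + K) r = \<psi> k r" using per K by (simp add: periodic_choice_def)
      then show "AE r in lborel. \<psi>' (k + K) r = \<psi>' k r"
        by eventually_elim (simp add: \<psi>'_def \<xi>per[OF K])
    qed
    fix p k assume p: "p \<in> carrier P"
    show "R p \<in> L" by (rule RL[OF p])
    have "rho \<psi>' p k = cis (- \<xi> (rot p k)) * (cis (s p * \<xi> k) * cis (\<theta> p k))"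
      unfolding \<psi>'_def rho_smult[OF p] by (simp add: cis_cnj cj_cis[OF s_cases[OF p]] \<theta>[OF p])
    also have "\<dots> = cis (- \<xi> (rot p k) + (s p * \<xi> k + \<theta> p k))" by (simp only: cis_mult)
    also have "- \<xi> (rot p k) + (s p * \<xi> k + \<theta> p k) = k \<bullet> R p + \<theta> p 0"
      unfolding \<xi>rot[OF p] by (simp add: \<phi>_def)
    finally show "rho \<psi>' p k = cis (k \<bullet> R p + \<theta> p 0)" .
  next
    fix q p assume "q \<in> carrier P" "p \<in> carrier P"
    then show "R (q \<otimes>\<^bsub>P\<^esub> p) = s p *\<^sub>R (transpose (ch p) *v R q) + s q *\<^sub>R R p"
      using coc by blast
  qed
qed

end

subsection \<open>Jointly measurable representatives\<close>

context analytic_band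
begin

text \<open>By monotone convergence the sum of the squared norms has a finite integral over the
  cell. It is finite almost everywhere there, and the terms of a convergent series tend to
  zero.\<close>

lemma L2_summable_imp_AE_tendsto:
  fixes f :: "nat \<Rightarrow> real^'d \<Rightarrow> complex^'m"
  assumes f: "\<And>n. L2 (f n)" and sum: "summable (\<lambda>n. (N (f n))\<^sup>2)"
  shows "AE r in lborel. r \<in> unit_cell L \<longrightarrow> (\<lambda>n. f n r) \<longlonglongrightarrow> 0"
proof -
  let ?g = "\<lambda>n r. indicator (unit_cell L) r * (norm (f n r))\<^sup>2"
  have fm[measurable]: "f n \<in> borel_measurable borel" for n by (rule L2_measurable[OF f])
  have gn: "(\<integral>\<^sup>+r. ennreal (?g n r) \<partial>lborel) = ennreal ((N (f n))\<^sup>2)" for n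
  proof -
    have "integrable lborel (?g n)"
      using square_integrable_onD(2)[OF f[of n]] by (simp add: set_integrable_def)
    then have "(\<integral>\<^sup>+r. ennreal (?g n r) \<partial>lborel) = ennreal (integral\<^sup>L lborel (?g n))"
      by (rule nn_integral_eq_integral) simp
    then show ?thesis by (simp add: N_square set_lebesgue_integral_def)
  qed
  have "(\<integral>\<^sup>+r. (\<Sum>n. ennreal (?g n r)) \<partial>lborel) = (\<Sum>n. \<integral>\<^sup>+r. ennreal (?g n r) \<partial>lborel)"
    by (rule nn_integral_suminf) measurable
  also have "\<dots> = ennreal (\<Sum>n. (N (f n))\<^sup>2)"
    unfolding gn by (rule suminf_ennreal2[OF _ sum]) simp
  finally have "(\<integral>\<^sup>+r. (\<Sum>n. ennreal (?g n r)) \<partial>lborel) \<noteq> \<infinity>" by simp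
  then have "AE r in lborel. (\<Sum>n. ennreal (?g n r)) \<noteq> \<infinity>"
    by (intro nn_integral_PInf_AE) measurable
  then show ?thesis
  proof eventually_elim
    case (elim r)
    show ?case
    proof
      assume r: "r \<in> unit_cell L"
      have "summable (\<lambda>n. ?g n r)" by (rule summable_suminf_not_top) (use elim in auto)
      then have "summable (\<lambda>n. (norm (f n r))\<^sup>2)" using r by simp
      then have "(\<lambda>n. (norm (f n r))\<^sup>2) \<longlonglongrightarrow> 0" by (rule summable_LIMSEQ_zero)
      then have "(\<lambda>n. sqrt ((norm (f n r))\<^sup>2)) \<longlonglongrightarrow> sqrt 0" by (rule tendsto_real_sqrt)
      then show "(\<lambda>n. f n r) \<longlonglongrightarrow> 0" by (simp add: tendsto_norm_zero_iff)
    qed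
  qed
qed

text \<open>
  Approximate \<open>\<psi> k\<close> by the first member of a countable dense subfamily that is \<open>2\<^sup>-\<^sup>n\<close>-close
  to it; these approximations are jointly measurable and converge almost everywhere for each \<open>k\<close>.
\<close>

lemma jointly_measurable_representative:
  assumes \<psi>: "band_choice L B \<psi>" and cont: "continuous_choice L \<psi>"
  obtains \<psi>' where "(\<lambda>(k, r). \<psi>' k r) \<in> borel_measurable (borel \<Otimes>\<^sub>M borel)"
    "\<And>k. AE r in lborel. \<psi>' k r = \<psi> k r"
proof -
  let ?u = "periodic_part \<psi>"
  note uL = choice_L2[OF \<psi>]
  obtain Q :: "(real^'d) set" where Q: "countable Q" "\<And>Y. open Y \<Longrightarrow> Y \<noteq> {} \<Longrightarrow> \<exists>d\<in>Q. d \<in> Y"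
    by (rule countable_dense_setE) blast
  have "Q \<noteq> {}" using Q(2)[of UNIV] by auto
  define q where "q = from_nat_into Q"
  have close: "\<exists>e>0. \<forall>k'. dist k' k < e \<longrightarrow> N (\<lambda>r. ?u k' r - ?u k r) < \<epsilon>" if "\<epsilon> > 0" for \<epsilon> k
  proof -
    have "((\<lambda>k'. N (?u k' - ?u k)) \<longlongrightarrow> 0) (at k)" using cont by (simp add: continuous_choice_def)
    then have "eventually (\<lambda>k'. N (?u k' - ?u k) < \<epsilon>) (at k)" by (rule order_tendstoD) (rule that)
    then obtain e where e: "e > 0" "\<And>k'. k' \<noteq> k \<Longrightarrow> dist k' k < e \<Longrightarrow> N (?u k' - ?u k) < \<epsilon>"
      unfolding eventually_at by auto
    have "N (\<lambda>r. ?u k' r - ?u k r) < \<epsilon>" if "dist k' k < e" for k'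
      using e(2)[OF _ that] \<open>\<epsilon> > 0\<close> by (cases "k' = k") (simp_all add: N_zero fun_diff_def)
    then show ?thesis using e(1) by blast
  qed
  have sym: "N (\<lambda>r. ?u k r - ?u k' r) = N (\<lambda>r. ?u k' r - ?u k r)" for k k'
    using N_minus[of "\<lambda>r. ?u k r - ?u k' r"] by simp
  define good where "good n j k \<longleftrightarrow> N (\<lambda>r. ?u (q j) r - ?u k r) < (1/2) ^ n" for n j k
  have good_open: "open {k. good n j k}" for n j
    unfolding open_dist
  proof (intro ballI)
    fix k assume "k \<in> {k. good n j k}"
    then have "(1/2) ^ n - N (\<lambda>r. ?u (q j) r - ?u k r) > 0" by (simp add: good_def)
    then obtain e where e: "e > 0" "\<And>k'. dist k' k < e \<Longrightarrow>
        N (\<lambda>r. ?u k' r - ?u k r) < (1/2) ^ n - N (\<lambda>r. ?u (q j) r - ?u k r)"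
      using close by meson
    have "k' \<in> {k. good n j k}" if "dist k' k < e" for k'
      using e(2)[OF that] N_diff_triangle[OF uL[of "q j"] uL[of k] uL[of k']] sym[of k k']
      by (simp add: good_def)
    then show "\<exists>e>0. \<forall>y. dist y k < e \<longrightarrow> y \<in> {k. good n j k}" using e(1) by blast
  qed
  have good_ex: "\<exists>j. good n j k" for n k
  proof -
    obtain e where e: "e > 0" "\<And>k'. dist k' k < e \<Longrightarrow> N (\<lambda>r. ?u k' r - ?u k r) < (1/2) ^ n"
      using close[of "(1/2) ^ n" k] by auto
    obtain d where "d \<in> Q" "d \<in> ball k e" using Q(2)[of "ball k e"] e(1) by auto
    moreover obtain j where "q j = d"
      using from_nat_into_surj[OF Q(1) \<open>d \<in> Q\<close>] by (auto simp: q_def)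
    ultimately show ?thesis using e(2)[of d] by (auto simp: good_def dist_commute intro!: exI[of _ j])
  qed
  \<comment> \<open>Taking the least admissible index makes the selection measurable, since the sets
    of \<open>k\<close> for which an index is admissible are open.\<close>
  define J where "J n k = (LEAST j. good n j k)" for n k
  have J: "good n (J n k) k" for n k unfolding J_def using good_ex by (rule LeastI_ex)
  have J_meas: "J n \<in> measurable borel (count_space UNIV)" for n
  proof -
    have "(\<lambda>k. good n j k) \<in> measurable borel (count_space UNIV)" for j
      unfolding pred_def using borel_open[OF good_open[of n j]] by simp
    then show ?thesis unfolding J_def[abs_def] by (rule measurable_Least)
  qed
  define v where "v n p = ?u (q (J n (fst p))) (snd p)" for n and p :: "(real^'d) \<times> (real^'d)"
  have v_meas: "v n \<in> borel_measurable (borel \<Otimes>\<^sub>M borel)" for n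
    unfolding v_def
  proof (rule measurable_compose_countable[where f = "\<lambda>j p. ?u (q j) (snd p)" and g = "\<lambda>p. J n (fst p)"])
    show "(\<lambda>p. ?u (q j) (snd p)) \<in> borel_measurable (borel \<Otimes>\<^sub>M borel)" for j
      by (rule measurable_compose[OF measurable_snd L2_measurable[OF uL]])
    show "(\<lambda>p. J n (fst p)) \<in> measurable (borel \<Otimes>\<^sub>M borel) (count_space UNIV)"
      by (rule measurable_compose[OF measurable_fst J_meas])
  qed
  \<comment> \<open>Where the approximations diverge, \<open>lim\<close> has an unspecified value,
    yet the resulting function is measurable; for each \<open>k\<close> this concerns only a null
    set of \<open>r\<close>.\<close>
  define w where "w k r = lim (\<lambda>n. v n (k, r))" for k r
  have w_meas: "(\<lambda>p. lim (\<lambda>n. v n p)) \<in> borel_measurable (borel \<Otimes>\<^sub>M borel)"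
    by (intro borel_measurable_lim_metric v_meas)
  have w_eq: "AE r in lborel. w k r = ?u k r" for k
  proof -
    let ?f = "\<lambda>n r. ?u (q (J n k)) r - ?u k r"
    have "summable (\<lambda>n. (N (?f n))\<^sup>2)"
    proof (rule summable_comparison_test'[of "\<lambda>n. (1/4 :: real) ^ n" 0])
      fix n
      have "(N (?f n))\<^sup>2 \<le> ((1/2) ^ n)\<^sup>2"
        using J[of n k] by (intro power_mono N_nonneg) (simp add: good_def less_imp_le)
      then show "norm ((N (?f n))\<^sup>2) \<le> (1/4) ^ n"
        by (simp add: power_even_eq[symmetric] power_mult[symmetric] power_divide power2_eq_square mult.commute power_mult_distrib[symmetric])
    qed simp
    then have "AE r in lborel. r \<in> unit_cell L \<longrightarrow> (\<lambda>n. ?f n r) \<longlonglongrightarrow> 0"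
      by (intro L2_summable_imp_AE_tendsto L2_diff uL)
    \<comment> \<open>The norms control only the cell; periodicity carries the convergence to all of
      space.\<close>
    then have 1: "AE r in lborel. (\<lambda>n. ?f n (cell_rep r)) \<longlonglongrightarrow> 0"
      by (rule AE_cell_rep)
    have per: "AE r in lborel. ?u l (cell_rep r) = ?u l r" for l
      by (rule AE_cell_rep_eq) (rule torus_L2_periodic[OF choice_torus[OF \<psi>]])
    have 2: "AE r in lborel. \<forall>n. ?u (q (J n k)) (cell_rep r) = ?u (q (J n k)) r"
      using per by (simp add: AE_all_countable)
    from 1 2 per[of k] show ?thesis
    proof eventually_elim
      case (elim r)
      then have "(\<lambda>n. ?u (q (J n k)) r - ?u k r) \<longlonglongrightarrow> 0" by simp
      then have "(\<lambda>n. v n (k, r)) \<longlonglongrightarrow> ?u k r" by (simp add: v_def LIM_zero_iff)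
      then show ?case unfolding w_def by (rule limI)
    qed
  qed
  show ?thesis
  proof
    have "(\<lambda>p. fst p \<bullet> snd p) \<in> borel_measurable (borel \<Otimes>\<^sub>M borel :: ((real^'d) \<times> (real^'d)) measure)"
      by measurable
    then have "(\<lambda>p. cis (fst p \<bullet> snd p) *s lim (\<lambda>n. v n p)) \<in> borel_measurable (borel \<Otimes>\<^sub>M borel)"
      by (intro measurable_vec_smult w_meas measurable_compose[OF _ measurable_cis])
    then show "(\<lambda>(k, r). cis (k \<bullet> r) *s w k r) \<in> borel_measurable (borel \<Otimes>\<^sub>M borel)"
      by (simp add: case_prod_unfold w_def)
    fix k
    show "AE r in lborel. cis (k \<bullet> r) *s w k r = \<psi> k r"
      using w_eq[of k] by eventually_elim (simp add: periodic_part_def vector_smult_assoc cis_mult)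
  qed
qed

lemma measurable_section:
  assumes "(\<lambda>(k, r). \<psi> k r) \<in> borel_measurable (borel \<Otimes>\<^sub>M borel)"
  shows "\<psi> k \<in> borel_measurable borel"
  using measurable_compose[OF measurable_Pair1'[of k borel borel] assms] by simp

lemma band_choice_cong_AE:
  assumes \<psi>: "band_choice L B \<psi>" and m: "\<And>k. \<psi>' k \<in> borel_measurable borel"
    and ae: "\<And>k. AE r in lborel. \<psi>' k r = \<psi> k r"
  shows "band_choice L B \<psi>'"
  unfolding band_choice_def
proof (intro allI conjI)
  fix k
  obtain \<phi> where \<phi>: "bloch_function L k \<phi>" "cell_norm L \<phi> = 1" "B k = ae_span \<phi>" using band_line by blast
  obtain a where a: "AE r in lborel. \<psi> k r = a *s \<phi> r" using choice_phase[OF \<psi> \<phi>] by blast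
  have "AE r in lborel. \<psi>' k r = a *s \<phi> r" using a ae[of k] by eventually_elim simp
  then show "\<psi>' k \<in> B k" unfolding \<phi>(3) ae_span_def using m by blast
  have "N (\<psi>' k) = N (\<psi> k)" by (rule cell_norm_cong_AE[OF m choice_measurable[OF \<psi>] ae])
  then show "N (\<psi>' k) = 1" using \<psi> by (simp add: band_choice_def)
qed

lemma periodic_part_cong_AE:
  assumes "AE r in lborel. \<psi>' k r = \<psi> k r"
  shows "AE r in lborel. periodic_part \<psi>' k r = periodic_part \<psi> k r"
  using assms by eventually_elim (simp add: periodic_part_def)

lemma analytic_gauge_cong_AE:
  assumes \<psi>: "analytic_gauge \<psi>" and ch': "band_choice L B \<psi>'"
    and ae: "\<And>k. AE r in lborel. \<psi>' k r = \<psi> k r"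
  shows "analytic_gauge \<psi>'"
proof -
  have ch: "band_choice L B \<psi>" using \<psi> by (simp add: analytic_gauge_def)
  have "H (periodic_part \<psi>' k) (periodic_part \<psi>' l) = H (periodic_part \<psi> k) (periodic_part \<psi> l)" for k l
    by (intro cell_inner_cong_AE L2_measurable choice_L2 ch ch' periodic_part_cong_AE ae)
  then show ?thesis using \<psi> ch' by (simp add: analytic_gauge_def)
qed

lemma periodic_choice_cong_AE:
  assumes per: "periodic_choice L \<psi>" and ae: "\<And>k. AE r in lborel. \<psi>' k r = \<psi> k r"
  shows "periodic_choice L \<psi>'"
  unfolding periodic_choice_def
proof (intro allI ballI)
  fix k K assume "K \<in> reciprocal_lattice L"
  then have "AE r in lborel. \<psi> (k + K) r = \<psi> k r" using per by (simp add: periodic_choice_def)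
  with ae[of k] ae[of "k + K"] show "AE r in lborel. \<psi>' (k + K) r = \<psi>' k r" by eventually_elim simp
qed

end

section \<open>Wannier functions\<close>

text \<open>Fubini for null sets. Identities between choices hold for each \<open>k\<close> off a
  null set of \<open>r\<close> that depends on \<open>k\<close>, whereas the Wannier integral is
  taken over \<open>k\<close> at fixed \<open>r\<close>.\<close>

lemma AE_swap_eq:
  fixes F G :: "(real^'d) \<times> (real^'d) \<Rightarrow> complex^'m"
  assumes F: "F \<in> borel_measurable (borel \<Otimes>\<^sub>M borel)" and G: "G \<in> borel_measurable (borel \<Otimes>\<^sub>M borel)"
    and ae: "\<And>k. AE r in lborel. F (k, r) = G (k, r)"
  shows "AE r in lborel. AE k in lborel. F (k, r) = G (k, r)"
proof -
  have s: "sets (lborel \<Otimes>\<^sub>M lborel :: ((real^'d) \<times> (real^'d)) measure) = sets (borel \<Otimes>\<^sub>M borel)"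
    by (rule sets_pair_measure_cong) auto
  have "F \<in> borel_measurable (lborel \<Otimes>\<^sub>M lborel)" "G \<in> borel_measurable (lborel \<Otimes>\<^sub>M lborel)"
    using F G by (simp_all add: measurable_cong_sets[OF s refl])
  then have "{p \<in> space (lborel \<Otimes>\<^sub>M lborel). F p = G p} \<in> sets (lborel \<Otimes>\<^sub>M lborel)"
    by measurable
  then have "{p \<in> space (lborel \<Otimes>\<^sub>M lborel). F (fst p, snd p) = G (fst p, snd p)} \<in> sets (lborel \<Otimes>\<^sub>M lborel)"
    by simp
  from lborel_pair.AE_commute[of "\<lambda>k r. F (k, r) = G (k, r)", OF this] show ?thesis using ae by simp
qed

text \<open>Scaling by \<open>c\<close> is either zero or has a bounded inverse, and for such maps
  the integral commutes with the map even if the integrand is not integrable.\<close>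

lemma set_integral_vec_smult:
  fixes f :: "'x \<Rightarrow> complex^'m"
  shows "(LINT x:A|M. c *s f x) = c *s (LINT x:A|M. f x)"
proof -
  have bl: "bounded_linear ((*s) b :: complex^'m \<Rightarrow> complex^'m)" for b
    by (rule bounded_bilinear.bounded_linear_right[OF bounded_bilinear_vec_smult])
  have "integral\<^sup>L M (\<lambda>x. c *s (indicator A x *\<^sub>R f x)) = c *s integral\<^sup>L M (\<lambda>x. indicator A x *\<^sub>R f x)"
  proof (rule integral_bounded_linear'[OF bl bl[of "inverse c"]])
    assume "\<not> (\<forall>x :: complex^'m. c *s x = 0)"
    then have "c \<noteq> 0" by auto
    then show "\<forall>x :: complex^'m. inverse c *s (c *s x) = x" by (simp add: vector_smult_assoc)
  qed
  moreover have "indicator A x *\<^sub>R (c *s f x) = c *s (indicator A x *\<^sub>R f x)" for x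
    by (simp add: indicator_def)
  ultimately show ?thesis unfolding set_lebesgue_integral_def by simp
qed

context symmetric_band
begin

text \<open>The multiplication law makes this operator idempotent, and an injective idempotent map
  is the identity.\<close>

lemma D_one:
  shows "D \<one>\<^bsub>P\<^esub> v = v"
proof -
  have "D \<one>\<^bsub>P\<^esub> (D \<one>\<^bsub>P\<^esub> v) = D \<one>\<^bsub>P\<^esub> v" using D_mult[of "\<one>\<^bsub>P\<^esub>" "\<one>\<^bsub>P\<^esub>" v] by simp
  then show ?thesis using D_bij[of "\<one>\<^bsub>P\<^esub>"] by (simp add: bij_def inj_eq)
qed

text \<open>Antiunitary operators are still bounded and linear over the reals. The operator of the
  inverse group element provides the inverse that dispenses with integrability.\<close>

lemma set_integral_D:
  assumes p: "p \<in> carrier P"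
  shows "(LINT x:A|M. D p (f x)) = D p (LINT x:A|M. f x)"
proof -
  have "integral\<^sup>L M (\<lambda>x. D p (indicator A x *\<^sub>R f x)) = D p (integral\<^sup>L M (\<lambda>x. indicator A x *\<^sub>R f x))"
  proof (rule integral_bounded_linear'[OF D_bounded_linear[OF p] D_bounded_linear[OF P.inv_closed[OF p]]])
    have "D (inv\<^bsub>P\<^esub> p) (D p x) = x" for x
      using D_mult[of "inv\<^bsub>P\<^esub> p" p x] p by (simp add: D_one)
    then show "\<forall>x. D (inv\<^bsub>P\<^esub> p) (D p x) = x" by blast
  qed
  moreover have "indicator A x *\<^sub>R D p (f x) = D p (indicator A x *\<^sub>R f x)" for x
    using linear_0[OF bounded_linear.linear[OF D_bounded_linear[OF p]]] by (auto simp: indicator_def)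
  ultimately show ?thesis unfolding set_lebesgue_integral_def by simp
qed

text \<open>The translations \<open>T p\<close> form a crossed homomorphism, and the group average
  exhibits it as a coboundary. Division by the group order happens in real space, so
  \<open>w\<close> is in general no lattice vector even if all \<open>R p\<close> are.\<close>

lemma linear_phase_center:
  assumes coc: "\<And>q p. q \<in> carrier P \<Longrightarrow> p \<in> carrier P \<Longrightarrow>
      R (q \<otimes>\<^bsub>P\<^esub> p) = s p *\<^sub>R (transpose (ch p) *v R q) + s q *\<^sub>R R p"
  obtains w where "\<And>p. p \<in> carrier P \<Longrightarrow> ch p *v w = w - s p *\<^sub>R (ch p *v R p)"
proof
  define T where "T p = - (s p *\<^sub>R (ch p *v R p))" for p
  have T: "T (q \<otimes>\<^bsub>P\<^esub> p) = T q + ch q *v T p" if q: "q \<in> carrier P" and p: "p \<in> carrier P" for q p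
  proof -
    have "ch (q \<otimes>\<^bsub>P\<^esub> p) *v R (q \<otimes>\<^bsub>P\<^esub> p) =
        ch q *v (ch p *v (s p *\<^sub>R (transpose (ch p) *v R q) + s q *\<^sub>R R p))"
      by (simp add: coc[OF q p] ch_mult[OF q p] matrix_vector_mul_assoc)
    also have "\<dots> = s p *\<^sub>R (ch q *v R q) + s q *\<^sub>R (ch q *v (ch p *v R p))"
      by (simp add: matrix_vector_right_distrib matrix_vector_mult_scaleR
          orthogonal_matrix_mult_self[OF orthogonal[OF p]])
    finally show ?thesis
      using s_square[OF p] s_square[OF q]
      by (simp add: T_def s_mult[OF q p] scaleR_add_right matrix_vector_mult_scaleR mult_ac
          matrix_vector_mult_diff_distrib[of "ch q" 0, simplified])
  qed
  define n where "n = real (card (carrier P))"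
  have n: "n > 0" using finite_P P.one_closed by (auto simp: n_def card_gt_0_iff)
  define S where "S = (\<Sum>q\<in>carrier P. T q)"
  fix p assume p: "p \<in> carrier P"
  have bij: "bij_betw (\<lambda>q. p \<otimes>\<^bsub>P\<^esub> q) (carrier P) (carrier P)"
    by (rule bij_betwI[where g = "\<lambda>q. inv\<^bsub>P\<^esub> p \<otimes>\<^bsub>P\<^esub> q"]) (use p in \<open>auto simp: P.m_assoc[symmetric]\<close>)
  have "ch p *v S = (\<Sum>q\<in>carrier P. ch p *v T q)"
    unfolding S_def by (simp only: linear_sum[OF matrix_vector_mul_linear])
  also have "\<dots> = (\<Sum>q\<in>carrier P. T (p \<otimes>\<^bsub>P\<^esub> q) - T p)"
    by (rule sum.cong) (simp_all add: T[OF p])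
  also have "\<dots> = (\<Sum>q\<in>carrier P. T (p \<otimes>\<^bsub>P\<^esub> q)) - n *\<^sub>R T p"
    by (simp only: sum_subtractf n_def sum_constant_scaleR)
  also have "(\<Sum>q\<in>carrier P. T (p \<otimes>\<^bsub>P\<^esub> q)) = S"
    unfolding S_def by (rule sum.reindex_bij_betw[OF bij])
  finally have "ch p *v ((- (1 / n)) *\<^sub>R S) = (- (1 / n)) *\<^sub>R S + T p"
    using n by (simp add: matrix_vector_mult_scaleR scaleR_diff_right
        matrix_vector_mult_diff_distrib[of "ch p" 0, simplified])
  then show "ch p *v ((- (1 / n)) *\<^sub>R (\<Sum>q\<in>carrier P. T q)) =
      (- (1 / n)) *\<^sub>R (\<Sum>q\<in>carrier P. T q) - s p *\<^sub>R (ch p *v R p)"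
    by (simp add: S_def T_def)
qed

text \<open>
  Applying \<open>(p|R')\<close> under the integral turns \<open>exp (- i k R0) \<psi>\<^sub>k\<close> into a multiple of
  \<open>exp (- i k' R0) \<psi>\<^sub>k\<^sub>'\<close> with \<open>k' = rot p k\<close>, and \<open>rot p\<close> preserves integrals of
  periodic functions over the Brillouin torus.
\<close>

lemma wannier_eigenfunction:
  assumes \<psi>: "band_choice L B \<psi>" and per: "periodic_choice L \<psi>"
    and m: "(\<lambda>(k, r). \<psi> k r) \<in> borel_measurable (borel \<Otimes>\<^sub>M borel)"
    and p: "p \<in> carrier P" and R': "R' \<in> L" and R0: "R0 \<in> L"
    and lin: "\<And>k. rho \<psi> p k = cis (k \<bullet> Rp + a)"
    and fixed: "ch p *v R0 + R' - s p *\<^sub>R (ch p *v Rp) = R0"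
  shows "AE r in lborel. spinor_act P ch L D (p, R') (wannier L \<psi> R0) r = cis a *s wannier L \<psi> R0 r"
proof -
  let ?RL = "reciprocal_lattice L" and ?u = "periodic_part \<psi>"
  interpret RL: full_lattice ?RL by unfold_locales (rule full_rank_reciprocal)
  let ?C = "unit_cell ?RL" and ?y = "\<lambda>r. transpose (ch p) *v (r - R')"
  define G where "G r l = cis (- (l \<bullet> R0)) *s \<psi> l r" for r l
  have G_joint: "(\<lambda>x. G (snd x) (fst x)) \<in> borel_measurable (borel \<Otimes>\<^sub>M borel)"
  proof -
    have "(\<lambda>x :: (real^'d) \<times> (real^'d). cis (- (fst x \<bullet> R0))) \<in> borel_measurable (borel \<Otimes>\<^sub>M borel)"
      by (rule measurable_compose[OF measurable_fst, where g = "\<lambda>l. cis (- (l \<bullet> R0))"])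
        (intro borel_measurable_continuous_onI continuous_intros)
    then show ?thesis
      unfolding G_def using m by (intro measurable_vec_smult) (simp_all add: case_prod_unfold)
  qed
  have G_meas: "G r \<in> borel_measurable borel" for r
    using measurable_compose[OF measurable_Pair2'[of r borel borel] G_joint] by simp
  have \<psi>u: "\<psi> l r = cis (l \<bullet> r) *s ?u l r" for l r
    by (simp add: periodic_part_def vector_smult_assoc cis_mult)
  have pointwise: "AE r in lborel. D p (cis (- (k \<bullet> R0)) *s \<psi> k (?y r)) = cis a *s G r (rot p k)" for k
  proof -
    have "AE r in lborel. act p (?u k) (r + - R') = rho \<psi> p k *s ?u (rot p k) (r + - R')"
      by (rule AE_lborel_translate[OF rho(1)[OF \<psi> p]])
    moreover have "AE r in lborel. ?u (rot p k) (r + - R') = ?u (rot p k) r"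
      by (rule torus_L2_periodic[OF choice_torus[OF \<psi>] lattice_minus[OF R']])
    ultimately show ?thesis
    proof eventually_elim
      case (elim r)
      \<comment> \<open>All exponents are rewritten as pairings with \<open>rot p k\<close>. The
        lattice vectors paired with it then combine into the left-hand side of \<open>fixed\<close>,
        which leaves \<open>R0\<close> alone.\<close>
      have ky: "s p * (k \<bullet> ?y r) = rot p k \<bullet> (r - R')" "s p * (k \<bullet> R0) = rot p k \<bullet> (ch p *v R0)"
        "k \<bullet> Rp = rot p k \<bullet> (s p *\<^sub>R (ch p *v Rp))"
        using s_square[OF p]
        by (simp_all add: rot_inner matrix_vector_mult_scaleR orthogonal_matrix_mult_self[OF orthogonal[OF p]])
      have "D p (cis (- (k \<bullet> R0)) *s \<psi> k (?y r)) =
          cis (- (s p * (k \<bullet> R0))) *s (cis (s p * (k \<bullet> ?y r)) *s D p (?u k (?y r)))"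
        unfolding \<psi>u[of k] D_smult[OF p] cj_cis[OF s_cases[OF p]] by simp
      also have "D p (?u k (?y r)) = cis (k \<bullet> Rp + a) *s ?u (rot p k) r"
        using elim by (simp add: act_def lin)
      also have "?u (rot p k) r = cis (- (rot p k \<bullet> r)) *s \<psi> (rot p k) r"
        by (simp add: periodic_part_def)
      also have "cis (- (s p * (k \<bullet> R0))) *s (cis (s p * (k \<bullet> ?y r)) *s (cis (k \<bullet> Rp + a) *s
          (cis (- (rot p k \<bullet> r)) *s \<psi> (rot p k) r))) =
          cis (- (s p * (k \<bullet> R0)) + (s p * (k \<bullet> ?y r) + (k \<bullet> Rp + a + - (rot p k \<bullet> r)))) *s \<psi> (rot p k) r"
        by (simp only: vector_smult_assoc cis_mult)
      also have "- (s p * (k \<bullet> R0)) + (s p * (k \<bullet> ?y r) + (k \<bullet> Rp + a + - (rot p k \<bullet> r))) =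
          a + - (rot p k \<bullet> (ch p *v R0 + R' - s p *\<^sub>R (ch p *v Rp)))"
        unfolding ky by (simp add: inner_add_right inner_diff_right)
      also have "\<dots> = a + - (rot p k \<bullet> R0)" by (simp only: fixed)
      finally show ?case by (simp add: G_def vector_smult_assoc cis_mult)
    qed
  qed
  have rot_meas: "rot p \<in> borel_measurable borel"
    unfolding rot_matrix[abs_def] by (rule measurable_matrix_mult)
  have y_meas: "?y \<in> borel_measurable borel"
    by (intro borel_measurable_continuous_onI continuous_on_compose2[OF matrix_vector_mult_linear_continuous_on]
        continuous_intros) auto
  let ?F1 = "\<lambda>x. D p (G (?y (snd x)) (fst x))" and ?F2 = "\<lambda>x. cis a *s G (snd x) (rot p (fst x))"
  have F1: "?F1 \<in> borel_measurable (borel \<Otimes>\<^sub>M borel)"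
  proof (rule D_measurable[OF p])
    have "(\<lambda>x. (fst x, ?y (snd x))) \<in> borel \<Otimes>\<^sub>M borel \<rightarrow>\<^sub>M borel \<Otimes>\<^sub>M borel"
      by (intro measurable_Pair measurable_fst measurable_compose[OF measurable_snd y_meas])
    from measurable_compose[OF this G_joint]
    show "(\<lambda>x. G (?y (snd x)) (fst x)) \<in> borel_measurable (borel \<Otimes>\<^sub>M borel)" by simp
  qed
  have F2: "?F2 \<in> borel_measurable (borel \<Otimes>\<^sub>M borel)"
  proof (rule measurable_vec_smult)
    have "(\<lambda>x. (rot p (fst x), snd x)) \<in> borel \<Otimes>\<^sub>M borel \<rightarrow>\<^sub>M borel \<Otimes>\<^sub>M borel"
      by (intro measurable_Pair measurable_snd measurable_compose[OF measurable_fst rot_meas])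
    from measurable_compose[OF this G_joint]
    show "(\<lambda>x. G (snd x) (rot p (fst x))) \<in> borel_measurable (borel \<Otimes>\<^sub>M borel)" by simp
  qed simp
  have swap1: "AE r in lborel. AE k in lborel. ?F1 (k, r) = ?F2 (k, r)"
    by (rule AE_swap_eq[OF F1 F2]) (use pointwise in \<open>simp add: G_def\<close>)
  have "AE r in lborel. AE k in lborel. G r (k + K) = G r k" if K: "K \<in> ?RL" for K
  proof -
    have "(\<lambda>x. (fst x + K, snd x)) \<in> borel \<Otimes>\<^sub>M borel \<rightarrow>\<^sub>M borel \<Otimes>\<^sub>M (borel :: (real^'d) measure)"
      by (intro measurable_Pair measurable_snd borel_measurable_add measurable_fst borel_measurable_const)
    from measurable_compose[OF this G_joint]
    have "(\<lambda>x. G (snd x) (fst x + K)) \<in> borel_measurable (borel \<Otimes>\<^sub>M borel)" by simp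
    from AE_swap_eq[OF this G_joint]
    have "(\<And>k. AE r in lborel. G r (k + K) = G r k) \<Longrightarrow> AE r in lborel. AE k in lborel. G r (k + K) = G r k"
      by simp
    moreover have "AE r in lborel. G r (k + K) = G r k" for k
    proof -
      have "AE r in lborel. \<psi> (k + K) r = \<psi> k r" using per K by (simp add: periodic_choice_def)
      moreover have "cis (- ((k + K) \<bullet> R0)) = cis (- (k \<bullet> R0))"
      proof -
        have "cis (- (K \<bullet> R0)) = 1"
          using reciprocal_lattice_inner[OF K lattice_minus[OF R0]] by simp
        then have "cis (- (k \<bullet> R0)) * cis (- (K \<bullet> R0)) = cis (- (k \<bullet> R0))" by simp
        then show ?thesis by (simp add: cis_mult inner_add_left)
      qed
      ultimately show ?thesis by (auto simp: G_def)
    qed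
    ultimately show ?thesis by blast
  qed
  then have swap2: "AE r in lborel. \<forall>K\<in>?RL. AE k in lborel. G r (k + K) = G r k"
    by (intro AE_ball_countable' RL.countable_lattice)
  \<comment> \<open>The sign of a time-reversing element does not disturb orthogonality, so the
    invariance of cell integrals applies to \<open>rot p\<close> acting on the Brillouin
    torus.\<close>
  have orth: "orthogonal_matrix (s p *\<^sub>R ch p)"
    using orthogonal[OF p] s_square[OF p]
    by (simp add: orthogonal_matrix_def matrix_eq matrix_vector_mul_assoc[symmetric] transpose_scalar
        scaleR_matrix_vector_assoc[symmetric] matrix_vector_mult_scaleR)
  have rotRL: "(*v) (s p *\<^sub>R ch p) ` ?RL = ?RL"
  proof -
    have "rot p ` ?RL = ?RL"
    proof (intro equalityI subsetI)
      fix K assume K: "K \<in> ?RL"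
      have "rot p (rot (inv\<^bsub>P\<^esub> p) K) = rot \<one>\<^bsub>P\<^esub> K"
        using p by (simp add: rot_mult[symmetric])
      also have "\<dots> = K" by (simp add: rot_def s_one ch_one)
      finally show "K \<in> rot p ` ?RL"
        using rot_reciprocal[OF P.inv_closed[OF p] K] by (metis image_eqI)
    qed (auto intro: rot_reciprocal[OF p])
    then show ?thesis by (simp add: rot_matrix[abs_def])
  qed
  have wan: "wannier L \<psi> R0 r = (1 / sqrt (measure lborel ?C)) *\<^sub>R (LINT k:?C|lborel. G r k)" for r
    by (simp add: wannier_def G_def)
  from swap1 swap2 show ?thesis
  proof eventually_elim
    case (elim r)
    have c1: "(\<lambda>k. D p (G (?y r) k)) \<in> borel_measurable borel" by (intro D_measurable p G_meas)
    have c2: "(\<lambda>k. cis a *s G r (rot p k)) \<in> borel_measurable borel"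
      by (intro measurable_vec_smult measurable_compose[OF rot_meas G_meas]) simp
    have "spinor_act P ch L D (p, R') (wannier L \<psi> R0) r = D p (wannier L \<psi> R0 (?y r))"
      by (rule spinor_act_eq[OF p R'])
    also have "\<dots> = (1 / sqrt (measure lborel ?C)) *\<^sub>R (LINT k:?C|lborel. D p (G (?y r) k))"
      by (simp only: wan linear_scale[OF bounded_linear.linear[OF D_bounded_linear[OF p]]] set_integral_D[OF p])
    also have "(LINT k:?C|lborel. D p (G (?y r) k)) = (LINT k:?C|lborel. cis a *s G r (rot p k))"
      by (rule set_lebesgue_integral_cong_AE) (use elim(1) c1 c2 in auto)
    also have "\<dots> = cis a *s (LINT k:?C|lborel. G r ((s p *\<^sub>R ch p) *v k))"
      by (simp only: set_integral_vec_smult rot_matrix)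
    also have "(LINT k:?C|lborel. G r ((s p *\<^sub>R ch p) *v k)) = (LINT k:?C|lborel. G r k)"
      by (rule RL.cell_integral_orthogonal[OF G_meas _ orth rotRL]) (use elim(2) in blast)
    also have "(1 / sqrt (measure lborel ?C)) *\<^sub>R (cis a *s (LINT k:?C|lborel. G r k)) = cis a *s wannier L \<psi> R0 r"
      by (simp add: wan scaleR_vec_smult vector_smult_assoc mult.commute)
    finally show ?case .
  qed
qed

theorem trivial_imp_band_representation:
  assumes "topologically_trivial L B"
  shows "band_representation P ch L D B"
proof -
  obtain \<psi>0 where \<psi>0: "band_choice L B \<psi>0" "continuous_choice L \<psi>0" "periodic_choice L \<psi>0"
    using assms unfolding topologically_trivial_def by blast
  obtain \<psi>1 where \<psi>1: "analytic_gauge \<psi>1" "periodic_choice L \<psi>1"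
    using continuous_imp_analytic_gauge[OF \<psi>0] .
  obtain \<psi>2 R a where \<psi>2: "analytic_gauge \<psi>2" "periodic_choice L \<psi>2"
    and R: "\<And>p. p \<in> carrier P \<Longrightarrow> R p \<in> L"
    and coc: "\<And>q p. q \<in> carrier P \<Longrightarrow> p \<in> carrier P \<Longrightarrow>
      R (q \<otimes>\<^bsub>P\<^esub> p) = s p *\<^sub>R (transpose (ch p) *v R q) + s q *\<^sub>R R p"
    and lin: "\<And>p k. p \<in> carrier P \<Longrightarrow> rho \<psi>2 p k = cis (k \<bullet> R p + a p)"
    by (rule linear_phase_gauge[OF \<psi>1]) blast
  have ch2: "band_choice L B \<psi>2" using \<psi>2(1) by (simp add: analytic_gauge_def)
  have cont2: "continuous_choice L \<psi>2"
    by (rule analytic_choice_imp_continuous[OF ch2 analytic_gauge_imp_analytic_choice[OF \<psi>2(1)]])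
  \<comment> \<open>Measurable representatives are introduced after all phases are fixed. Gauge,
    periodicity and \<open>rho\<close> depend only on classes modulo null sets and pass to the new
    representatives.\<close>
  obtain \<psi> where m: "(\<lambda>(k, r). \<psi> k r) \<in> borel_measurable (borel \<Otimes>\<^sub>M borel)"
    and ae: "\<And>k. AE r in lborel. \<psi> k r = \<psi>2 k r"
    by (rule jointly_measurable_representative[OF ch2 cont2]) blast
  have ch: "band_choice L B \<psi>" by (rule band_choice_cong_AE[OF ch2 measurable_section[OF m] ae])
  have gauge: "analytic_gauge \<psi>" by (rule analytic_gauge_cong_AE[OF \<psi>2(1) ch ae])
  have per: "periodic_choice L \<psi>" by (rule periodic_choice_cong_AE[OF \<psi>2(2) ae])
  have rho_eq: "rho \<psi> p k = cis (k \<bullet> R p + a p)" if p: "p \<in> carrier P" for p k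
  proof -
    have "rho \<psi> p k = rho \<psi>2 p k"
      unfolding rho_def
      by (intro cell_inner_cong_AE L2_measurable choice_L2 ch ch2 act_measurable p act_cong_AE
          periodic_part_cong_AE ae)
    then show ?thesis by (simp add: lin[OF p])
  qed
  obtain w where w: "\<And>p. p \<in> carrier P \<Longrightarrow> ch p *v w = w - s p *\<^sub>R (ch p *v R p)"
    by (rule linear_phase_center[OF coc]) blast+
  have T: "s p *\<^sub>R (ch p *v R p) \<in> L" if p: "p \<in> carrier P" for p
    using s_cases[OF p] ch_lattice_mem[OF p R[OF p]] lattice_minus by auto
  have "unit_multiplicity P ch L w"
    unfolding unit_multiplicity_def
  proof
    fix g assume "g \<in> carrier (space_group P ch L)"
    then obtain p R' where g: "g = (p, R')" "p \<in> carrier P" "R' \<in> L" by (auto simp: space_group_def)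
    have "space_act ch g w - w = R' - s p *\<^sub>R (ch p *v R p)"
      using w[OF g(2)] by (simp add: space_act_def g(1))
    then show "space_act ch g w - w \<in> L" using lattice_diff[OF g(3) T[OF g(2)]] by simp
  qed
  moreover have "\<exists>c. norm c = 1 \<and> (AE r in lborel.
      spinor_act P ch L D g (wannier L \<psi> R0) r = c *s wannier L \<psi> R0 r)"
    if R0: "R0 \<in> L" and g: "g \<in> site_stabilizer P ch L (w + R0)" for R0 g
  proof -
    obtain p R' where g': "g = (p, R')" "p \<in> carrier P" "R' \<in> L" "space_act ch (p, R') (w + R0) = w + R0"
      using g by (auto simp: site_stabilizer_def space_group_def)
    \<comment> \<open>In the fixed-point equation for \<open>w + R0\<close> the center
      \<open>w\<close> cancels against its image under \<open>p\<close>, which leaves a relation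
      between lattice vectors.\<close>
    then have "ch p *v R0 + R' - s p *\<^sub>R (ch p *v R p) = R0"
      using w[OF g'(2)] by (simp add: space_act_def matrix_vector_right_distrib algebra_simps)
    from wannier_eigenfunction[OF ch per m g'(2,3) R0 rho_eq[OF g'(2)] this]
    show ?thesis unfolding g'(1) by (intro exI[of _ "cis (a p)"]) simp
  qed
  ultimately show ?thesis
    unfolding band_representation_def
    using ch analytic_gauge_imp_analytic_choice[OF gauge] per m by blast
qed

lemma band_representation_imp_trivial:
  assumes "band_representation P ch L D B"
  shows "topologically_trivial L B"
  using assms analytic_choice_imp_continuous
  unfolding band_representation_def topologically_trivial_def by blast

end

theorem mainTheorem6:
  fixes BL :: "(real^'d) set"
    and P :: "'p monoid"
    and ch :: "'p \<Rightarrow> real^'d^'d"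
    and s :: "'p \<Rightarrow> real"
    and Ebar :: 'p
    and D :: "'p \<Rightarrow> complex^'m \<Rightarrow> complex^'m"
    and B :: "real^'d \<Rightarrow> (real^'d \<Rightarrow> complex^'m) set"
  assumes "full_rank_lattice BL"
    and "double_point_group P ch s Ebar BL"
    and "broken_time_reversal P ch s"
    and "spinor_representation P s Ebar D"
    and "simple_band P ch s BL D B"
    and "analytic_projection BL B"
  shows "band_representation P ch BL D B \<longleftrightarrow> topologically_trivial BL B"
proof -
  have line: "\<exists>\<phi>. bloch_function BL k \<phi> \<and> cell_norm BL \<phi> = 1 \<and> B k = ae_span \<phi>" for k
    using assms(5) unfolding simple_band_def by blast
  interpret symmetric_band BL B P ch s Ebar D
    by unfold_locales (use assms line in auto)
  show ?thesis
    using trivial_imp_band_representation band_representation_imp_trivial by blast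
qed

end
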